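(* Let $K/\mathbb{Q}$ be a Galois extension of prime degree $d\ge 3$. There exists a normal basis $\beta_1,\dots,\beta_d$ for $K$ over $\mathbb{Q}$ consisting of algebraic integers such that $$h(\beta_i)\le |\Delta_K|^{1/2}$$ for all $1\le i\le d$.
   Context: $\Delta_K$ denotes the discriminant of $K$. A normal basis of a Galois extension $K/\mathbb{Q}$ is a $\mathbb{Q}$-basis of $K$ consisting of the Galois conjugates $\sigma(\beta)$, $\sigma\in\mathrm{Gal}(K/\mathbb{Q})$, of a single element $\beta$. The height $h$ is the absolute multiplicative Weil height: for $\alpha\in K$, $h(\alpha)=\prod_{v\in M(K)}\max\{1,|\alpha|_v\}^{d_v/d}$, where $M(K)$ is the set of places of $K$, $d_v=[K_v:\mathbb{Q}_v]$, and $|\cdot|_v$ extends the usual archimedean or $p$-adic absolute value on $\mathbb{Q}$. *)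

theory Defs
  imports
    Complex_Main
    "HOL-Computational_Algebra.Computational_Algebra"
    "HOL-Algebra.Embedded_Algebras"
    "HOL-Algebra.QuotRing"
    "Jordan_Normal_Form.Determinant"
begin

text \<open>
  An extension field of the rationals is a type of class \<open>field_char_0\<close>, the rationals
  being embedded by \<open>of_rat\<close>; the image of the embedding is the set \<open>\<rat>\<close>. Invariants of the
  field itself take an argument \<open>TYPE('a)\<close>.
\<close>

subsection \<open>Degree, Galois group, normal bases\<close>

text \<open>The scalar multiplications are constants of their own because the rewrite rules of the
  interpretations, stated for \<open>of_int n * x\<close>, would loop with \<open>of_int_mult\<close> and \<open>mult.assoc\<close>.\<close>

definition rat_scale :: "rat \<Rightarrow> 'a::field_char_0 \<Rightarrow> 'a"
  where "rat_scale q x = of_rat q * x"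

definition int_scale :: "int \<Rightarrow> 'a::field_char_0 \<Rightarrow> 'a"
  where "int_scale n x = of_int n * x"

global_interpretation rat_vs: vector_space "rat_scale :: rat \<Rightarrow> 'a::field_char_0 \<Rightarrow> 'a"
  by unfold_locales (simp_all add: rat_scale_def algebra_simps of_rat_add of_rat_mult)

global_interpretation int_mod: Modules.module "int_scale :: int \<Rightarrow> 'a::field_char_0 \<Rightarrow> 'a"
  by unfold_locales (simp_all add: int_scale_def algebra_simps)

text \<open>This is 0 if the extension is infinite.\<close>

definition rat_degree :: "'a::field_char_0 itself \<Rightarrow> nat"
  where "rat_degree _ = rat_vs.dim (UNIV :: 'a set)"

definition rat_Gal :: "('a::field_char_0 \<Rightarrow> 'a) set"
  where "rat_Gal = {\<sigma>. bij \<sigma> \<and> (\<forall>x y. \<sigma> (x + y) = \<sigma> x + \<sigma> y) \<and> (\<forall>x y. \<sigma> (x * y) = \<sigma> x * \<sigma> y)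
      \<and> (\<forall>q. \<sigma> (of_rat q) = of_rat q)}"

text \<open>Finite Galois extensions: the fixed field of the automorphism group is the base field.\<close>

definition rat_galois :: "'a::field_char_0 itself \<Rightarrow> bool"
  where "rat_galois T \<longleftrightarrow> rat_degree T > 0 \<and> {x::'a. \<forall>\<sigma>\<in>rat_Gal. \<sigma> x = x} = \<rat>"

definition normal_basis :: "'a::field_char_0 set \<Rightarrow> bool"
  where "normal_basis B \<longleftrightarrow> (\<exists>\<beta>. B = (\<lambda>\<sigma>. \<sigma> \<beta>) ` rat_Gal)
      \<and> rat_vs.independent B \<and> rat_vs.span B = UNIV"


subsection \<open>Discriminant\<close>

text \<open>The trace of the linear map \<open>x \<mapsto> a * x\<close>, computed in some basis of the field.\<close>

definition rat_trace :: "'a::field_char_0 \<Rightarrow> rat"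
  where "rat_trace a =
    (let B = rat_vs.extend_basis {} in \<Sum>b\<in>B. rat_vs.representation B (a * b) b)"

definition integral_basis :: "'a::field_char_0 list \<Rightarrow> bool"
  where "integral_basis bs \<longleftrightarrow> distinct bs \<and> int_mod.independent (set bs)
      \<and> int_mod.span (set bs) = {x. algebraic_int x}"

definition basis_disc :: "'a::field_char_0 list \<Rightarrow> rat"
  where "basis_disc bs = det (mat (length bs) (length bs) (\<lambda>(i, j). rat_trace (bs ! i * bs ! j)))"

text \<open>The choice of integral basis is immaterial, since a change of basis has determinant
  \<open>1\<close> or \<open>-1\<close>.\<close>

definition field_disc :: "'a::field_char_0 itself \<Rightarrow> rat"
  where "field_disc _ = basis_disc (SOME bs :: 'a list. integral_basis bs)"


subsection \<open>Places\<close>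

definition padic_abs :: "nat \<Rightarrow> rat \<Rightarrow> real"
  where "padic_abs p q = (if q = 0 then 0 else
    real p powi (int (multiplicity (int p) (snd (quotient_of q)))
               - int (multiplicity (int p) (fst (quotient_of q)))))"

definition absolute_value :: "('a::field \<Rightarrow> real) \<Rightarrow> bool"
  where "absolute_value v \<longleftrightarrow> (\<forall>x. v x \<ge> 0) \<and> (\<forall>x. v x = 0 \<longleftrightarrow> x = 0)
      \<and> (\<forall>x y. v (x * y) = v x * v y) \<and> (\<forall>x y. v (x + y) \<le> v x + v y)"

text \<open>A place, i.e. a class of equivalent nontrivial absolute values, is represented by its unique
  member that extends the usual archimedean or a \<open>p\<close>-adic absolute value of the rationals.\<close>

definition places :: "('a::field_char_0 \<Rightarrow> real) set"
  where "places = {v. absolute_value v \<and>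
      ((\<forall>q. v (of_rat q) = \<bar>real_of_rat q\<bar>) \<or>
       (\<exists>p::nat. prime p \<and> (\<forall>q. v (of_rat q) = padic_abs p q)))}"


subsection \<open>Completions and local degrees\<close>

definition cauchy_seqs :: "('a::field \<Rightarrow> real) \<Rightarrow> (nat \<Rightarrow> 'a) set"
  where "cauchy_seqs v = {s. \<forall>e>0. \<exists>N. \<forall>m\<ge>N. \<forall>n\<ge>N. v (s m - s n) < e}"

definition cauchy_ring :: "('a::field \<Rightarrow> real) \<Rightarrow> (nat \<Rightarrow> 'a) ring"
  where "cauchy_ring v = \<lparr>carrier = cauchy_seqs v, mult = (\<lambda>s t n. s n * t n), one = (\<lambda>_. 1),
      zero = (\<lambda>_. 0), add = (\<lambda>s t n. s n + t n)\<rparr>"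

definition null_seqs :: "('a::field \<Rightarrow> real) \<Rightarrow> (nat \<Rightarrow> 'a) set"
  where "null_seqs v = {s. (\<lambda>n. v (s n)) \<longlonglongrightarrow> 0}"

definition completion :: "('a::field \<Rightarrow> real) \<Rightarrow> (nat \<Rightarrow> 'a) set ring"
  where "completion v = cauchy_ring v Quot null_seqs v"

text \<open>The completion of the rationals, as the subfield of the completion that consists of the
  classes of rational Cauchy sequences.\<close>

definition rat_completion :: "('a::field_char_0 \<Rightarrow> real) \<Rightarrow> (nat \<Rightarrow> 'a) set set"
  where "rat_completion v =
    {null_seqs v +>\<^bsub>cauchy_ring v\<^esub> s | s. s \<in> cauchy_seqs v \<and> range s \<subseteq> \<rat>}"

definition local_degree :: "('a::field_char_0 \<Rightarrow> real) \<Rightarrow> nat"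
  where "local_degree v =
    (THE n. ring.dimension (completion v) n (rat_completion v) (carrier (completion v)))"


subsection \<open>Height\<close>

text \<open>Only the finitely many places with \<open>v \<alpha> > 1\<close> contribute a factor other than 1. They are
  singled out because \<open>\<Prod>\<close> over an infinite set is 1 by convention.\<close>

definition weil_height :: "'a::field_char_0 \<Rightarrow> real"
  where "weil_height \<alpha> = (\<Prod>v\<in>{v \<in> places. v \<alpha> > 1}.
    max 1 (v \<alpha>) powr (real (local_degree v) / real (rat_degree TYPE('a))))"

end

theory Submission
  imports
    Defs
    "HOL-Algebra.Multiplicative_Group"
    "Jordan_Normal_Form.Char_Poly"
begin

text \<open>Since the degree \<open>d\<close> is an odd prime, \<open>K\<close> is cyclic and totally real, and an element
  generates a normal basis as soon as it is irrational with nonzero trace: the cyclotomic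
  polynomial of prime index is irreducible. The trace form \<open>x \<mapsto> Tr (x\<^sup>2)\<close> is positive definite on
  the ring of integers, with determinant \<open>\<Delta>\<close>. Complete \<open>1\<close> to an integral basis and split off the
  direction of \<open>1\<close>, which accounts for a factor \<open>d\<close> of \<open>\<Delta>\<close>. A pigeonhole argument in the
  remaining \<open>d - 1\<close> coordinates gives, for every \<open>C\<close> with \<open>C ^ (d - 1) > \<Delta> / d\<close>, an irrational
  integer whose trace-free part has square norm at most \<open>(d - 1) * C\<close>; adding a rational integer
  moves \<open>t = Tr / d\<close> into any interval of length 1. On the other hand \<open>Tr (\<beta>\<^sup>2) \<ge> 5/4 * d\<close> for
  irrational integers \<open>\<beta>\<close>, as \<open>\<beta>\<^sup>2\<close> and \<open>\<beta>\<^sup>2 - 1\<close> have norm at least 1. If \<open>\<Delta>\<close> were at most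
  \<open>d\<close>, the choice \<open>C = 1 + 1 / d\<close> and \<open>\<bar>t\<bar> \<le> 1/2\<close> would violate this. So \<open>\<Delta> > d\<close>, and now
  \<open>C = \<Delta> / d\<close> and \<open>0 < t \<le> 1\<close> give \<open>\<beta>\<close> with \<open>h(\<beta>)\<^sup>2 \<le> 1 + Tr (\<beta>\<^sup>2) / d \<le> \<Delta>\<close>, by the inequality of
  arithmetic and geometric means.\<close>

text \<open>A nonzero trace keeps \<open>t\<close> away from 0, so the generator is shifted into
  \<open>(0, 1]\<close> and its trace part may cost a full \<open>d\<close>. The bound still closes:
  \<open>1 + Tr / d\<close> is at most \<open>C + 2\<close>, and
  \<open>C = \<Delta> / d \<le> \<Delta> / 3\<close>, so \<open>\<Delta> \<ge> 3\<close> is enough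
  at this point. But the pigeonhole condition is strict, and \<open>C = \<Delta> / d\<close>
  satisfies it only if \<open>C > 1\<close>, when \<open>C ^ (d - 1)\<close> with
  \<open>d - 1 \<ge> 2\<close> exceeds \<open>C\<close>. This is why \<open>\<Delta> > d\<close> has
  to come first. It also dictates the constant 5/4: a \<open>C\<close> just above 1 contributes
  almost \<open>d\<close>, rounding to the nearest integer adds at most \<open>d / 4\<close>, and
  the plain bound \<open>Tr (\<beta> * \<beta>) \<ge> d\<close> would give no contradiction.

  The field is an abstract type without a given embedding. Total reality comes from a single real
  embedding, which exists because a polynomial of odd degree has a real root; the conjugates are its
  compositions with the automorphisms. The height is a product over places, that is, over functions
  known only by their axioms and their values on the rationals. A place exceeding 1 at an algebraic
  integer is shown to be the absolute value of a conjugate, with local degree 1.\<close>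

hide_const (open) UnivPoly.coeff UnivPoly.monom Module.smult

subsection \<open>Algebraic integers\<close>

text \<open>Here \<open>v\<close> is an eigenvector of the integer matrix \<open>A\<close> with
  eigenvalue \<open>x\<close>, and the characteristic polynomial of an integer matrix is monic and
  integral.\<close>

lemma algebraic_int_eigenvalue:
  fixes x :: "'a::field_char_0" and n :: nat
  assumes nz: "\<exists>i<n. v i \<noteq> 0"
    and eq: "\<And>i. i < n \<Longrightarrow> x * v i = (\<Sum>j<n. of_int (A i j) * v j)"
  shows "algebraic_int x"
proof -
  define M where "M = mat n n (\<lambda>(i,j). A i j)"
  define M' :: "'a mat" where "M' = map_mat of_int M"
  have M: "M \<in> carrier_mat n n" and M': "M' \<in> carrier_mat n n"
    by (auto simp: M_def M'_def)
  have "eigenvector M' (vec n v) x"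
    unfolding eigenvector_def
  proof (intro conjI)
    show "vec n v \<in> carrier_vec (dim_row M')" using M' by auto
    show "vec n v \<noteq> 0\<^sub>v (dim_row M')"
    proof
      assume "vec n v = 0\<^sub>v (dim_row M')"
      then have "vec n v = 0\<^sub>v n" using M' by simp
      then have "v i = 0" if "i < n" for i
        using that by (metis index_vec index_zero_vec(1))
      with nz show False by blast
    qed
    show "M' *\<^sub>v vec n v = x \<cdot>\<^sub>v vec n v"
    proof (rule eq_vecI)
      fix i assume "i < dim_vec (x \<cdot>\<^sub>v vec n v)"
      then have i: "i < n" by simp
      show "(M' *\<^sub>v vec n v) $ i = (x \<cdot>\<^sub>v vec n v) $ i"
        using i by (simp add: M'_def M_def scalar_prod_def eq atLeast0LessThan)
    qed (use M' in auto)
  qed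
  then have "eigenvalue M' x" unfolding eigenvalue_def by blast
  then have "poly (char_poly M') x = 0"
    using eigenvalue_root_char_poly[OF M'] by simp
  moreover have "char_poly M' = map_poly of_int (char_poly M)"
    unfolding M'_def by (rule of_int_hom.char_poly_hom[OF M])
  moreover have "lead_coeff (char_poly M) = 1"
    using degree_monic_char_poly[OF M] by simp
  ultimately show ?thesis
    unfolding algebraic_int_altdef_ipoly by auto
qed

text \<open>The expansions of the products \<open>x * s\<close> give the matrix, and the enumerated
  generators form the eigenvector, so they may satisfy linear relations.\<close>

lemma algebraic_int_if_stable_span:
  fixes x :: "'a::field_char_0"
  assumes fin: "finite S" and nz: "\<exists>s\<in>S. s \<noteq> 0"
    and st: "\<And>s. s \<in> S \<Longrightarrow> x * s \<in> int_mod.span S"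
  shows "algebraic_int x"
proof -
  obtain h where h: "bij_betw h {..<card S} S"
    using ex_bij_betw_nat_finite[OF fin] by (auto simp: atLeast0LessThan)
  have "\<exists>u. x * s = (\<Sum>t\<in>S. of_int (u t) * t)" if "s \<in> S" for s
    using st[OF that] unfolding int_mod.span_finite[OF fin] by (auto simp: int_scale_def)
  then obtain u where u: "\<And>s. s \<in> S \<Longrightarrow> x * s = (\<Sum>t\<in>S. of_int (u s t) * t)" by metis
  show ?thesis
  proof (rule algebraic_int_eigenvalue[where n = "card S" and v = h and A = "\<lambda>i j. u (h i) (h j)"])
    show "\<exists>i<card S. h i \<noteq> 0"
      using nz h unfolding bij_betw_def by force
    fix i assume "i < card S"
    then have "h i \<in> S" using h by (auto simp: bij_betw_def)
    from u[OF this] show "x * h i = (\<Sum>j<card S. of_int (u (h i) (h j)) * h j)"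
      using sum.reindex_bij_betw[OF h, of "\<lambda>t. of_int (u (h i) t) * t"] by simp
  qed
qed

lemma power_in_span_algebraic_int:
  fixes x :: "'a::field_char_0"
  assumes "algebraic_int x"
  obtains n c where "n > 0" "x ^ n = (\<Sum>i<n. of_int (c i) * x ^ i)"
proof -
  obtain p where p: "poly (map_poly of_int p) x = 0" "lead_coeff p = 1"
    using assms unfolding algebraic_int_altdef_ipoly by blast
  define n where "n = degree p"
  have n0: "n > 0"
  proof (rule ccontr)
    assume "\<not> n > 0"
    then have "degree p = 0" by (simp add: n_def)
    then have "p = [:1:]" using p(2) by (metis degree_eq_zeroE lead_coeff_pCons(2) coeff_pCons_0)
    then show False using p(1) by simp
  qed
  have "(\<Sum>i\<le>n. of_int (coeff p i) * x ^ i) = 0"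
    using p(1) by (simp add: poly_altdef n_def degree_map_poly coeff_map_poly)
  then have "(\<Sum>i<n. of_int (coeff p i) * x ^ i) + x ^ n = 0"
    using p(2) by (simp add: n_def lessThan_Suc_atMost[symmetric])
  then have "x ^ n = - (\<Sum>i<n. of_int (coeff p i) * x ^ i)"
    by (simp add: add_eq_0_iff)
  also have "\<dots> = (\<Sum>i<n. of_int (- coeff p i) * x ^ i)" by (simp add: sum_negf)
  finally show ?thesis using that[OF n0, of "\<lambda>i. - coeff p i"] by simp
qed

text \<open>The monomials \<open>x ^ i * y ^ j\<close> with \<open>i < m\<close> and
  \<open>j < n\<close> span a group stable under \<open>x\<close> and \<open>y\<close>, because the
  two equations reduce \<open>x ^ m\<close> and \<open>y ^ n\<close>.\<close>

lemma algebraic_int_plus_times: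
  fixes x y :: "'a::field_char_0"
  assumes "algebraic_int x" "algebraic_int y"
  shows "algebraic_int (x + y)" "algebraic_int (x * y)"
proof -
  obtain m c where m: "m > 0" "x ^ m = (\<Sum>i<m. of_int (c i) * x ^ i)"
    using power_in_span_algebraic_int[OF assms(1)] by blast
  obtain n e where n: "n > 0" "y ^ n = (\<Sum>i<n. of_int (e i) * y ^ i)"
    using power_in_span_algebraic_int[OF assms(2)] by blast
  define S where "S = (\<lambda>(i,j). x ^ i * y ^ j) ` ({..<m} \<times> {..<n})"
  have fin: "finite S" by (simp add: S_def)
  have "x ^ 0 * y ^ 0 \<in> S" using m(1) n(1) unfolding S_def by force
  then have one: "1 \<in> S" by simp
  have inS: "x ^ i * y ^ j \<in> S" if "i < m" "j < n" for i j
    using that unfolding S_def by force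
  have xS: "x * s \<in> int_mod.span S" if "s \<in> S" for s
  proof -
    from that obtain i j where ij: "i < m" "j < n" "s = x ^ i * y ^ j" by (auto simp: S_def)
    show ?thesis
    proof (cases "Suc i < m")
      case True
      then have "x ^ Suc i * y ^ j \<in> S" using ij by (intro inS)
      then show ?thesis using ij by (auto simp: mult.assoc intro: int_mod.span_base)
    next
      case False
      with ij have "m = Suc i" by simp
      then have "x * s = x ^ m * y ^ j" by (simp add: ij)
      also have "\<dots> = (\<Sum>k<m. int_scale (c k) (x ^ k * y ^ j))"
        by (simp add: m(2) sum_distrib_right int_scale_def mult.assoc)
      also have "\<dots> \<in> int_mod.span S"
        using ij inS by (intro int_mod.span_sum int_mod.span_scale int_mod.span_base) auto
      finally show ?thesis .
    qed
  qed
  have yS: "y * s \<in> int_mod.span S" if "s \<in> S" for s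
  proof -
    from that obtain i j where ij: "i < m" "j < n" "s = x ^ i * y ^ j" by (auto simp: S_def)
    show ?thesis
    proof (cases "Suc j < n")
      case True
      then have "x ^ i * y ^ Suc j \<in> S" using ij by (intro inS)
      then show ?thesis using ij by (auto simp: mult_ac intro: int_mod.span_base)
    next
      case False
      with ij have "n = Suc j" by simp
      then have "y * s = x ^ i * y ^ n" by (simp add: ij)
      also have "\<dots> = (\<Sum>k<n. int_scale (e k) (x ^ i * y ^ k))"
        by (simp add: n(2) sum_distrib_left int_scale_def mult_ac)
      also have "\<dots> \<in> int_mod.span S"
        using ij inS by (intro int_mod.span_sum int_mod.span_scale int_mod.span_base) auto
      finally show ?thesis .
    qed
  qed
  have x_span: "x * s \<in> int_mod.span S" if s: "s \<in> int_mod.span S" for s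
  proof -
    obtain u where "s = (\<Sum>t\<in>S. int_scale (u t) t)"
      using s unfolding int_mod.span_finite[OF fin] by blast
    then have "x * s = (\<Sum>t\<in>S. int_scale (u t) (x * t))"
      by (simp add: sum_distrib_left int_scale_def mult_ac)
    then show ?thesis using xS by (auto intro!: int_mod.span_sum int_mod.span_scale)
  qed
  have nz: "\<exists>s\<in>S. s \<noteq> 0" using one by (intro bexI[of _ 1]) simp_all
  show "algebraic_int (x + y)"
    using xS yS by (intro algebraic_int_if_stable_span[OF fin nz])
      (simp add: distrib_right int_mod.span_add)
  show "algebraic_int (x * y)"
    using x_span yS by (intro algebraic_int_if_stable_span[OF fin nz]) (simp add: mult.assoc)
qed

lemma algebraic_int_sum:
  fixes f :: "'b \<Rightarrow> 'a::field_char_0"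
  shows "(\<And>i. i \<in> I \<Longrightarrow> algebraic_int (f i)) \<Longrightarrow> algebraic_int (sum f I)"
  by (induction I rule: infinite_finite_induct) (auto intro: algebraic_int_plus_times)

lemma algebraic_int_prod:
  fixes f :: "'b \<Rightarrow> 'a::field_char_0"
  shows "(\<And>i. i \<in> I \<Longrightarrow> algebraic_int (f i)) \<Longrightarrow> algebraic_int (prod f I)"
  by (induction I rule: infinite_finite_induct) (auto intro: algebraic_int_plus_times)

lemma algebraic_int_power:
  "algebraic_int (x::'a::field_char_0) \<Longrightarrow> algebraic_int (x ^ n)"
  by (induction n) (auto intro: algebraic_int_plus_times)

lemma algebraic_int_int_scale:
  "algebraic_int (x::'a::field_char_0) \<Longrightarrow> algebraic_int (of_int k * x)"
  by (auto intro: algebraic_int_plus_times)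

lemma algebraic_int_diff:
  "algebraic_int (x::'a::field_char_0) \<Longrightarrow> algebraic_int y \<Longrightarrow> algebraic_int (x - y)"
  using algebraic_int_plus_times(1)[of x "- y"] by simp

text \<open>Multiplied by the power \<open>n - 1\<close> of its leading coefficient
  \<open>c\<close>, the equation of \<open>z\<close> becomes a monic integral equation of
  \<open>c * z\<close>.\<close>

lemma algebraic_int_clear_denominator:
  fixes z :: "'a::field_char_0"
  assumes "p \<noteq> 0" "poly (map_poly of_int p) z = 0"
  obtains c :: int where "c \<noteq> 0" "algebraic_int (of_int c * z)"
proof -
  define n where "n = degree p"
  define c where "c = lead_coeff p"
  have c: "c \<noteq> 0" using assms(1) by (simp add: c_def)
  have n0: "n > 0"
  proof (rule ccontr)
    assume "\<not> n > 0"
    then have "degree p = 0" by (simp add: n_def)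
    then obtain a where "p = [:a:]" by (metis degree_eq_zeroE)
    then show False using assms by simp
  qed
  have "(\<Sum>i\<le>n. of_int (coeff p i) * z ^ i) = 0"
    using assms(2) by (simp add: poly_altdef n_def degree_map_poly coeff_map_poly)
  then have *: "of_int c * z ^ n = - (\<Sum>i<n. of_int (coeff p i) * z ^ i)"
    by (simp add: n_def c_def lessThan_Suc_atMost[symmetric] add_eq_0_iff)
  let ?x = "of_int c * z"
  have top: "?x ^ n = (\<Sum>i<n. of_int (- coeff p i * c ^ (n - 1 - i)) * ?x ^ i)"
  proof -
    have "?x ^ n = of_int (c ^ (n - 1)) * (of_int c * z ^ n)"
      using n0 by (cases n) (simp_all add: power_mult_distrib mult_ac)
    also have "\<dots> = (\<Sum>i<n. of_int (- coeff p i * c ^ (n - 1)) * z ^ i)"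
      unfolding * by (simp add: sum_distrib_left sum_negf mult_ac)
    also have "\<dots> = (\<Sum>i<n. of_int (- coeff p i * c ^ (n - 1 - i)) * ?x ^ i)"
    proof (rule sum.cong[OF refl])
      fix i assume "i \<in> {..<n}"
      then have "c ^ (n - 1) = c ^ (n - 1 - i) * c ^ i" by (simp flip: power_add)
      then show "of_int (- coeff p i * c ^ (n - 1)) * z ^ i
          = of_int (- coeff p i * c ^ (n - 1 - i)) * ?x ^ i"
        by (simp add: power_mult_distrib)
    qed
    finally show ?thesis .
  qed
  \<comment> \<open>The matrix is the companion matrix of this equation: multiplication by
    \<open>?x\<close> shifts the powers, and the last one is reduced by \<open>top\<close>.\<close>
  have "algebraic_int ?x"
  proof (rule algebraic_int_eigenvalue[where n = n and v = "\<lambda>i. ?x ^ i"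
        and A = "\<lambda>i j. if Suc i = n then - coeff p j * c ^ (n - 1 - j) else if j = Suc i then 1 else 0"])
    show "\<exists>i<n. ?x ^ i \<noteq> 0" using n0 by (intro exI[of _ 0]) simp
    fix i assume i: "i < n"
    show "?x * ?x ^ i = (\<Sum>j<n. of_int (if Suc i = n then - coeff p j * c ^ (n - 1 - j)
        else if j = Suc i then 1 else 0) * ?x ^ j)"
    proof (cases "Suc i = n")
      case True
      then have "?x * ?x ^ i = ?x ^ n" by (metis power_Suc)
      then show ?thesis using top True by simp
    next
      case False
      then have "Suc i < n" using i by simp
      then show ?thesis using False
        by (simp add: if_distrib[of of_int] if_distrib[of "\<lambda>a. a * _"] cong: if_cong)
    qed
  qed
  with c that show ?thesis by blast
qed

subsection \<open>Polynomials\<close>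

lemma odd_degree_real_root:
  fixes p :: "real poly"
  assumes "odd (degree p)"
  shows "\<exists>x. poly p x = 0"
proof -
  have *: "\<exists>x. poly p x = 0" if od: "odd (degree p)" and pos: "lead_coeff p > 0" for p :: "real poly"
  proof -
    obtain a where a: "\<And>x. x \<ge> a \<Longrightarrow> poly p x \<ge> lead_coeff p"
      using poly_pinfty_gt_lc[OF pos] by blast
    \<comment> \<open>\<open>q x = - p (- x)\<close> has the same positive leading coefficient
      because the degree is odd, so growth at plus infinity settles both ends.\<close>
    define q where "q = - pcompose p [:0, -1:]"
    have "lead_coeff (pcompose p [:0, -1:]) = lead_coeff p * (-1) ^ degree p"
      by (subst lead_coeff_comp) auto
    then have "lead_coeff q = lead_coeff p"
      using od by (simp add: q_def)
    then have "lead_coeff q > 0" using pos by simp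
    then obtain b where b: "\<And>x. x \<ge> b \<Longrightarrow> poly q x \<ge> lead_coeff q"
      using poly_pinfty_gt_lc by blast
    define t where "t = max 1 (max a b)"
    have t: "t \<ge> a" "t \<ge> b" "t > 0" by (auto simp: t_def)
    have "poly p t > 0" using a[OF t(1)] pos by linarith
    moreover have "poly p (- t) < 0"
      using b[OF t(2)] \<open>lead_coeff q > 0\<close> by (simp add: q_def poly_pcompose)
    moreover have "- t < t" using t(3) by simp
    ultimately show ?thesis using poly_IVT_pos by blast
  qed
  show ?thesis
  proof (cases "lead_coeff p > 0")
    case True with * assms show ?thesis by blast
  next
    case False
    moreover have "lead_coeff p \<noteq> 0" using assms by auto
    ultimately have "lead_coeff p < 0" by linarith
    then have "lead_coeff (- p) > 0" by simp
    with *[of "- p"] assms show ?thesis by simp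
  qed
qed

text \<open>Let \<open>p\<close> divide \<open>coeff g 0\<close> but not \<open>coeff h 0\<close>,
  and let \<open>k\<close> be the first index at which \<open>p\<close> does not divide
  \<open>coeff g k\<close>. Modulo \<open>p\<close>, \<open>coeff f k\<close> is
  \<open>coeff g k * coeff h 0\<close>, which is not 0, so \<open>k\<close> is at least
  \<open>degree f\<close> and \<open>h\<close> is constant. The condition on \<open>p ^ 2\<close>
  prevents both constant coefficients from being divisible.\<close>

lemma eisenstein:
  fixes f :: "int poly"
  assumes p: "prime p" and monic: "lead_coeff f = 1" and deg: "degree f > 0"
    and dvd: "\<And>k. k < degree f \<Longrightarrow> p dvd coeff f k" and nd: "\<not> p ^ 2 dvd coeff f 0"
  shows "irreducible f"
proof (rule irreducibleI)
  show "f \<noteq> 0" using deg by auto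
  show "\<not> f dvd 1" using deg by (auto simp: is_unit_poly_iff)
  fix g h assume fgh: "f = g * h"
  have g0: "g \<noteq> 0" and h0: "h \<noteq> 0" using fgh deg by auto
  have lc: "lead_coeff g * lead_coeff h = 1" using monic by (simp add: fgh lead_coeff_mult)
  then have lg: "\<not> p dvd lead_coeff g" and lh: "\<not> p dvd lead_coeff h"
    using p by (metis dvd_mult2 dvd_mult not_prime_unit)+
  \<comment> \<open>Over the integers a constant factor need not be a unit; it is one here because
    the leading coefficients multiply to 1.\<close>
  have units: "is_unit (lead_coeff g)" "is_unit (lead_coeff h)" using lc
    by (metis dvd_triv_left, metis dvd_triv_right)
  have degs: "degree f = degree g + degree h" using g0 h0 by (simp add: fgh degree_mult_eq)
  have key: "degree g \<ge> degree f"
    if g0: "p dvd coeff g 0" and h0: "\<not> p dvd coeff h 0" and fgh: "f = g * h"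
      and lg: "\<not> p dvd lead_coeff g" for g h
  proof (rule ccontr)
    assume lt: "\<not> degree g \<ge> degree f"
    define k where "k = (LEAST k. \<not> p dvd coeff g k)"
    have k: "\<not> p dvd coeff g k" unfolding k_def using lg by (rule LeastI)
    have kle: "k \<le> degree g" unfolding k_def using lg by (rule Least_le)
    have below: "p dvd coeff g i" if "i < k" for i
      using not_less_Least[of i "\<lambda>k. \<not> p dvd coeff g k"] that by (auto simp: k_def)
    have "coeff f k = (\<Sum>i\<le>k. coeff g i * coeff h (k - i))" by (simp add: fgh coeff_mult)
    also have "\<dots> = (\<Sum>i<k. coeff g i * coeff h (k - i)) + coeff g k * coeff h 0"
      by (simp add: lessThan_Suc_atMost[symmetric])
    finally have "coeff g k * coeff h 0 = coeff f k - (\<Sum>i<k. coeff g i * coeff h (k - i))" by simp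
    moreover have "p dvd coeff f k" using kle lt by (intro dvd) auto
    moreover have "p dvd (\<Sum>i<k. coeff g i * coeff h (k - i))" using below by (intro dvd_sum) auto
    ultimately have "p dvd coeff g k * coeff h 0" by (simp only: dvd_diff)
    then show False using k h0 p by (simp add: prime_dvd_mult_iff)
  qed
  have c0: "coeff f 0 = coeff g 0 * coeff h 0" by (simp add: fgh coeff_mult_0)
  have "p dvd coeff g 0 * coeff h 0" using dvd[OF deg] c0 by simp
  then consider "p dvd coeff g 0" | "p dvd coeff h 0" using p by (auto simp: prime_dvd_mult_iff)
  then show "g dvd 1 \<or> h dvd 1"
  proof cases
    case 1
    then have "\<not> p dvd coeff h 0" using nd c0 by (auto simp: power2_eq_square dest: mult_dvd_mono)
    from key[OF 1 this fgh lg] degs have "degree h = 0" by simp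
    then obtain c where "h = [:c:]" by (meson degree_eq_zeroE)
    then have "h dvd 1" using units(2) by (simp add: is_unit_const_poly_iff)
    then show ?thesis ..
  next
    case 2
    then have "\<not> p dvd coeff g 0" using nd c0 by (auto simp: power2_eq_square dest: mult_dvd_mono)
    from key[OF 2 this _ lh] fgh degs have "degree g = 0" by (simp add: mult.commute)
    then obtain c where "g = [:c:]" by (meson degree_eq_zeroE)
    then have "g dvd 1" using units(1) by (simp add: is_unit_const_poly_iff)
    then show ?thesis ..
  qed
qed

subsection \<open>Geometry of numbers\<close>

text \<open>The system is solved from the first form on: \<open>x i\<close> enters form
  \<open>i\<close> with coefficient 1 and shifts it by an integer.\<close>

lemma unitriangular_floor_surj:
  fixes u :: "nat \<Rightarrow> nat \<Rightarrow> real" and a :: "nat \<Rightarrow> int"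
  shows "\<exists>x::nat\<Rightarrow>int. \<forall>i<n. \<lfloor>of_int (x i) + (\<Sum>j<i. u i j * of_int (x j))\<rfloor> = a i"
proof (induction n)
  case (Suc n)
  then obtain x :: "nat \<Rightarrow> int" where x: "\<forall>i<n. \<lfloor>of_int (x i) + (\<Sum>j<i. u i j * of_int (x j))\<rfloor> = a i"
    by blast
  define s where "s = (\<Sum>j<n. u n j * of_int (x j))"
  \<comment> \<open>\<open>s + \<lceil>- s\<rceil>\<close> lies in \<open>[0, 1)\<close>, so its
    floor is 0 and \<open>a n\<close> remains.\<close>
  define y where "y = x(n := a n + \<lceil>- s\<rceil>)"
  have y: "(\<Sum>j<i. u i j * of_int (y j)) = (\<Sum>j<i. u i j * of_int (x j))" if "i \<le> n" for i
    using that by (intro sum.cong) (auto simp: y_def)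
  have "\<lfloor>of_int (y i) + (\<Sum>j<i. u i j * of_int (y j))\<rfloor> = a i" if "i < Suc n" for i
  proof (cases "i = n")
    case True
    have "(\<Sum>j<i. u i j * of_int (y j)) = s" using y[of n] True by (simp add: s_def)
    then show ?thesis using True by (simp add: y_def) linarith
  next
    case False
    with that have "i < n" by simp
    then show ?thesis using x y[of i] by (simp add: y_def)
  qed
  then show ?case by blast
qed simp

text \<open>Minkowski's theorem on linear forms, for a triangular system: by the previous lemma the integer
  vectors correspond to unit boxes, so a large cube contains more of them than there are cells
  with sides \<open>c i / t i\<close>, and two vectors share a cell.\<close>

lemma unitriangular_small_vector:
  fixes u :: "nat \<Rightarrow> nat \<Rightarrow> real" and t c :: "nat \<Rightarrow> real"
  assumes t: "\<And>i. i < n \<Longrightarrow> t i > 0" and c: "\<And>i. i < n \<Longrightarrow> c i > 0"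
    and lt: "(\<Prod>i<n. t i) < (\<Prod>i<n. c i)"
  obtains x :: "nat \<Rightarrow> int" where "\<exists>i<n. x i \<noteq> 0"
    "\<And>i. i < n \<Longrightarrow> t i * \<bar>of_int (x i) + (\<Sum>j<i. u i j * of_int (x j))\<bar> < c i"
proof -
  define l where "l = (\<lambda>(x::nat\<Rightarrow>int) i. of_int (x i) + (\<Sum>j<i. u i j * of_int (x j)) :: real)"
  define r where "r = (\<lambda>i. t i / c i)"
  have r: "r i > 0" if "i < n" for i using t c that by (simp add: r_def)
  have "(\<Prod>i<n. r i) < 1"
  proof -
    have "(\<Prod>i<n. c i) > 0" using c by (intro prod_pos) auto
    then show ?thesis using lt by (simp add: r_def prod_dividef)
  qed
  \<comment> \<open>The strict inequality leaves room for the error \<open>1 / N\<close> that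
    counting cells adds to every factor, once \<open>N\<close> is large.\<close>
  moreover have "(\<lambda>N. \<Prod>i<n. r i + 1 / real (Suc N)) \<longlonglongrightarrow> (\<Prod>i<n. r i + 0)"
    using LIMSEQ_inverse_real_of_nat
    by (intro tendsto_prod tendsto_add tendsto_const) (simp add: inverse_eq_divide)
  ultimately have "eventually (\<lambda>N. (\<Prod>i<n. r i + 1 / real (Suc N)) < 1) sequentially"
    by (intro order_tendstoD) auto
  then obtain M where M: "(\<Prod>i<n. r i + 1 / real (Suc M)) < 1"
    by (meson eventually_sequentially order_refl)
  define N where "N = Suc M"
  have N: "(\<Prod>i<n. r i + 1 / real N) < 1" "N > 0" using M by (auto simp: N_def)
  define X where "X = (\<lambda>a. SOME x::nat\<Rightarrow>int. \<forall>i<n. \<lfloor>l x i\<rfloor> = a i)"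
  have X: "\<lfloor>l (X a) i\<rfloor> = a i" if "i < n" for a i
    using someI_ex[OF unitriangular_floor_surj[of n u a]] that unfolding X_def l_def by blast
  \<comment> \<open>\<open>A\<close> consists of the \<open>N ^ n\<close> prescribed vectors of
    floors, \<open>B\<close> of the cells, and \<open>g\<close> finds the cell of the corresponding
    integer vector.\<close>
  define A where "A = Pi\<^sub>E {..<n} (\<lambda>_. {0..<int N})"
  define B where "B = Pi\<^sub>E {..<n} (\<lambda>i. {0..\<lfloor>real N * r i\<rfloor>})"
  define g where "g = (\<lambda>a. restrict (\<lambda>i. \<lfloor>l (X a) i * r i\<rfloor>) {..<n})"
  have finB: "finite B" unfolding B_def by (intro finite_PiE) auto
  have cardA: "real (card A) = real N ^ n" by (simp add: A_def card_PiE)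
  have "real (card B) = (\<Prod>i<n. of_int (\<lfloor>real N * r i\<rfloor> + 1))"
    using r N(2) by (simp add: B_def card_PiE)
      (intro prod.cong refl, simp add: less_imp_le)
  also have "\<dots> \<le> (\<Prod>i<n. real N * (r i + 1 / real N))"
  proof (intro prod_mono conjI)
    fix i assume "i \<in> {..<n}"
    then have "r i > 0" using r by simp
    then have "0 \<le> \<lfloor>real N * r i\<rfloor>" using N(2) by simp
    then show "0 \<le> (of_int (\<lfloor>real N * r i\<rfloor> + 1) :: real)" by simp
    have "real N * (r i + 1 / real N) = real N * r i + 1" using N(2) by (simp add: field_simps)
    then show "of_int (\<lfloor>real N * r i\<rfloor> + 1) \<le> real N * (r i + 1 / real N)" by simp
  qed
  also have "\<dots> = real N ^ n * (\<Prod>i<n. r i + 1 / real N)" by (simp add: prod.distrib)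
  also have "\<dots> < real N ^ n * 1" using N by (intro mult_strict_left_mono) auto
  finally have card: "card B < card A" using cardA by simp
  have gB: "g ` A \<subseteq> B"
  proof
    fix b assume "b \<in> g ` A"
    then obtain a where a: "a \<in> A" "b = g a" by blast
    have "\<lfloor>l (X a) i * r i\<rfloor> \<in> {0..\<lfloor>real N * r i\<rfloor>}" if i: "i < n" for i
    proof -
      have "a i \<in> {0..<int N}" using a(1) i by (auto simp: A_def PiE_iff)
      then have "0 \<le> l (X a) i" "l (X a) i < real N" using X[OF i, of a] by (simp_all add: floor_eq_iff)
      then have "0 \<le> l (X a) i * r i" "l (X a) i * r i \<le> real N * r i"
        using r[OF i] by (auto intro: mult_right_mono less_imp_le)
      then show ?thesis by (simp add: floor_mono)
    qed
    then show "b \<in> B" by (auto simp: a(2) B_def g_def)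
  qed
  have "card (g ` A) < card A" using card_mono[OF finB gB] card by simp
  then have "\<not> inj_on g A" using pigeonhole by blast
  then obtain a b where ab: "a \<in> A" "b \<in> A" "g a = g b" "a \<noteq> b" by (auto simp: inj_on_def)
  define x where "x = (\<lambda>i. X a i - X b i)"
  have lx: "l x i = l (X a) i - l (X b) i" for i
    by (simp add: l_def x_def sum_subtractf algebra_simps)
  show ?thesis
  proof (rule that[of x])
    show "\<exists>i<n. x i \<noteq> 0"
    proof (rule ccontr)
      assume "\<not> (\<exists>i<n. x i \<noteq> 0)"
      then have "l (X a) i = l (X b) i" if "i < n" for i
        using that unfolding l_def x_def by (auto intro!: sum.cong)
      then have "a i = b i" if "i < n" for i using X that by metis
      then have "a = b" using ab(1,2) unfolding A_def by (intro PiE_ext) auto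
      with ab(4) show False ..
    qed
    fix i assume i: "i < n"
    have "g a i = g b i" using ab(3) by simp
    then have "\<lfloor>l (X a) i * r i\<rfloor> = \<lfloor>l (X b) i * r i\<rfloor>" using i by (simp add: g_def)
    then have "\<bar>l (X a) i * r i - l (X b) i * r i\<bar> < 1" by linarith
    then have "\<bar>l x i * r i\<bar> < 1" by (simp add: lx left_diff_distrib)
    then have "\<bar>l x i\<bar> * r i < 1" using r[OF i] by (simp add: abs_mult)
    then have "t i * \<bar>l x i\<bar> < c i" using c[OF i] by (simp add: r_def field_simps)
    then show "t i * \<bar>of_int (x i) + (\<Sum>j<i. u i j * of_int (x j))\<bar> < c i" by (simp add: l_def)
  qed
qed

text \<open>Complete the square in the last variable and recurse on the Schur complement
  \<open>G'\<close>. Eliminating from the end makes \<open>U\<close> lower triangular, so the last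
  variable occurs in the last form only.\<close>

lemma LDL_decomposition:
  fixes G :: "nat \<Rightarrow> nat \<Rightarrow> 'b::linordered_field"
  assumes sym: "\<And>i j. i < n \<Longrightarrow> j < n \<Longrightarrow> G i j = G j i"
    and pos: "\<And>x. \<exists>i<n. x i \<noteq> 0 \<Longrightarrow> 0 < (\<Sum>i<n. \<Sum>j<n. G i j * x i * x j)"
  shows "\<exists>t U. (\<forall>k<n. t k > 0) \<and> (\<forall>k. U k k = 1) \<and> (\<forall>k i. k < i \<longrightarrow> U k i = 0) \<and>
    (\<forall>i<n. \<forall>j<n. G i j = (\<Sum>k<n. t k * U k i * U k j))"
  using assms
proof (induction n arbitrary: G)
  case 0
  show ?case by (rule exI[of _ "\<lambda>_. 1"], rule exI[of _ "\<lambda>k i. if i = k then 1 else 0"]) auto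
next
  case (Suc n)
  define g where "g = G n n"
  have form: "(\<Sum>i<Suc n. \<Sum>j<Suc n. G i j * x i * x j)
      = (\<Sum>i<n. \<Sum>j<n. G i j * x i * x j) + 2 * x n * (\<Sum>i<n. G n i * x i) + g * x n ^ 2" for x
  proof -
    have "(\<Sum>i<n. G i n * x i * x n) = (\<Sum>i<n. G n i * x n * x i)"
      using Suc.prems(1) by (intro sum.cong) (auto simp: mult_ac)
    then show ?thesis
      by (simp add: sum.distrib g_def power2_eq_square sum_distrib_left mult_ac)
  qed
  have g: "g > 0"
    using Suc.prems(2)[of "\<lambda>i. if i = n then 1 else 0"] unfolding form by (simp add: g_def)
  define G' where "G' = (\<lambda>i j. G i j - G n i * G n j / g)"
  have form': "(\<Sum>i<n. \<Sum>j<n. G' i j * x i * x j)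
      = (\<Sum>i<n. \<Sum>j<n. G i j * x i * x j) - (\<Sum>i<n. G n i * x i) ^ 2 / g" for x
    by (simp add: G'_def left_diff_distrib sum_subtractf power2_eq_square sum_product
        sum_divide_distrib) (simp add: mult_ac)
  have pos': "0 < (\<Sum>i<n. \<Sum>j<n. G' i j * x i * x j)" if "\<exists>i<n. x i \<noteq> 0" for x
  proof -
    define s where "s = (\<Sum>i<n. G n i * x i)"
    \<comment> \<open>The last coordinate makes the completed square vanish, so the form of
      \<open>G\<close> at \<open>y\<close> equals the form of \<open>G'\<close> at
      \<open>x\<close>.\<close>
    define y where "y = x(n := - s / g)"
    have "\<exists>i<Suc n. y i \<noteq> 0" using that by (auto simp: y_def less_Suc_eq)
    from Suc.prems(2)[OF this]
    have "0 < (\<Sum>i<n. \<Sum>j<n. G i j * y i * y j) + 2 * y n * (\<Sum>i<n. G n i * y i) + g * y n ^ 2"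
      unfolding form .
    also have "(\<Sum>i<n. \<Sum>j<n. G i j * y i * y j) = (\<Sum>i<n. \<Sum>j<n. G i j * x i * x j)"
      by (intro sum.cong) (auto simp: y_def)
    also have "(\<Sum>i<n. G n i * y i) = s"
      unfolding s_def by (intro sum.cong) (auto simp: y_def)
    finally have "0 < (\<Sum>i<n. \<Sum>j<n. G i j * x i * x j) + 2 * (- s / g) * s + g * (- s / g) ^ 2"
      by (simp add: y_def)
    moreover have "2 * (- s / g) * s + g * (- s / g) ^ 2 = - (s ^ 2 / g)"
      using g by (simp add: power2_eq_square)
    ultimately show ?thesis unfolding form' s_def[symmetric] by (simp only: diff_conv_add_uminus add.assoc)
  qed
  have sym': "G' i j = G' j i" if "i < n" "j < n" for i j
    using Suc.prems(1)[of i j] that by (simp add: G'_def)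
  have "\<exists>t U. (\<forall>k<n. t k > 0) \<and> (\<forall>k. U k k = 1) \<and> (\<forall>k i. k < i \<longrightarrow> U k i = 0) \<and>
      (\<forall>i<n. \<forall>j<n. G' i j = (\<Sum>k<n. t k * U k i * U k j))"
    by (rule Suc.IH) (fact sym', fact pos')
  then obtain t U where "\<forall>k<n. t k > 0" "\<forall>k. U k k = 1" "\<forall>k i. k < i \<longrightarrow> U k i = 0"
    "\<forall>i<n. \<forall>j<n. G' i j = (\<Sum>k<n. t k * U k i * U k j)"
    by (elim exE conjE) (rule that)
  note tU = this[rule_format]
  define t' where "t' = t(n := g)"
  define U' where "U' = U(n := \<lambda>i. if i \<le> n then G n i / g else 0)"
  have "t' k > 0" if "k < Suc n" for k using that g tU(1) by (auto simp: t'_def less_Suc_eq)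
  moreover have "U' k k = 1" for k using g tU(2) by (simp add: U'_def g_def)
  moreover have "U' k i = 0" if "k < i" for k i using tU(3) that by (auto simp: U'_def)
  moreover have "G i j = (\<Sum>k<Suc n. t' k * U' k i * U' k j)" if ij: "i < Suc n" "j < Suc n" for i j
  proof -
    have "(\<Sum>k<Suc n. t' k * U' k i * U' k j)
        = (\<Sum>k<n. t k * U k i * U k j) + G n i * G n j / g"
      using ij g by (simp add: t'_def U'_def)
    also have "\<dots> = G i j"
    proof (cases "i < n \<and> j < n")
      case True
      then show ?thesis using tU(4)[of i j] by (simp add: G'_def)
    next
      case False
      then have "i = n \<or> j = n" using ij by auto
      then have "(\<Sum>k<n. t k * U k i * U k j) = 0" using tU(3) by (intro sum.neutral) auto
      moreover have "G n i * G n j / g = G i j"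
        using \<open>i = n \<or> j = n\<close> g Suc.prems(1)[of i j] ij by (auto simp: g_def)
      ultimately show ?thesis by simp
    qed
    finally show "G i j = (\<Sum>k<Suc n. t' k * U' k i * U' k j)" by simp
  qed
  ultimately show ?case
    by (intro exI[of _ t'] exI[of _ U'] conjI allI impI)
qed

text \<open>The matrix is the product of the transpose of \<open>U\<close>, of determinant 1, and of
  \<open>U\<close> with rows scaled by \<open>t\<close>.\<close>

lemma det_LDL:
  fixes G :: "nat \<Rightarrow> nat \<Rightarrow> 'b::linordered_field"
  assumes U1: "\<And>k. U k k = 1" and U0: "\<And>k i. k < i \<Longrightarrow> U k i = 0"
    and G: "\<And>i j. i < n \<Longrightarrow> j < n \<Longrightarrow> G i j = (\<Sum>k<n. t k * U k i * U k j)"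
  shows "det (mat n n (\<lambda>(i,j). G i j)) = (\<Prod>k<n. t k)"
proof -
  define A where "A = mat n n (\<lambda>(k,i). U k i)"
  define B where "B = mat n n (\<lambda>(k,i). t k * U k i)"
  have A: "A \<in> carrier_mat n n" and B: "B \<in> carrier_mat n n" by (auto simp: A_def B_def)
  have "mat n n (\<lambda>(i,j). G i j) = transpose_mat A * B"
    using G by (intro eq_matI)
      (auto simp: A_def B_def scalar_prod_def atLeast0LessThan mult_ac intro!: sum.cong)
  moreover have "det A = 1"
    by (subst det_lower_triangular[OF _ A])
      (auto simp: A_def U0 U1 diag_mat_def prod.list_conv_set_nth)
  moreover have "det B = (\<Prod>k<n. t k)"
    by (subst det_lower_triangular[OF _ B])
      (auto simp: B_def U0 U1 diag_mat_def prod.list_conv_set_nth atLeast0LessThan)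
  ultimately show ?thesis
    using det_mult[of "transpose_mat A" n B] det_transpose[OF A] A B by simp
qed

subsection \<open>Inequalities\<close>

text \<open>The inequality of arithmetic and geometric means, with \<open>A\<close> above the mean:
  multiply \<open>z i / A \<le> exp (z i / A - 1)\<close> over all \<open>i\<close>; the exponents
  add up to at most 0.\<close>

lemma prod_le_mean_power:
  fixes z :: "'b \<Rightarrow> real"
  assumes fin: "finite S" and z: "\<And>i. i \<in> S \<Longrightarrow> z i \<ge> 0"
    and A: "A > 0" and sum: "(\<Sum>i\<in>S. z i) \<le> A * real (card S)"
  shows "(\<Prod>i\<in>S. z i) \<le> A ^ card S"
proof -
  have "(\<Prod>i\<in>S. z i) \<le> (\<Prod>i\<in>S. A * exp (z i / A - 1))"
  proof (intro prod_mono conjI)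
    fix i assume "i \<in> S"
    have "z i / A \<le> exp (z i / A - 1)" using exp_ge_add_one_self[of "z i / A - 1"] by simp
    then show "z i \<le> A * exp (z i / A - 1)" using A by (simp add: field_simps)
  qed (use z in auto)
  also have "\<dots> = A ^ card S * exp ((\<Sum>i\<in>S. z i) / A - real (card S))"
    using fin by (simp add: prod.distrib exp_sum[symmetric] sum_subtractf sum_divide_distrib)
  also have "\<dots> \<le> A ^ card S * 1"
    using A sum by (intro mult_left_mono) (auto simp: field_simps)
  finally show ?thesis by simp
qed

text \<open>For \<open>y > 1\<close> the minimum of \<open>y - ln y - ln (y - 1) / 2\<close> is
  \<open>2 - ln 2\<close>, attained at 2, so 3/4 is exactly what the constant 5/4 asks for.\<close>

lemma ln2_le: "ln 2 \<le> (3/4 :: real)"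
proof -
  have "(1 + (3/4) / real 16) ^ 16 \<le> exp (3/4 :: real)"
    by (rule exp_ge_one_plus_x_over_n_power_n) auto
  moreover have "(2::real) \<le> (1 + (3/4) / real 16) ^ 16" by (simp add: power_divide)
  ultimately have "2 \<le> exp (3/4 :: real)" by linarith
  then have "ln 2 \<le> ln (exp (3/4 :: real))" by (subst ln_le_cancel_iff) auto
  then show ?thesis by simp
qed

text \<open>The weights 1 and 1/2 of the logarithms are chosen such that the critical points are 1/2 and 2.
  The tangents of the logarithms there yield the bound.\<close>

lemma five_quarters_le_sub_ln:
  fixes y :: real
  assumes "y > 0" "y \<noteq> 1"
  shows "5/4 \<le> y - ln y - ln \<bar>y - 1\<bar> / 2"
proof (cases "y < 1")
  case True
  have "ln (2 * y) \<le> 2 * y - 1" using assms by (intro ln_le_minus_one) simp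
  moreover have "ln (2 * (1 - y)) \<le> 2 * (1 - y) - 1" using True by (intro ln_le_minus_one) simp
  moreover have "ln (2 * y) = ln 2 + ln y" using assms by (simp add: ln_mult)
  moreover have "ln (2 * (1 - y)) = ln 2 + ln (1 - y)" using True by (subst ln_mult) auto
  \<comment> \<open>The tangents combine to the bound \<open>1/2 + 3/2 * ln 2\<close> on this side,
    and \<open>ln 2 \<ge> 1/2\<close> turns it into 5/4.\<close>
  moreover have "ln 2 \<ge> (1/2 :: real)" using ln_le_minus_one[of "1/2::real"] by (simp add: ln_div)
  moreover have "\<bar>y - 1\<bar> = 1 - y" using True by simp
  ultimately show ?thesis by simp
next
  case False
  have "ln (y / 2) \<le> y / 2 - 1" using assms by (intro ln_le_minus_one) simp
  moreover have "ln (y - 1) \<le> (y - 1) - 1" using assms False by (intro ln_le_minus_one) simp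
  moreover have "ln (y / 2) = ln y - ln 2" using assms by (simp add: ln_div)
  moreover have "\<bar>y - 1\<bar> = y - 1" using False by simp
  ultimately show ?thesis using ln2_le by simp
qed

lemma sum_ge_five_quarters:
  fixes y :: "'b \<Rightarrow> real"
  assumes y: "\<And>i. i \<in> S \<Longrightarrow> y i > 0" "\<And>i. i \<in> S \<Longrightarrow> y i \<noteq> 1"
    and P: "(\<Prod>i\<in>S. y i) \<ge> 1" and Q: "\<bar>\<Prod>i\<in>S. y i - 1\<bar> \<ge> 1" and fin: "finite S"
  shows "(\<Sum>i\<in>S. y i) \<ge> 5/4 * real (card S)"
proof -
  have "5/4 * real (card S) = (\<Sum>i\<in>S. 5/4)" by simp
  also have "\<dots> \<le> (\<Sum>i\<in>S. y i - ln (y i) - ln \<bar>y i - 1\<bar> / 2)"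
    using y by (intro sum_mono five_quarters_le_sub_ln)
  also have "\<dots> = (\<Sum>i\<in>S. y i) - ln (\<Prod>i\<in>S. y i) - ln (\<Prod>i\<in>S. \<bar>y i - 1\<bar>) / 2"
    using fin y by (subst (1 2) ln_prod) (auto simp: sum_subtractf sum_divide_distrib order_less_irrefl dest: y(1))
  also have "\<dots> \<le> (\<Sum>i\<in>S. y i)"
  proof -
    have "(\<Prod>i\<in>S. \<bar>y i - 1\<bar>) \<ge> 1" using Q by (simp add: abs_prod)
    from ln_ge_zero[OF this] ln_ge_zero[OF P] show ?thesis by simp
  qed
  finally show ?thesis .
qed

subsection \<open>The Galois group and the trace\<close>

lemma rat_Gal_hom:
  assumes "\<sigma> \<in> rat_Gal"
  shows rat_Gal_add: "\<sigma> (x + y) = \<sigma> x + \<sigma> y"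
    and rat_Gal_mult: "\<sigma> (x * y) = \<sigma> x * \<sigma> y"
    and rat_Gal_of_rat: "\<sigma> (of_rat q) = of_rat q"
    and rat_Gal_0: "\<sigma> 0 = 0" and rat_Gal_1: "\<sigma> 1 = 1"
    and rat_Gal_uminus: "\<sigma> (- x) = - \<sigma> x" and rat_Gal_diff: "\<sigma> (x - y) = \<sigma> x - \<sigma> y"
    and rat_Gal_power: "\<sigma> (x ^ n) = \<sigma> x ^ n" and rat_Gal_of_int: "\<sigma> (of_int k) = of_int k"
    and rat_Gal_eq_0_iff: "\<sigma> x = 0 \<longleftrightarrow> x = 0" and rat_Gal_inj: "inj \<sigma>"
proof -
  show add: "\<sigma> (x + y) = \<sigma> x + \<sigma> y" for x y using assms by (simp add: rat_Gal_def)
  show mult: "\<sigma> (x * y) = \<sigma> x * \<sigma> y" for x y using assms by (simp add: rat_Gal_def)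
  show rat: "\<sigma> (of_rat q) = of_rat q" for q using assms by (simp add: rat_Gal_def)
  show zero: "\<sigma> 0 = 0" using rat[of 0] by simp
  show one: "\<sigma> 1 = 1" using rat[of 1] by simp
  show minus: "\<sigma> (- x) = - \<sigma> x" for x using add[of x "- x"] zero by (simp add: eq_neg_iff_add_eq_0 add.commute)
  show "\<sigma> (x - y) = \<sigma> x - \<sigma> y" using add[of x "- y"] minus by simp
  show "\<sigma> (x ^ n) = \<sigma> x ^ n" by (induction n) (simp_all add: one mult)
  show "\<sigma> (of_int k) = of_int k" using rat[of "of_int k"] by simp
  show inj: "inj \<sigma>" using assms by (simp add: rat_Gal_def bij_def)
  show "\<sigma> x = 0 \<longleftrightarrow> x = 0" using inj zero by (metis injD)
qed

lemma rat_Gal_sum: "\<sigma> \<in> rat_Gal \<Longrightarrow> \<sigma> (sum f I) = (\<Sum>i\<in>I. \<sigma> (f i))"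
  by (induction I rule: infinite_finite_induct) (simp_all add: rat_Gal_hom)

lemma rat_Gal_prod: "\<sigma> \<in> rat_Gal \<Longrightarrow> \<sigma> (prod f I) = (\<Prod>i\<in>I. \<sigma> (f i))"
  by (induction I rule: infinite_finite_induct) (simp_all add: rat_Gal_hom)

lemma rat_Gal_id: "id \<in> rat_Gal"
  by (simp add: rat_Gal_def)

lemma rat_Gal_comp: "\<sigma> \<in> rat_Gal \<Longrightarrow> \<tau> \<in> rat_Gal \<Longrightarrow> \<sigma> \<circ> \<tau> \<in> rat_Gal"
  by (auto simp: rat_Gal_def intro: bij_comp)

lemma rat_Gal_inv:
  assumes s: "\<sigma> \<in> rat_Gal"
  shows "inv_into UNIV \<sigma> \<in> rat_Gal" "inv_into UNIV \<sigma> \<circ> \<sigma> = id" "\<sigma> \<circ> inv_into UNIV \<sigma> = id"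
proof -
  have bij: "bij \<sigma>" using s by (simp add: rat_Gal_def)
  have si: "\<sigma> (inv_into UNIV \<sigma> x) = x" for x using bij by (simp add: bij_is_surj surj_f_inv_f)
  have ls: "inv_into UNIV \<sigma> (\<sigma> x) = x" for x using bij by (simp add: bij_is_inj inv_f_f)
  show "inv_into UNIV \<sigma> \<circ> \<sigma> = id" "\<sigma> \<circ> inv_into UNIV \<sigma> = id" using si ls by auto
  have "inv_into UNIV \<sigma> (x + y) = inv_into UNIV \<sigma> x + inv_into UNIV \<sigma> y" for x y
    by (metis ls si rat_Gal_add[OF s])
  moreover have "inv_into UNIV \<sigma> (x * y) = inv_into UNIV \<sigma> x * inv_into UNIV \<sigma> y" for x y
    by (metis ls si rat_Gal_mult[OF s])
  moreover have "inv_into UNIV \<sigma> (of_rat q) = of_rat q" for q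
    by (metis ls rat_Gal_of_rat[OF s])
  ultimately show "inv_into UNIV \<sigma> \<in> rat_Gal" using bij by (simp add: rat_Gal_def bij_imp_bij_inv)
qed

lemma bij_betw_rat_Gal_comp:
  assumes t: "\<tau> \<in> rat_Gal"
  shows "bij_betw ((\<circ>) \<tau>) rat_Gal rat_Gal"
proof (rule bij_betw_byWitness[where f' = "(\<circ>) (inv_into UNIV \<tau>)"])
  show "\<forall>\<sigma>\<in>rat_Gal. inv_into UNIV \<tau> \<circ> (\<tau> \<circ> \<sigma>) = \<sigma>" "\<forall>\<sigma>\<in>rat_Gal. \<tau> \<circ> (inv_into UNIV \<tau> \<circ> \<sigma>) = \<sigma>"
    by (simp_all add: rat_Gal_inv[OF t] flip: comp_assoc)
qed (use rat_Gal_comp rat_Gal_inv t in blast)+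

lemma rat_Gal_poly:
  assumes "\<sigma> \<in> rat_Gal"
  shows "\<sigma> (poly (map_poly of_rat f) x) = poly (map_poly of_rat f) (\<sigma> x)"
  by (simp add: poly_altdef rat_Gal_sum[OF assms] rat_Gal_hom[OF assms] coeff_map_poly)

lemma rat_Gal_algebraic_int:
  assumes s: "\<sigma> \<in> rat_Gal" and x: "algebraic_int x"
  shows "algebraic_int (\<sigma> x)"
proof -
  obtain p where p: "poly (map_poly of_int p) x = 0" "lead_coeff p = 1"
    using x unfolding algebraic_int_altdef_ipoly by blast
  have "poly (map_poly of_int p) (\<sigma> x) = \<sigma> (poly (map_poly of_int p) x)"
    by (simp add: poly_altdef rat_Gal_sum[OF s] rat_Gal_hom[OF s] coeff_map_poly)
  then show ?thesis using p rat_Gal_0[OF s] unfolding algebraic_int_altdef_ipoly by auto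
qed

text \<open>Artin's argument: subtracting \<open>h k y\<close> times the relation at
  \<open>x\<close> from the relation at \<open>y * x\<close> removes the term of \<open>k\<close>. A
  \<open>y\<close> that separates \<open>h j\<close> from \<open>h k\<close> then yields
  \<open>c j = 0\<close>.\<close>

lemma dedekind_independence:
  fixes h :: "'b \<Rightarrow> 'a::field_char_0 \<Rightarrow> 'a"
  assumes "finite I" "inj_on h I" "h ` I \<subseteq> rat_Gal" "\<And>x. (\<Sum>i\<in>I. c i * h i x) = 0" "i \<in> I"
  shows "c i = 0"
  using assms
proof (induction I arbitrary: c i rule: finite_induct)
  case (insert k I)
  have kG: "h k \<in> rat_Gal" and IG: "\<And>j. j \<in> I \<Longrightarrow> h j \<in> rat_Gal" using insert.prems by auto
  have zero: "c j = 0" if j: "j \<in> I" for j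
  proof -
    have "c j * (h j y - h k y) = 0" for y
    proof (rule insert.IH[where c = "\<lambda>j. c j * (h j y - h k y)" and i = j])
      fix x
      have "(\<Sum>j\<in>I. c j * (h j y - h k y) * h j x)
          = (\<Sum>j\<in>I. c j * h j (y * x)) - h k y * (\<Sum>j\<in>I. c j * h j x)"
        by (simp add: sum_distrib_left sum_subtractf[symmetric] IG rat_Gal_mult algebra_simps)
      also have "(\<Sum>j\<in>I. c j * h j (y * x)) = - (c k * h k (y * x))"
        using insert.prems(3)[of "y * x"] insert.hyps by (simp add: eq_neg_iff_add_eq_0 add.commute)
      also have "(\<Sum>j\<in>I. c j * h j x) = - (c k * h k x)"
        using insert.prems(3)[of x] insert.hyps by (simp add: eq_neg_iff_add_eq_0 add.commute)
      finally show "(\<Sum>j\<in>I. c j * (h j y - h k y) * h j x) = 0"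
        by (simp add: rat_Gal_mult[OF kG])
    qed (use insert.prems j in auto)
    moreover have "h j \<noteq> h k" using insert.prems(1) insert.hyps j by (auto simp: inj_on_def)
    then obtain y where "h j y \<noteq> h k y" by auto
    ultimately show ?thesis by (metis mult_eq_0_iff right_minus_eq)
  qed
  have "(\<Sum>j\<in>I. c j * h j 1) = 0" using zero by simp
  then have "c k = 0" using insert.prems(3)[of 1] insert.hyps rat_Gal_1[OF kG] by simp
  then show ?case using zero insert.prems by auto
qed simp

text \<open>Zero rows complete the system to a square matrix of determinant 0.\<close>

lemma underdetermined_system:
  fixes A :: "nat \<Rightarrow> nat \<Rightarrow> 'a::field"
  assumes "m < n"
  obtains v where "\<exists>j<n. v j \<noteq> 0" "\<And>i. i < m \<Longrightarrow> (\<Sum>j<n. A i j * v j) = 0"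
proof -
  define M where "M = mat n n (\<lambda>(i,j). if i < m then A i j else 0)"
  have M: "M \<in> carrier_mat n n" by (simp add: M_def)
  have "det M = (\<Sum>j<n. M $$ (m,j) * cofactor M m j)"
    using laplace_expansion_row[OF M assms] .
  also have "\<dots> = 0" using assms by (intro sum.neutral) (auto simp: M_def)
  finally obtain v where v: "v \<in> carrier_vec n" "v \<noteq> 0\<^sub>v n" "M *\<^sub>v v = 0\<^sub>v n"
    using det_0_iff_vec_prod_zero_field[OF M] by blast
  show ?thesis
  proof (rule that[of "\<lambda>j. v $ j"])
    show "\<exists>j<n. v $ j \<noteq> 0"
    proof (rule ccontr)
      assume "\<not> (\<exists>j<n. v $ j \<noteq> 0)"
      then have "v = 0\<^sub>v n" using v(1) by (intro eq_vecI) auto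
      with v(2) show False ..
    qed
    fix i assume i: "i < m"
    then have "(M *\<^sub>v v) $ i = 0" using v(3) assms by simp
    then show "(\<Sum>j<n. A i j * v $ j) = 0"
      using i assms v(1) by (simp add: M_def scalar_prod_def atLeast0LessThan)
  qed
qed

text \<open>Indexed families instead of sets: the indices become matrix indices, and the position of
  1 in a basis matters. Injectivity is implied.\<close>

definition rat_indep :: "nat \<Rightarrow> (nat \<Rightarrow> 'a::field_char_0) \<Rightarrow> bool"
  where "rat_indep n b \<longleftrightarrow> (\<forall>x. (\<Sum>i<n. of_rat (x i) * b i) = 0 \<longrightarrow> (\<forall>i<n. x i = 0))"

lemma rat_indepD:
  "rat_indep n b \<Longrightarrow> (\<Sum>i<n. of_rat (x i) * b i) = 0 \<Longrightarrow> i < n \<Longrightarrow> x i = 0"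
  by (simp add: rat_indep_def)

lemma rat_indep_iff:
  "rat_indep n b \<longleftrightarrow> inj_on b {..<n} \<and> rat_vs.independent (b ` {..<n})"
proof
  assume r: "rat_indep n b"
  have inj: "inj_on b {..<n}"
  proof (rule inj_onI, rule ccontr)
    fix i j assume ij: "i \<in> {..<n}" "j \<in> {..<n}" "b i = b j" "i \<noteq> j"
    let ?x = "\<lambda>k. if k = i then 1 else if k = j then - 1 else 0 :: rat"
    have "(\<Sum>k<n. of_rat (?x k) * b k) = (\<Sum>k<n. (if k = i then b k else 0) - (if k = j then b k else 0))"
      using ij(4) by (intro sum.cong) auto
    also have "\<dots> = 0" using ij by (simp add: sum_subtractf)
    finally have "?x i = 0" using rat_indepD[OF r, where x = ?x and i = i] ij by blast
    then show False by simp
  qed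
  moreover have "rat_vs.independent (b ` {..<n})"
    unfolding rat_vs.dependent_finite[OF finite_imageI[OF finite_lessThan]]
  proof safe
    fix u k assume u: "(\<Sum>v\<in>b ` {..<n}. rat_scale (u v) v) = 0" "u (b k) \<noteq> 0" "k < n"
    have "(\<Sum>i<n. of_rat (u (b i)) * b i) = 0"
      using u(1) by (simp add: sum.reindex[OF inj] rat_scale_def)
    then show False using rat_indepD[OF r, where x = "\<lambda>i. u (b i)" and i = k] u by simp
  qed
  ultimately show "inj_on b {..<n} \<and> rat_vs.independent (b ` {..<n})" by blast
next
  assume *: "inj_on b {..<n} \<and> rat_vs.independent (b ` {..<n})"
  show "rat_indep n b"
    unfolding rat_indep_def
  proof safe
    fix x i assume x: "(\<Sum>i<n. of_rat (x i) * b i) = 0" and i: "i < n"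
    define u where "u = (\<lambda>v. x (inv_into {..<n} b v))"
    have "(\<Sum>v\<in>b ` {..<n}. rat_scale (u v) v) = (\<Sum>i<n. of_rat (x i) * b i)"
      using * by (subst sum.reindex) (auto simp: u_def rat_scale_def)
    then have "u (b i) = 0"
      using * x i unfolding rat_vs.dependent_finite[OF finite_imageI[OF finite_lessThan]] by auto
    then show "x i = 0" using * i by (simp add: u_def)
  qed
qed

lemma rat_span_image_eq:
  fixes b :: "nat \<Rightarrow> 'a::field_char_0"
  assumes "inj_on b {..<n}"
  shows "z \<in> rat_vs.span (b ` {..<n}) \<longleftrightarrow> (\<exists>x. z = (\<Sum>i<n. of_rat (x i) * b i))"
proof
  assume "z \<in> rat_vs.span (b ` {..<n})"
  then obtain u where "z = (\<Sum>v\<in>b ` {..<n}. rat_scale (u v) v)"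
    unfolding rat_vs.span_finite[OF finite_imageI[OF finite_lessThan]] by blast
  then show "\<exists>x. z = (\<Sum>i<n. of_rat (x i) * b i)"
    by (intro exI[of _ "\<lambda>i. u (b i)"]) (simp add: sum.reindex[OF assms] rat_scale_def)
next
  assume "\<exists>x. z = (\<Sum>i<n. of_rat (x i) * b i)"
  then obtain x where "z = (\<Sum>i<n. rat_scale (x i) (b i))" by (auto simp: rat_scale_def)
  then show "z \<in> rat_vs.span (b ` {..<n})"
    by (simp, intro rat_vs.span_sum rat_vs.span_scale rat_vs.span_base) auto
qed

text \<open>The values lie in the field itself; Galois invariance makes them rational, and
  \<open>rat_trace_eq_gal_trace\<close> identifies them with the trace in the discriminant.\<close>

definition gal_trace :: "'a::field_char_0 \<Rightarrow> 'a"
  where "gal_trace x = (\<Sum>\<sigma>\<in>rat_Gal. \<sigma> x)"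

section \<open>Order of the Galois group, and the trace as the sum of the conjugates\<close>

locale finite_galois =
  fixes T :: "'a::field_char_0 itself"
  assumes galois: "rat_galois T"
begin

abbreviation dK :: nat where "dK \<equiv> rat_degree T"

lemma deg_pos: "dK > 0"
  using galois by (simp add: rat_galois_def rat_degree_def)

lemma Rats_if_fixed: "(\<And>\<sigma>. \<sigma> \<in> rat_Gal \<Longrightarrow> \<sigma> x = (x::'a)) \<Longrightarrow> x \<in> \<rat>"
  using galois unfolding rat_galois_def by blast

text \<open>An infinite basis has cardinality 0, which would make the degree 0 against
  \<open>deg_pos\<close>.\<close>

lemma extend_basis_empty:
  defines "B \<equiv> rat_vs.extend_basis ({} :: 'a set)"
  shows "finite B" "card B = dK" "rat_vs.independent B" "rat_vs.span B = UNIV"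
proof -
  have e: "rat_vs.independent ({} :: 'a set)" by (rule rat_vs.independent_empty)
  show i: "rat_vs.independent B" unfolding B_def by (rule rat_vs.independent_extend_basis[OF e])
  show s: "rat_vs.span B = UNIV" unfolding B_def by (rule rat_vs.span_extend_basis[OF e])
  show c: "card B = dK" unfolding rat_degree_def
    using rat_vs.dim_eq_card[of B UNIV] i s by simp
  show "finite B" using deg_pos c by (intro card_ge_0_finite) simp
qed

lemma finite_dim: "finite_dimensional_vector_space (rat_scale :: rat \<Rightarrow> 'a \<Rightarrow> 'a) (rat_vs.extend_basis {})"
  using extend_basis_empty by unfold_locales auto

lemma rat_indep_coords:
  assumes "rat_indep dK (b :: nat \<Rightarrow> 'a)"
  obtains x where "z = (\<Sum>i<dK. of_rat (x i) * b i)"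
proof -
  interpret f: finite_dimensional_vector_space "rat_scale :: rat \<Rightarrow> 'a \<Rightarrow> 'a" "rat_vs.extend_basis {}"
    by (rule finite_dim)
  have b: "inj_on b {..<dK}" "rat_vs.independent (b ` {..<dK})"
    using assms by (simp_all add: rat_indep_iff)
  have "card (b ` {..<dK}) = dK" using b(1) by (simp add: card_image)
  then have "UNIV \<subseteq> rat_vs.span (b ` {..<dK})"
    using f.card_eq_dim[of "b ` {..<dK}" UNIV] b(2) by (simp add: rat_degree_def)
  then show ?thesis using rat_span_image_eq[OF b(1)] that by blast
qed

lemma rat_indep_le: "rat_indep n (b :: nat \<Rightarrow> 'a) \<Longrightarrow> n \<le> dK"
proof -
  interpret f: finite_dimensional_vector_space "rat_scale :: rat \<Rightarrow> 'a \<Rightarrow> 'a" "rat_vs.extend_basis {}"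
    by (rule finite_dim)
  assume "rat_indep n b"
  then have b: "inj_on b {..<n}" "rat_vs.independent (b ` {..<n})"
    by (simp_all add: rat_indep_iff)
  then show ?thesis
    using f.independent_card_le_dim[of "b ` {..<n}" UNIV] by (simp add: card_image rat_degree_def)
qed

lemma ex_rat_basis: "\<exists>b :: nat \<Rightarrow> 'a. rat_indep dK b"
proof -
  obtain h where h: "bij_betw h {..<dK} (rat_vs.extend_basis {} :: 'a set)"
    using ex_bij_betw_nat_finite extend_basis_empty by (metis atLeast0LessThan)
  then show ?thesis using extend_basis_empty(3)
    by (intro exI[of _ h]) (simp add: rat_indep_iff bij_betw_def)
qed

text \<open>With more automorphisms than basis elements, a nontrivial combination of them vanishes
  on a basis, hence everywhere, against Dedekind's lemma. Finite subsets are considered because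
  finiteness of the group is deduced from this bound.\<close>

lemma card_subset_Gal_le:
  assumes "finite S" "S \<subseteq> (rat_Gal :: ('a \<Rightarrow> 'a) set)"
  shows "card S \<le> dK"
proof (rule ccontr)
  assume lt: "\<not> card S \<le> dK"
  obtain h where h: "bij_betw h {..<card S} S"
    using ex_bij_betw_nat_finite[OF assms(1)] by (auto simp: atLeast0LessThan)
  have hG: "h j \<in> rat_Gal" if "j < card S" for j
    using that h assms(2) by (auto simp: bij_betw_def)
  obtain b :: "nat \<Rightarrow> 'a" where b: "rat_indep dK b" using ex_rat_basis by blast
  obtain v where v: "\<exists>j<card S. v j \<noteq> 0" "\<And>i. i < dK \<Longrightarrow> (\<Sum>j<card S. h j (b i) * v j) = 0"
    using underdetermined_system[of dK "card S" "\<lambda>i j. h j (b i)"] lt by auto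
  have "(\<Sum>j<card S. v j * h j x) = 0" for x
  proof -
    obtain q where q: "x = (\<Sum>i<dK. of_rat (q i) * b i)" using rat_indep_coords[OF b] by blast
    have "(\<Sum>j<card S. v j * h j x) = (\<Sum>j<card S. \<Sum>i<dK. of_rat (q i) * (h j (b i) * v j))"
      by (intro sum.cong refl)
        (simp add: q hG rat_Gal_sum rat_Gal_mult rat_Gal_of_rat sum_distrib_left mult_ac)
    also have "\<dots> = (\<Sum>i<dK. of_rat (q i) * (\<Sum>j<card S. h j (b i) * v j))"
      by (subst sum.swap) (simp add: sum_distrib_left)
    also have "\<dots> = 0" using v(2) by simp
    finally show ?thesis .
  qed
  then have "v j = 0" if "j < card S" for j
    using dedekind_independence[where I = "{..<card S}" and h = h and c = v and i = j] that h assms(2) by (auto simp: bij_betw_def)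
  with v(1) show False by blast
qed

lemma finite_Gal: "finite (rat_Gal :: ('a \<Rightarrow> 'a) set)"
  using card_subset_Gal_le by (meson finite_if_finite_subsets_card_bdd)

lemma gal_fixed:
  assumes "\<tau> \<in> (rat_Gal :: ('a \<Rightarrow> 'a) set)"
  shows "\<tau> (gal_trace x) = gal_trace x"
    and "\<tau> (\<Prod>\<sigma>\<in>rat_Gal. \<sigma> x) = (\<Prod>\<sigma>\<in>rat_Gal. \<sigma> x)"
  using sum.reindex_bij_betw[OF bij_betw_rat_Gal_comp[OF assms], of "\<lambda>\<sigma>. \<sigma> x"]
    prod.reindex_bij_betw[OF bij_betw_rat_Gal_comp[OF assms], of "\<lambda>\<sigma>. \<sigma> x"]
  by (simp_all add: gal_trace_def rat_Gal_sum[OF assms] rat_Gal_prod[OF assms])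

lemma gal_trace_conj:
  assumes t: "\<tau> \<in> (rat_Gal :: ('a \<Rightarrow> 'a) set)"
  shows "gal_trace (\<tau> x) = gal_trace x"
proof -
  have "bij_betw (\<lambda>\<sigma>. \<sigma> \<circ> \<tau>) rat_Gal rat_Gal"
  proof (rule bij_betw_byWitness[where f' = "\<lambda>\<sigma>. \<sigma> \<circ> inv_into UNIV \<tau>"])
    show "\<forall>\<sigma>\<in>rat_Gal. \<sigma> \<circ> \<tau> \<circ> inv_into UNIV \<tau> = \<sigma>" "\<forall>\<sigma>\<in>rat_Gal. \<sigma> \<circ> inv_into UNIV \<tau> \<circ> \<tau> = \<sigma>"
      by (simp_all add: rat_Gal_inv[OF t] comp_assoc)
  qed (use rat_Gal_comp rat_Gal_inv t in blast)+
  from sum.reindex_bij_betw[OF this, of "\<lambda>\<sigma>. \<sigma> x"] show ?thesis by (simp add: gal_trace_def)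
qed

lemma gal_trace_Rats: "gal_trace (x::'a) \<in> \<rat>"
  using gal_fixed by (intro Rats_if_fixed) auto

lemma gal_trace_add: "gal_trace (x + y) = gal_trace x + gal_trace (y::'a)"
  by (simp add: gal_trace_def rat_Gal_add sum.distrib)

lemma gal_trace_of_rat_mult: "gal_trace (of_rat q * x) = of_rat q * gal_trace (x::'a)"
  by (simp add: gal_trace_def rat_Gal_mult rat_Gal_of_rat sum_distrib_left)

lemma gal_trace_0: "gal_trace (0::'a) = 0"
  by (simp add: gal_trace_def rat_Gal_0)

lemma gal_trace_sum: "gal_trace (sum f I) = (\<Sum>i\<in>I. gal_trace (f i :: 'a))"
  by (induction I rule: infinite_finite_induct) (simp_all add: gal_trace_0 gal_trace_add)

lemma gal_trace_of_rat: "gal_trace (of_rat q :: 'a) = of_nat (card (rat_Gal :: ('a \<Rightarrow> 'a) set)) * of_rat q"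
  by (simp add: gal_trace_def rat_Gal_of_rat)

lemma card_Gal_pos: "card (rat_Gal :: ('a \<Rightarrow> 'a) set) > 0"
  using finite_Gal rat_Gal_id by (auto simp: card_gt_0_iff)

text \<open>If there were fewer automorphisms than the degree, the system \<open>\<Sum>j. \<sigma> (b j) * v j = 0\<close> would have
  a nonzero solution. Scaled to have an entry 1 and replaced by its traces, it becomes a rational
  relation between the \<open>b j\<close>.\<close>

lemma card_Gal: "card (rat_Gal :: ('a \<Rightarrow> 'a) set) = dK"
proof (rule antisym)
  show "card (rat_Gal :: ('a \<Rightarrow> 'a) set) \<le> dK" using card_subset_Gal_le[OF finite_Gal] by simp
  show "dK \<le> card (rat_Gal :: ('a \<Rightarrow> 'a) set)"
  proof (rule ccontr)
    let ?n = "card (rat_Gal :: ('a \<Rightarrow> 'a) set)"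
    assume lt: "\<not> dK \<le> ?n"
    obtain h where h: "bij_betw h {..<?n} (rat_Gal :: ('a \<Rightarrow> 'a) set)"
      using ex_bij_betw_nat_finite[OF finite_Gal] by (auto simp: atLeast0LessThan)
    obtain b :: "nat \<Rightarrow> 'a" where b: "rat_indep dK b" using ex_rat_basis by blast
    obtain v where v: "\<exists>j<dK. v j \<noteq> 0" "\<And>i. i < ?n \<Longrightarrow> (\<Sum>j<dK. h i (b j) * v j) = 0"
      using underdetermined_system[of ?n dK "\<lambda>i j. h i (b j)"] lt by auto
    have v0: "(\<Sum>j<dK. \<sigma> (b j) * v j) = 0" if "\<sigma> \<in> rat_Gal" for \<sigma>
    proof -
      from that h obtain i where "i < ?n" "\<sigma> = h i" by (auto simp: bij_betw_def)
      with v(2) show ?thesis by simp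
    qed
    obtain k where k: "k < dK" "v k \<noteq> 0" using v(1) by blast
    define c where "c = 1 / v k"
    have "\<forall>j. \<exists>q. gal_trace (c * v j) = of_rat q" using gal_trace_Rats by (auto elim: Rats_cases)
    then obtain w where w: "\<And>j. gal_trace (c * v j) = of_rat (w j)" by metis
    have "(\<Sum>j<dK. of_rat (w j) * b j) = (\<Sum>j<dK. \<Sum>\<tau>\<in>rat_Gal. \<tau> (c * v j) * b j)"
      by (simp add: w[symmetric] gal_trace_def sum_distrib_right)
    also have "\<dots> = (\<Sum>\<tau>\<in>rat_Gal. \<Sum>j<dK. \<tau> (c * v j) * b j)" by (rule sum.swap)
    also have "\<dots> = 0"
    proof (rule sum.neutral, rule ballI)
      fix \<tau> :: "'a \<Rightarrow> 'a" assume t: "\<tau> \<in> rat_Gal"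
      have tb: "\<tau> (inv_into UNIV \<tau> x) = x" for x using rat_Gal_inv(3)[OF t] by (metis comp_apply id_apply)
      \<comment> \<open>This sum is the image under \<open>\<tau>\<close> of the equation for the
        inverse automorphism, scaled by \<open>c\<close>.\<close>
      have "(\<Sum>j<dK. \<tau> (c * v j) * b j) = \<tau> (c * (\<Sum>j<dK. inv_into UNIV \<tau> (b j) * v j))"
        by (simp add: rat_Gal_mult[OF t] rat_Gal_sum[OF t] tb sum_distrib_left mult_ac)
      also have "\<dots> = 0" using v0[OF rat_Gal_inv(1)[OF t]] by (simp add: rat_Gal_0[OF t])
      finally show "(\<Sum>j<dK. \<tau> (c * v j) * b j) = 0" .
    qed
    finally have "w k = 0" using rat_indepD[OF b] k(1) by blast
    moreover have "gal_trace (c * v k) = of_nat ?n" using gal_trace_of_rat[of 1] k(2) by (simp add: c_def)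
    ultimately show False using w[of k] card_Gal_pos by simp
  qed
qed

lemma gal_trace_nondegenerate:
  assumes "\<And>y. gal_trace (x * y) = 0"
  shows "x = (0::'a)"
proof (rule ccontr)
  assume "x \<noteq> 0"
  then have "gal_trace (1::'a) = 0" using assms[of "1 / x"] by simp
  then show False using gal_trace_of_rat[of 1] card_Gal_pos by simp
qed

text \<open>The map \<open>g\<close> below sends \<open>c\<close> to the vector with coordinates
  \<open>t (b * c)\<close>. It is injective because the trace form is nondegenerate, hence
  surjective by dimension, and a preimage of \<open>b\<close> is the dual vector.\<close>

lemma dual_basis:
  assumes "b \<in> rat_vs.extend_basis ({} :: 'a set)"
  shows "\<exists>c. \<forall>x. gal_trace (x * c) = of_rat (rat_vs.representation (rat_vs.extend_basis {}) x b)"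
proof -
  define B where "B = rat_vs.extend_basis ({} :: 'a set)"
  note B = extend_basis_empty[folded B_def]
  interpret f: finite_dimensional_vector_space "rat_scale :: rat \<Rightarrow> 'a \<Rightarrow> 'a" B
    unfolding B_def by (rule finite_dim)
  have "\<forall>z::'a. \<exists>q. gal_trace z = of_rat q" using gal_trace_Rats by (auto elim: Rats_cases)
  then obtain t where t: "\<And>z::'a. gal_trace z = of_rat (t z)" by metis
  have t_add: "t (x + y) = t x + t y" for x y :: 'a
    using gal_trace_add[of x y] by (simp add: t of_rat_add[symmetric])
  have t_scale: "t (of_rat q * x) = q * t x" for q and x :: 'a
    using gal_trace_of_rat_mult[of q x] by (simp add: t of_rat_mult[symmetric])
  have indep: "u b = 0" if "b \<in> B" "(\<Sum>b\<in>B. rat_scale (u b) b) = 0" for u b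
    using B(3) that unfolding rat_vs.dependent_finite[OF B(1)] by blast
  define g where "g = (\<lambda>c. \<Sum>b\<in>B. rat_scale (t (b * c)) b)"
  have lin: "Vector_Spaces.linear rat_scale rat_scale g"
  proof (unfold_locales)
    show "g (x + y) = g x + g y" for x y
      by (simp add: g_def distrib_left t_add rat_scale_def of_rat_add distrib_right sum.distrib)
    show "g (rat_scale q x) = rat_scale q (g x)" for q x
    proof -
      have "t (b * rat_scale q x) = q * t (b * x)" for b
        using t_scale[of q "b * x"] by (simp add: rat_scale_def mult_ac)
      then show ?thesis by (simp add: g_def rat_scale_def of_rat_mult sum_distrib_left mult_ac)
    qed
  qed
  have "inj g"
  proof -
    have "c = 0" if "g c = 0" for c
    proof (rule gal_trace_nondegenerate)
      fix y
      have tb: "t (b * c) = 0" if "b \<in> B" for b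
        using indep[where u = "\<lambda>b. t (b * c)"] \<open>g c = 0\<close> that by (simp add: g_def)
      have "y \<in> rat_vs.span B" using B(4) by simp
      then obtain u where "y = (\<Sum>b\<in>B. rat_scale (u b) b)"
        unfolding rat_vs.span_finite[OF B(1)] by blast
      then have "gal_trace (c * y) = (\<Sum>b\<in>B. of_rat (u b) * gal_trace (b * c))"
        by (simp add: sum_distrib_left gal_trace_sum rat_scale_def mult_ac flip: gal_trace_of_rat_mult)
      then show "gal_trace (c * y) = 0" using tb by (simp add: t)
    qed
    moreover interpret g: Vector_Spaces.linear rat_scale rat_scale g by (rule lin)
    have "g x = g y \<Longrightarrow> g (x - y) = 0" for x y by (simp add: g.diff)
    ultimately show ?thesis by (intro injI) (metis right_minus_eq)
  qed
  then have "surj g" using f.linear_inj_imp_surj[OF lin] by blast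
  then obtain c where c: "g c = b" by (metis surjD)
  have tb: "t (b' * c) = (if b' = b then 1 else 0)" if "b' \<in> B" for b'
  proof -
    have bB: "b \<in> B" using assms by (simp add: B_def)
    have "(\<Sum>b'\<in>B. rat_scale (t (b' * c) - (if b' = b then 1 else 0)) b')
        = (\<Sum>b'\<in>B. rat_scale (t (b' * c)) b' - (if b' = b then b' else 0))"
      by (intro sum.cong) (auto simp: rat_scale_def of_rat_diff left_diff_distrib)
    also have "\<dots> = g c - b" using bB B(1) by (simp add: g_def sum_subtractf)
    finally have "(\<Sum>b'\<in>B. rat_scale (t (b' * c) - (if b' = b then 1 else 0)) b') = 0" by (simp add: c)
    then have "t (b' * c) - (if b' = b then 1 else 0) = 0"
      using indep[where u = "\<lambda>b'. t (b' * c) - (if b' = b then 1 else 0)"] that by simp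
    then show ?thesis by simp
  qed
  have "gal_trace (x * c) = of_rat (rat_vs.representation B x b)" for x
  proof -
    have bB: "b \<in> B" using assms by (simp add: B_def)
    have "x = (\<Sum>b'\<in>B. rat_scale (rat_vs.representation B x b') b')"
      using rat_vs.sum_representation_eq[OF B(3), of x B] B(1,4) by simp
    then have "gal_trace (x * c)
        = gal_trace (\<Sum>b'\<in>B. of_rat (rat_vs.representation B x b') * (b' * c))"
      by (metis (no_types, lifting) rat_scale_def sum_distrib_right mult.assoc sum.cong)
    also have "\<dots> = (\<Sum>b'\<in>B. of_rat (rat_vs.representation B x b') * of_rat (t (b' * c)))"
      unfolding gal_trace_sum gal_trace_of_rat_mult by (simp only: t)
    also have "\<dots> = (\<Sum>b'\<in>B. if b' = b then of_rat (rat_vs.representation B x b') else 0)"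
      by (intro sum.cong) (auto simp: tb)
    also have "\<dots> = of_rat (rat_vs.representation B x b)" using bB B(1) by simp
    finally show ?thesis .
  qed
  then show ?thesis by (auto simp: B_def)
qed

text \<open>Expanding \<open>x\<close> in a basis \<open>b\<close> with dual basis \<open>d\<close> and comparing coefficients by Dedekind's lemma
  gives \<open>\<Sum> d b * b = 1\<close>.\<close>

lemma rat_trace_eq_gal_trace: "of_rat (rat_trace a) = gal_trace (a::'a)"
proof -
  define B where "B = rat_vs.extend_basis ({} :: 'a set)"
  note B = extend_basis_empty[folded B_def]
  obtain d where d: "\<And>b x. b \<in> B \<Longrightarrow> gal_trace (x * d b) = of_rat (rat_vs.representation B x b)"
    using dual_basis unfolding B_def by metis
  define e where "e = (\<lambda>\<sigma> :: 'a \<Rightarrow> 'a. \<Sum>b\<in>B. \<sigma> (d b) * b)"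
  have expand: "(\<Sum>\<sigma>\<in>rat_Gal. e \<sigma> * \<sigma> x) = x" for x
  proof -
    have "x = (\<Sum>b\<in>B. rat_scale (rat_vs.representation B x b) b)"
      using rat_vs.sum_representation_eq[OF B(3), of x B] B(1,4) by simp
    also have "\<dots> = (\<Sum>b\<in>B. \<Sum>\<sigma>\<in>rat_Gal. \<sigma> (x * d b) * b)"
      by (intro sum.cong refl) (simp add: rat_scale_def d[symmetric] gal_trace_def sum_distrib_right)
    also have "\<dots> = (\<Sum>\<sigma>\<in>rat_Gal. \<Sum>b\<in>B. \<sigma> (x * d b) * b)" by (rule sum.swap)
    also have "\<dots> = (\<Sum>\<sigma>\<in>rat_Gal. e \<sigma> * \<sigma> x)"
      by (intro sum.cong refl) (simp add: e_def rat_Gal_mult sum_distrib_left sum_distrib_right mult_ac)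
    finally show ?thesis by simp
  qed
  have "e id - 1 = 0"
  proof -
    have "(\<Sum>\<sigma>\<in>rat_Gal. (e \<sigma> - (if \<sigma> = id then 1 else 0)) * \<sigma> x) = 0" for x
      using finite_Gal expand[of x]
      by (simp add: rat_Gal_id left_diff_distrib sum_subtractf if_distrib[of "\<lambda>a. a * _"] cong: if_cong)
    then show ?thesis
      using dedekind_independence[where I = rat_Gal and h = "\<lambda>\<sigma>. \<sigma>" and i = id
          and c = "\<lambda>\<sigma>. e \<sigma> - (if \<sigma> = id then 1 else 0)"] finite_Gal rat_Gal_id by simp
  qed
  then have e: "(\<Sum>b\<in>B. d b * b) = 1" by (simp add: e_def)
  have "of_rat (rat_trace a) = (\<Sum>b\<in>B. gal_trace (a * b * d b))"
    by (simp add: rat_trace_def B_def[symmetric] Let_def of_rat_sum d)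
  also have "\<dots> = gal_trace (a * (\<Sum>b\<in>B. d b * b))"
    by (simp add: sum_distrib_left gal_trace_sum mult_ac)
  finally show ?thesis by (simp add: e)
qed

lemma rat_trace_eqI: "gal_trace (a::'a) = of_rat q \<Longrightarrow> rat_trace a = q"
  using rat_trace_eq_gal_trace[of a] by simp

lemma rat_trace_linear:
  shows rat_trace_of_rat_mult: "rat_trace (of_rat q * x) = q * rat_trace (x::'a)"
    and rat_trace_sum: "rat_trace (sum f I) = (\<Sum>i\<in>I. rat_trace (f i :: 'a))"
    and rat_trace_of_rat: "rat_trace (of_rat q :: 'a) = of_nat dK * q"
  by ((intro rat_trace_eqI)?,
      simp add: gal_trace_of_rat_mult gal_trace_sum gal_trace_of_rat card_Gal
        of_rat_mult of_rat_sum rat_trace_eq_gal_trace)+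

lemma rat_trace_conj: "\<tau> \<in> rat_Gal \<Longrightarrow> rat_trace (\<tau> x) = rat_trace (x::'a)"
  by (intro rat_trace_eqI) (simp add: gal_trace_conj rat_trace_eq_gal_trace)

lemma rat_trace_algebraic_int:
  assumes "algebraic_int (x::'a)"
  shows "rat_trace x \<in> \<int>"
proof -
  have "algebraic_int (gal_trace x)"
    unfolding gal_trace_def using assms rat_Gal_algebraic_int by (intro algebraic_int_sum)
  then have "gal_trace x \<in> \<int>" using gal_trace_Rats rational_algebraic_int_is_int by blast
  then obtain k where "gal_trace x = of_int k" by (elim Ints_cases)
  then have "rat_trace x = of_int k" by (intro rat_trace_eqI) simp
  then show ?thesis by simp
qed

lemma gal_norm_algebraic_int:
  assumes "algebraic_int (x::'a)" "x \<noteq> 0"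
  obtains k :: int where "k \<noteq> 0" "(\<Prod>\<sigma>\<in>rat_Gal. \<sigma> x) = of_int k"
proof -
  let ?N = "\<Prod>\<sigma>\<in>rat_Gal. \<sigma> x"
  have "algebraic_int ?N"
    using assms rat_Gal_algebraic_int by (intro algebraic_int_prod) auto
  moreover have "?N \<in> \<rat>" using gal_fixed by (intro Rats_if_fixed) auto
  ultimately have "?N \<in> \<int>" using rational_algebraic_int_is_int by blast
  then obtain k where k: "?N = of_int k" by (elim Ints_cases)
  have "?N \<noteq> 0" using assms(2) finite_Gal by (simp add: rat_Gal_eq_0_iff)
  then show ?thesis using that k by force
qed

end

subsection \<open>Cyclic extensions of prime degree\<close>

definition Gal_group :: "('a::field_char_0 \<Rightarrow> 'a) monoid"
  where "Gal_group = \<lparr>carrier = rat_Gal, mult = (\<circ>), one = id\<rparr>"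

lemma group_Gal_group: "group Gal_group"
proof (rule groupI)
  fix \<sigma> :: "'a::field_char_0 \<Rightarrow> 'a" assume "\<sigma> \<in> carrier Gal_group"
  then show "\<exists>\<tau>\<in>carrier Gal_group. \<tau> \<otimes>\<^bsub>Gal_group\<^esub> \<sigma> = \<one>\<^bsub>Gal_group\<^esub>"
    using rat_Gal_inv[of \<sigma>] by (auto simp: Gal_group_def)
qed (auto simp: Gal_group_def rat_Gal_id rat_Gal_comp comp_assoc)

lemma Gal_group_pow: "\<sigma> [^]\<^bsub>Gal_group\<^esub> (n::nat) = \<sigma> ^^ n"
  by (induction n) (simp_all add: Gal_group_def nat_pow_def funpow_Suc_right del: funpow.simps)

lemma map_poly_hom:
  fixes h :: "'a::field \<Rightarrow> 'b::field"
  assumes h0: "h 0 = 0" and add: "\<And>x y. h (x + y) = h x + h y" and mult: "\<And>x y. h (x * y) = h x * h y"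
  shows map_poly_hom_add: "map_poly h (p + q) = map_poly h p + map_poly h q"
    and map_poly_hom_mult: "map_poly h (p * q) = map_poly h p * map_poly h q"
proof -
  have sum: "h (sum f I) = (\<Sum>i\<in>I. h (f i))" for f :: "nat \<Rightarrow> 'a" and I
    by (induction I rule: infinite_finite_induct) (simp_all add: h0 add)
  show "map_poly h (p + q) = map_poly h p + map_poly h q"
    by (rule poly_eqI) (simp add: coeff_map_poly h0 add)
  show "map_poly h (p * q) = map_poly h p * map_poly h q"
    by (rule poly_eqI) (simp add: coeff_map_poly h0 coeff_mult sum mult)
qed

lemma poly_map_poly_of_rat_sum_monom:
  "poly (map_poly of_rat (\<Sum>i<n. monom (x i) i)) (y::'a::field_char_0) = (\<Sum>i<n. of_rat (x i) * y ^ i)"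
proof (induction n)
  case (Suc n)
  have "map_poly of_rat ((\<Sum>i<n. monom (x i) i) + monom (x n) n)
      = map_poly of_rat (\<Sum>i<n. monom (x i) i) + (map_poly of_rat (monom (x n) n) :: 'a poly)"
    by (rule map_poly_hom_add) (simp_all add: of_rat_add of_rat_mult)
  then show ?case using Suc by (simp add: map_poly_monom poly_monom)
qed simp

lemma common_denominator_rat:
  fixes x :: "nat \<Rightarrow> rat"
  obtains N :: int and a where "N > 0" "\<And>i. i < n \<Longrightarrow> of_int N * x i = of_int (a i)"
proof -
  have "\<exists>N::int. N > 0 \<and> (\<forall>i<n. \<exists>a. of_int N * x i = of_int a)"
  proof (induction n)
    case 0
    show ?case by (intro exI[of _ 1]) simp
  next
    case (Suc n)
    then obtain N :: int where N: "N > 0" "\<forall>i<n. \<exists>a. of_int N * x i = of_int a" by blast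
    obtain a b where ab: "quotient_of (x n) = (a, b)" by (cases "quotient_of (x n)")
    have b: "b > 0" using quotient_of_denom_pos[OF ab] .
    have xn: "of_int b * x n = of_int a" using quotient_of_div[OF ab] b by simp
    have "\<exists>c. of_int (N * b) * x i = of_int c" if "i < Suc n" for i
    proof (cases "i = n")
      case True
      then show ?thesis using xn by (intro exI[of _ "N * a"]) (simp add: mult.assoc)
    next
      case False
      with that N(2) obtain a where "of_int N * x i = of_int a" by (auto simp: less_Suc_eq)
      then show ?thesis by (intro exI[of _ "b * a"]) (simp add: mult_ac)
    qed
    then show ?case using N(1) b by (intro exI[of _ "N * b"]) simp
  qed
  then show ?thesis using that by metis
qed

text \<open>The indeterminate acts as \<open>D\<close>. For \<open>D = \<sigma> - id\<close> with \<open>\<sigma>\<close> of order \<open>p\<close>, the polynomial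
  \<open>\<Sum>i<p. (X + 1) ^ i\<close>, to which Eisenstein's criterion applies, acts as the trace.\<close>

definition op_poly :: "('a \<Rightarrow> 'a) \<Rightarrow> int poly \<Rightarrow> 'a::field_char_0 \<Rightarrow> 'a"
  where "op_poly D f x = fold_coeffs (\<lambda>c z. of_int c * x + D z) f 0"

locale int_linear =
  fixes D :: "'a::field_char_0 \<Rightarrow> 'a"
  assumes D_add: "D (x + y) = D x + D y"
begin

lemma D_0: "D 0 = 0" using D_add[of 0 0] by simp

lemma D_minus: "D (- x) = - D x"
  using D_add[of x "- x"] D_0 by (simp add: eq_neg_iff_add_eq_0 add.commute)

lemma D_of_int: "D (of_int k * x) = of_int k * D x"
  by (induction k rule: int_induct[of _ 0])
    (simp_all add: D_0 D_add D_minus distrib_right left_diff_distrib diff_conv_add_uminus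
      del: add_uminus_conv_diff)

lemma op_poly_0: "op_poly D 0 x = 0"
  by (simp add: op_poly_def)

lemma op_poly_pCons: "op_poly D (pCons c f) x = of_int c * x + D (op_poly D f x)"
  by (cases "f = 0 \<and> c = 0") (auto simp: op_poly_def D_0 fold_coeffs_pCons_coeff_not_0_eq fold_coeffs_pCons_not_0_0_eq)

lemma op_poly_add: "op_poly D (f + g) x = op_poly D f x + op_poly D g x"
  by (induction f g rule: poly_induct2) (simp_all add: op_poly_0 op_poly_pCons D_add distrib_right)

lemma op_poly_smult: "op_poly D (smult c f) x = of_int c * op_poly D f x"
  by (induction f) (simp_all add: op_poly_0 op_poly_pCons D_of_int distrib_left mult.assoc)

lemma op_poly_diff: "op_poly D (f - g) x = op_poly D f x - op_poly D g x"
  using op_poly_add[of "f - g" g x] by simp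

lemma op_poly_sum: "op_poly D (sum f I) x = (\<Sum>i\<in>I. op_poly D (f i) x)"
  by (induction I rule: infinite_finite_induct) (simp_all add: op_poly_0 op_poly_add)

lemma op_poly_mult: "op_poly D (f * g) x = op_poly D f (op_poly D g x)"
  by (induction f) (simp_all add: op_poly_0 op_poly_pCons op_poly_add op_poly_smult)

lemma op_poly_X_plus_1_power: "op_poly D ([:1, 1:] ^ n) x = ((\<lambda>z. z + D z) ^^ n) x"
  by (induction n) (simp_all add: one_pCons op_poly_0 op_poly_pCons op_poly_mult D_0 del: mult_pCons_left mult_pCons_right)

end

text \<open>By \<open>X * \<psi> = (X + 1) ^ p - 1\<close> the coefficients are the binomials
  \<open>p choose Suc k\<close>: divisible by \<open>p\<close> below the top, with constant
  coefficient \<open>p\<close>. Eisenstein's criterion gives irreducibility, which means primality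
  for integer polynomials.\<close>

lemma cyclotomic_shifted:
  fixes p :: nat
  assumes p: "prime p"
  defines "\<psi> \<equiv> (\<Sum>i<p. [:1, 1:] ^ i :: int poly)"
  shows "prime_elem \<psi>" "degree \<psi> = p - 1" "lead_coeff \<psi> = 1"
proof -
  have "pCons 0 \<psi> = [:0, 1:] * \<psi>" by simp
  also have "\<dots> = ([:1, 1:] - 1) * \<psi>" by (simp add: one_pCons)
  also have "\<dots> = [:1, 1:] ^ p - 1" unfolding \<psi>_def by (rule power_diff_1_eq[symmetric])
  finally have X: "pCons 0 \<psi> = [:1, 1:] ^ p - 1" .
  have c: "coeff \<psi> k = int (p choose Suc k)" for k
  proof -
    have "coeff \<psi> k = coeff (pCons 0 \<psi>) (Suc k)" by simp
    also have "\<dots> = coeff ([:1, 1:] ^ p) (Suc k)" unfolding X by (simp add: one_pCons)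
    also have "\<dots> = int (p choose Suc k)"
    proof (cases "Suc k \<le> p")
      case True
      then show ?thesis by (simp add: coeff_linear_poly_power)
    next
      case False
      then show ?thesis by (subst coeff_eq_0) (simp_all add: degree_linear_power binomial_eq_0)
    qed
    finally show ?thesis .
  qed
  have p1: "p \<ge> 2" using p by (rule prime_ge_2_nat)
  show deg: "degree \<psi> = p - 1"
  proof (rule antisym)
    show "degree \<psi> \<le> p - 1" by (rule degree_le) (auto simp: c)
    show "p - 1 \<le> degree \<psi>" using p1 by (intro le_degree) (simp add: c)
  qed
  show lead: "lead_coeff \<psi> = 1" using p1 by (simp add: deg c)
  have "irreducible \<psi>"
  proof (rule eisenstein[of "int p"])
    show "int p dvd coeff \<psi> k" if "k < degree \<psi>" for k
      using dvd_choose_prime[of "Suc k" p] that p p1 by (simp add: c deg)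
    show "\<not> int p ^ 2 dvd coeff \<psi> 0"
    proof
      assume "int p ^ 2 dvd coeff \<psi> 0"
      then have "int p * int p dvd int p * 1" by (simp add: c power2_eq_square)
      then have "int p dvd 1" using p1 by (subst (asm) dvd_mult_cancel_left) auto
      then show False using p1 by simp
    qed
  qed (use p p1 lead deg in auto)
  then show "prime_elem \<psi>" by (rule irreducible_imp_prime_poly)
qed

section \<open>Prime degree: generators of the group and of the field, a real embedding, normal
  bases\<close>

locale prime_galois = finite_galois T for T :: "'a::field_char_0 itself" +
  assumes prime_dK: "prime dK" and dK_ge_3: "dK \<ge> 3"
begin

lemma odd_dK: "odd dK"
  using prime_odd_nat[OF prime_dK] dK_ge_3 by simp

text \<open>By Lagrange, a nontrivial element of a group of prime order has the group order as its
  order.\<close>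

lemma generator_of_Gal:
  assumes s: "\<sigma> \<in> (rat_Gal :: ('a \<Rightarrow> 'a) set)" and nid: "\<sigma> \<noteq> id"
  shows "bij_betw (\<lambda>i. \<sigma> ^^ i) {..<dK} rat_Gal" "\<sigma> ^^ dK = id"
proof -
  let ?G = "Gal_group :: ('a \<Rightarrow> 'a) monoid"
  interpret G: group ?G by (rule group_Gal_group)
  have carrier: "carrier ?G = rat_Gal" by (simp add: Gal_group_def)
  have one: "\<one>\<^bsub>?G\<^esub> = id" by (simp add: Gal_group_def)
  have sG: "\<sigma> \<in> carrier ?G" using s carrier by simp
  have "G.ord \<sigma> dvd order ?G" by (rule G.ord_dvd_group_order[OF sG])
  moreover have order: "order ?G = dK" by (simp add: order_def carrier card_Gal)
  moreover have "G.ord \<sigma> \<noteq> 1" using G.ord_eq_1[OF sG] nid by (simp add: Gal_group_def)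
  ultimately have ord: "G.ord \<sigma> = dK" using prime_dK by (auto simp: prime_nat_iff)
  show "\<sigma> ^^ dK = id" using G.pow_ord_eq_1[OF sG] by (simp add: ord Gal_group_pow one)
  have "inj_on (\<lambda>i. \<sigma> ^^ i) {0..dK - 1}"
    using G.ord_inj[OF sG] by (simp add: ord Gal_group_pow)
  then have inj: "inj_on (\<lambda>i. \<sigma> ^^ i) {..<dK}" by (rule inj_on_subset) auto
  have sub: "(\<lambda>i. \<sigma> ^^ i) ` {..<dK} \<subseteq> rat_Gal"
    using G.nat_pow_closed[OF sG] by (auto simp: carrier Gal_group_pow)
  have "(\<lambda>i. \<sigma> ^^ i) ` {..<dK} = rat_Gal"
    by (rule card_subset_eq[OF finite_Gal sub]) (simp add: card_image inj card_Gal)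
  with inj show "bij_betw (\<lambda>i. \<sigma> ^^ i) {..<dK} rat_Gal" by (simp add: bij_betw_def)
qed

lemma ex_nontrivial_Gal: "\<exists>\<sigma>\<in>rat_Gal. \<sigma> \<noteq> (id :: 'a \<Rightarrow> 'a)"
proof (rule ccontr)
  assume "\<not> ?thesis"
  then have "rat_Gal \<subseteq> {id :: 'a \<Rightarrow> 'a}" by blast
  then have "card (rat_Gal :: ('a \<Rightarrow> 'a) set) \<le> 1"
    using card_mono[of "{id :: 'a \<Rightarrow> 'a}"] by fastforce
  then show False using card_Gal dK_ge_3 by simp
qed

lemma Rats_if_fixed_by_one:
  assumes s: "\<sigma> \<in> rat_Gal" "\<sigma> \<noteq> id" and fx: "\<sigma> x = (x::'a)"
  shows "x \<in> \<rat>"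
proof (rule Rats_if_fixed)
  fix \<tau> :: "'a \<Rightarrow> 'a" assume "\<tau> \<in> rat_Gal"
  then obtain i where "\<tau> = \<sigma> ^^ i"
    using generator_of_Gal(1)[OF s] by (auto simp: bij_betw_def)
  moreover have "(\<sigma> ^^ i) x = x" by (induction i) (simp_all add: fx)
  ultimately show "\<tau> x = x" by simp
qed

lemma Gal_inj_on_irrational:
  assumes "y \<notin> \<rat>" "\<sigma> \<in> rat_Gal" "\<tau> \<in> rat_Gal" "\<sigma> y = \<tau> (y::'a)"
  shows "\<sigma> = \<tau>"
proof (rule ccontr)
  assume ne: "\<sigma> \<noteq> \<tau>"
  let ?i = "inv_into UNIV \<tau>"
  have i: "?i \<in> rat_Gal" "?i \<circ> \<tau> = id" "\<tau> \<circ> ?i = id" using rat_Gal_inv[OF assms(3)] by auto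
  have "?i \<circ> \<sigma> \<in> rat_Gal" using i(1) assms(2) by (rule rat_Gal_comp)
  moreover have "?i \<circ> \<sigma> \<noteq> id"
  proof
    assume "?i \<circ> \<sigma> = id"
    then have "\<tau> \<circ> (?i \<circ> \<sigma>) = \<tau>" by simp
    then show False using ne i(3) by (simp flip: comp_assoc)
  qed
  moreover have "(?i \<circ> \<sigma>) y = y" using i(2) assms(4) by (metis comp_apply id_apply)
  ultimately show False using Rats_if_fixed_by_one assms(1) by blast
qed

lemma ex_irrational: "\<exists>y::'a. y \<notin> \<rat>"
proof -
  obtain \<sigma> :: "'a \<Rightarrow> 'a" where s: "\<sigma> \<in> rat_Gal" "\<sigma> \<noteq> id" using ex_nontrivial_Gal by blast
  then obtain y where "\<sigma> y \<noteq> y" by (auto simp: fun_eq_iff)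
  then have "y \<notin> \<rat>" using rat_Gal_of_rat[OF s(1)] by (auto elim: Rats_cases)
  then show ?thesis ..
qed

lemma inj_on_conjugates: "y \<notin> \<rat> \<Longrightarrow> inj_on (\<lambda>\<sigma>. \<sigma> (y::'a)) rat_Gal"
  using Gal_inj_on_irrational by (auto intro: inj_onI)

text \<open>The \<open>dK\<close> conjugates of \<open>y\<close> are distinct and are all roots of
  \<open>f\<close>.\<close>

lemma degree_ge_if_root:
  assumes y: "(y::'a) \<notin> \<rat>" and f: "poly (map_poly of_rat f) y = 0" "f \<noteq> 0"
  shows "degree f \<ge> dK"
proof -
  let ?F = "map_poly of_rat f :: 'a poly"
  have F: "?F \<noteq> 0" using f(2) by (simp add: map_poly_eq_0_iff)
  have "(\<lambda>\<sigma>. \<sigma> y) ` rat_Gal \<subseteq> {x. poly ?F x = 0}"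
    using f(1) by (auto simp: rat_Gal_poly[symmetric] rat_Gal_0)
  then have "card ((\<lambda>\<sigma>. \<sigma> y) ` rat_Gal) \<le> card {x. poly ?F x = 0}"
    using poly_roots_finite[OF F] by (intro card_mono)
  also have "\<dots> \<le> degree ?F" by (rule card_poly_roots_bound[OF F])
  also have "degree ?F = degree f" by (simp add: degree_map_poly)
  finally show ?thesis by (simp add: card_image[OF inj_on_conjugates[OF y]] card_Gal)
qed

lemma powers_rat_indep:
  assumes y: "(y::'a) \<notin> \<rat>"
  shows "rat_indep dK (\<lambda>i. y ^ i)"
  unfolding rat_indep_def
proof (intro allI impI)
  fix x i assume x: "(\<Sum>i<dK. of_rat (x i) * y ^ i) = 0" and i: "i < dK"
  let ?f = "\<Sum>i<dK. monom (x i) i"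
  have root: "poly (map_poly of_rat ?f) y = 0" using x by (simp add: poly_map_poly_of_rat_sum_monom)
  have "degree ?f \<le> dK - 1"
    by (intro degree_sum_le) (auto intro: order_trans[OF degree_monom_le])
  then have "degree ?f < dK" using dK_ge_3 by simp
  then have "?f = 0" using degree_ge_if_root[OF y root] by force
  then have "coeff ?f i = 0" by simp
  then show "x i = 0" using i by (simp add: coeff_sum)
qed

lemma ex_poly_repr:
  assumes y: "(y::'a) \<notin> \<rat>"
  shows "\<exists>f. z = poly (map_poly of_rat f) y"
proof -
  obtain x where "z = (\<Sum>i<dK. of_rat (x i) * y ^ i)"
    using rat_indep_coords[OF powers_rat_indep[OF y]] by blast
  then show ?thesis by (metis poly_map_poly_of_rat_sum_monom)
qed

text \<open>An automorphism only permutes the factors, so it fixes the coefficients, which are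
  therefore rational.\<close>

lemma orbit_poly:
  obtains p where "map_poly of_rat p = (\<Prod>\<sigma>\<in>rat_Gal. [:- \<sigma> (y::'a), 1:])" "degree p = dK" "p \<noteq> 0"
proof -
  let ?P = "\<Prod>\<sigma>\<in>rat_Gal. [:- \<sigma> y, 1:]"
  have fixed: "\<tau> (coeff ?P k) = coeff ?P k" if t: "\<tau> \<in> rat_Gal" for \<tau> k
  proof -
    have prod: "map_poly \<tau> (prod f I) = (\<Prod>i\<in>I. map_poly \<tau> (f i))" for f :: "('a \<Rightarrow> 'a) \<Rightarrow> 'a poly" and I
      by (induction I rule: infinite_finite_induct)
        (simp_all add: rat_Gal_hom[OF t] map_poly_hom_mult[of \<tau>])
    have "map_poly \<tau> ?P = (\<Prod>\<sigma>\<in>rat_Gal. [:- (\<tau> \<circ> \<sigma>) y, 1:])"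
      by (simp add: prod map_poly_pCons rat_Gal_hom[OF t])
    also have "\<dots> = ?P"
      by (rule prod.reindex_bij_betw[OF bij_betw_rat_Gal_comp[OF t], of "\<lambda>\<sigma>. [:- \<sigma> y, 1:]"])
    finally show ?thesis by (metis coeff_map_poly rat_Gal_0[OF t])
  qed
  have "\<exists>q. of_rat q = coeff ?P k \<and> (coeff ?P k = 0 \<longrightarrow> q = 0)" for k
    using Rats_if_fixed[of "coeff ?P k"] fixed[of _ k] by (auto elim!: Rats_cases)
  then obtain q where q: "\<And>k. of_rat (q k) = coeff ?P k" by metis
  have q0: "q k = 0" if "k > degree ?P" for k
    using q[of k] that by (simp add: coeff_eq_0)
  define p where "p = Abs_poly q"
  have cp: "coeff p k = q k" for k
    unfolding p_def by (subst coeff_Abs_poly[of "degree ?P"]) (auto intro: q0)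
  have eq: "map_poly of_rat p = ?P"
    by (rule poly_eqI) (simp add: coeff_map_poly cp q)
  have "degree p = degree (map_poly of_rat p :: 'a poly)" by (simp add: degree_map_poly)
  also have "\<dots> = dK" unfolding eq
    by (subst degree_prod_eq_sum_degree) (simp_all add: card_Gal)
  finally have "degree p = dK" .
  moreover then have "p \<noteq> 0" using dK_ge_3 by auto
  ultimately show ?thesis using that eq by blast
qed

text \<open>An irrational \<open>y\<close> generates the field, and its characteristic polynomial,
  of odd degree, has a real root \<open>r\<close>. The embedding replaces \<open>y\<close> by
  \<open>r\<close> in polynomial expressions.\<close>

lemma ex_real_embedding:
  "\<exists>\<phi> :: 'a \<Rightarrow> real. (\<forall>x y. \<phi> (x + y) = \<phi> x + \<phi> y) \<and> (\<forall>x y. \<phi> (x * y) = \<phi> x * \<phi> y) \<and>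
    (\<forall>q. \<phi> (of_rat q) = of_rat q)"
proof -
  obtain y :: 'a where y: "y \<notin> \<rat>" using ex_irrational by blast
  obtain p where p: "map_poly of_rat p = (\<Prod>\<sigma>\<in>rat_Gal. [:- \<sigma> y, 1:])" "degree p = dK" "p \<noteq> 0"
    using orbit_poly by blast
  have py: "poly (map_poly of_rat p) y = 0"
    unfolding p(1) poly_prod using finite_Gal rat_Gal_id by (intro prod_zero) (auto intro!: bexI[of _ id])
  have "odd (degree (map_poly of_rat p :: real poly))" using p(2) odd_dK by (simp add: degree_map_poly)
  then obtain r :: real where r: "poly (map_poly of_rat p) r = 0" using odd_degree_real_root by blast
  note hom = map_poly_hom[of "of_rat :: rat \<Rightarrow> 'a", OF of_rat_0 of_rat_add of_rat_mult]
    map_poly_hom[of "of_rat :: rat \<Rightarrow> real", OF of_rat_0 of_rat_add of_rat_mult]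
  have wd: "poly (map_poly of_rat f) r = poly (map_poly of_rat g) r"
    if "poly (map_poly of_rat f) y = poly (map_poly of_rat g) y" for f g
  proof -
    \<comment> \<open>The remainder vanishes at \<open>y\<close> and has degree below
      \<open>dK\<close>, so it is 0: two expressions for one element differ by a multiple of
      \<open>p\<close>, which vanishes at \<open>r\<close>.\<close>
    define h where "h = (f - g) mod p"
    have fg: "f = g + (p * ((f - g) div p) + h)" by (simp add: h_def)
    have "poly (map_poly of_rat h) y = 0"
      using that unfolding arg_cong[OF fg, of "map_poly of_rat"] by (simp add: hom py)
    then have "h = 0"
      using degree_ge_if_root[OF y, of h] degree_mod_less[OF p(3), of "f - g"] p(2) by (force simp: h_def)
    then show ?thesis unfolding arg_cong[OF fg, of "map_poly of_rat"] by (simp add: hom r)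
  qed
  obtain F where F: "\<And>z::'a. z = poly (map_poly of_rat (F z)) y" using ex_poly_repr[OF y] by metis
  define \<phi> where "\<phi> = (\<lambda>z. poly (map_poly of_rat (F z)) r)"
  have \<phi>: "\<phi> (poly (map_poly of_rat f) y) = poly (map_poly of_rat f) r" for f
    unfolding \<phi>_def by (rule wd) (rule F[symmetric])
  have \<phi>F: "poly (map_poly of_rat (F z)) r = \<phi> z" for z by (simp add: \<phi>_def)
  have "\<phi> (x + z) = \<phi> x + \<phi> z" for x z
    using \<phi>[of "F x + F z"] by (simp add: hom F[symmetric] \<phi>F)
  moreover have "\<phi> (x * z) = \<phi> x * \<phi> z" for x z
    using \<phi>[of "F x * F z"] by (simp add: hom F[symmetric] \<phi>F)
  moreover have "\<phi> (of_rat q) = of_rat q" for q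
  proof -
    have "map_poly of_rat [:q:] = ([:of_rat q:] :: 'a poly)" "map_poly of_rat [:q:] = ([:of_rat q:] :: real poly)"
      by (rule poly_eqI, simp add: coeff_map_poly coeff_pCons split: nat.splits)+
    then show ?thesis using \<phi>[of "[:q:]"] by simp
  qed
  ultimately show ?thesis by blast
qed

text \<open>The prime \<open>\<psi>\<close> acts as the trace and kills \<open>\<gamma>\<close>. A
  nonzero annihilator \<open>r\<close> of least degree divides some \<open>a * \<psi>\<close> with
  \<open>a\<close> a nonzero integer. Either \<open>\<psi>\<close> divides \<open>r\<close>,
  excluded by the degree, or \<open>r\<close> is a constant, which cannot kill
  \<open>\<gamma> \<noteq> 0\<close>.\<close>

lemma annihilator_of_trace_zero:
  assumes s: "\<sigma> \<in> rat_Gal" "\<sigma> \<noteq> id" and g0: "\<gamma> \<noteq> (0::'a)" and tr: "gal_trace \<gamma> = 0"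
    and f: "op_poly (\<lambda>z. \<sigma> z - z) f \<gamma> = 0" "degree f < dK - 1"
  shows "f = 0"
proof (rule ccontr)
  assume fn0: "f \<noteq> 0"
  define D where "D = (\<lambda>z. \<sigma> z - z)"
  interpret D: int_linear D by unfold_locales (simp add: D_def rat_Gal_add[OF s(1)])
  define \<psi> where "\<psi> = (\<Sum>i<dK. [:1, 1:] ^ i :: int poly)"
  note cyc = cyclotomic_shifted[OF prime_dK, folded \<psi>_def]
  have psi: "op_poly D \<psi> \<gamma> = 0"
  proof -
    have "op_poly D \<psi> \<gamma> = (\<Sum>i<dK. (\<sigma> ^^ i) \<gamma>)"
      by (simp add: \<psi>_def D.op_poly_sum D.op_poly_X_plus_1_power) (simp add: D_def)
    also have "\<dots> = gal_trace \<gamma>"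
      unfolding gal_trace_def using sum.reindex_bij_betw[OF generator_of_Gal(1)[OF s], of "\<lambda>\<tau>. \<tau> \<gamma>"] by simp
    finally show ?thesis using tr by simp
  qed
  define P where "P = (\<lambda>r. r \<noteq> 0 \<and> op_poly D r \<gamma> = 0)"
  have "P f" using fn0 f(1) by (simp add: P_def D_def)
  define r where "r = (ARG_MIN degree r. P r)"
  have r: "P r" "\<And>s. P s \<Longrightarrow> degree r \<le> degree s"
    using arg_min_nat_lemma[of P f degree] \<open>P f\<close> unfolding r_def by auto
  have dr: "degree r < dK - 1" using r(2)[OF \<open>P f\<close>] f(2) by simp
  have rn0: "r \<noteq> 0" and rg: "op_poly D r \<gamma> = 0" using r(1) by (auto simp: P_def)
  \<comment> \<open>Over the integers, division with remainder works only up to a factor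
    \<open>a\<close>. The pseudo-remainder also annihilates \<open>\<gamma>\<close>, so it is 0 by
    the choice of \<open>r\<close>.\<close>
  obtain a q where aq: "a \<noteq> 0" "smult a \<psi> = r * q + pseudo_mod \<psi> r"
    using pseudo_mod(1)[OF rn0] by blast
  have "op_poly D (smult a \<psi> - q * r) \<gamma> = 0"
    by (simp add: D.op_poly_diff D.op_poly_smult D.op_poly_mult psi rg)
       (metis D.op_poly_smult D.op_poly_mult D.op_poly_0 mult_zero_right mult.commute psi rg)
  then have "op_poly D (pseudo_mod \<psi> r) \<gamma> = 0" using aq(2) by (simp add: mult.commute)
  then have "pseudo_mod \<psi> r = 0"
    using pseudo_mod(2)[OF rn0, of \<psi>] r(2)[of "pseudo_mod \<psi> r"] by (force simp: P_def)
  then have a\<psi>: "smult a \<psi> = r * q" using aq(2) by simp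
  have pn0: "\<psi> \<noteq> 0" using cyc(1) by (simp add: prime_elem_def)
  have "\<psi> dvd r * q" by (simp flip: a\<psi> add: dvd_smult)
  then consider "\<psi> dvd r" | "\<psi> dvd q" using cyc(1) prime_elem_dvd_mult_iff by blast
  then show False
  proof cases
    case 1
    then have "degree \<psi> \<le> degree r" using rn0 by (rule dvd_imp_degree_le)
    then show False using dr cyc(2) by simp
  next
    case 2
    then obtain t where t: "q = \<psi> * t" by blast
    then have "\<psi> * [:a:] = \<psi> * (r * t)" using a\<psi> by (simp add: mult_ac)
    then have "[:a:] = r * t" using pn0 by (simp only: mult_cancel_left) simp
    then have "degree (r * t) = 0" and "t \<noteq> 0" using aq(1) by (metis degree_pCons_0, auto)
    then have "degree r = 0" using rn0 by (simp add: degree_mult_eq)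
    then obtain c where c: "r = [:c:]" by (meson degree_eq_zeroE)
    then have "of_int c * \<gamma> = 0" using rg by (simp add: D.op_poly_pCons D.op_poly_0 D.D_0)
    then show False using g0 c rn0 by simp
  qed
qed

text \<open>A relation becomes a polynomial \<open>f\<close> in \<open>D\<close> that kills
  \<open>\<beta>\<close>, hence also \<open>\<gamma> = D \<beta>\<close>, which has trace 0 and is
  nonzero by irrationality. So \<open>f\<close> is a constant multiple of \<open>\<psi>\<close>, and
  since \<open>\<psi>\<close> sends \<open>\<beta>\<close> to its nonzero trace, the constant is
  0.\<close>

lemma conjugates_rat_indep:
  assumes s: "\<sigma> \<in> rat_Gal" "\<sigma> \<noteq> id" and b: "\<beta> \<notin> \<rat>" and tr: "gal_trace (\<beta>::'a) \<noteq> 0"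
  shows "rat_indep dK (\<lambda>i. (\<sigma> ^^ i) \<beta>)"
  unfolding rat_indep_def
proof (intro allI impI)
  fix x j assume x: "(\<Sum>i<dK. of_rat (x i) * (\<sigma> ^^ i) \<beta>) = 0" and j: "j < dK"
  obtain N :: int and a where N: "N > 0" "\<And>i. i < dK \<Longrightarrow> of_int N * x i = of_int (a i)"
    using common_denominator_rat[of dK x] by blast
  define D where "D = (\<lambda>z. \<sigma> z - z)"
  interpret D: int_linear D by unfold_locales (simp add: D_def rat_Gal_add[OF s(1)])
  have pow: "op_poly D ([:1, 1:] ^ i) z = (\<sigma> ^^ i) z" for i z
    unfolding D.op_poly_X_plus_1_power by (simp add: D_def)
  define f where "f = (\<Sum>i<dK. smult (a i) ([:1, 1:] ^ i))"
  define \<psi> where "\<psi> = (\<Sum>i<dK. [:1, 1:] ^ i :: int poly)"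
  have fb: "op_poly D f \<beta> = 0"
  proof -
    have "op_poly D f \<beta> = (\<Sum>i<dK. of_int (a i) * (\<sigma> ^^ i) \<beta>)"
      by (simp add: f_def D.op_poly_sum D.op_poly_smult pow)
    also have "\<dots> = (\<Sum>i<dK. of_rat (of_int N * x i) * (\<sigma> ^^ i) \<beta>)"
      by (intro sum.cong) (simp_all add: N(2))
    also have "\<dots> = of_int N * (\<Sum>i<dK. of_rat (x i) * (\<sigma> ^^ i) \<beta>)"
      by (simp add: of_rat_mult sum_distrib_left mult.assoc)
    finally show ?thesis using x by simp
  qed
  have psi: "op_poly D \<psi> z = gal_trace z" for z
    using sum.reindex_bij_betw[OF generator_of_Gal(1)[OF s], of "\<lambda>\<tau>. \<tau> z"]
    by (simp add: \<psi>_def D.op_poly_sum pow gal_trace_def)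
  define \<gamma> where "\<gamma> = D \<beta>"
  have g0: "\<gamma> \<noteq> 0" using Rats_if_fixed_by_one[OF s, of \<beta>] b by (auto simp: \<gamma>_def D_def)
  have trg: "gal_trace \<gamma> = 0"
    using gal_trace_conj[OF s(1), of \<beta>] gal_trace_add[of \<gamma> \<beta>] by (simp add: \<gamma>_def D_def)
  have "op_poly D f \<gamma> = 0"
  proof -
    have "\<gamma> = op_poly D [:0, 1:] \<beta>" by (simp add: \<gamma>_def D.op_poly_pCons D.op_poly_0 D.D_0)
    then have "op_poly D f \<gamma> = op_poly D [:0, 1:] (op_poly D f \<beta>)"
      by (simp only: D.op_poly_mult[symmetric] mult.commute)
    then show ?thesis using fb by (simp add: D.op_poly_pCons D.op_poly_0 D.D_0)
  qed
  \<comment> \<open>Subtracting this multiple of \<open>\<psi>\<close> removes the power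
    \<open>(X + 1) ^ (dK - 1)\<close>, so the degree drops below \<open>dK - 1\<close> while
    \<open>\<gamma>\<close> is still annihilated.\<close>
  then have "op_poly D (f - smult (a (dK - 1)) \<psi>) \<gamma> = 0"
    by (simp add: D.op_poly_diff D.op_poly_smult psi trg)
  moreover have "degree (f - smult (a (dK - 1)) \<psi>) < dK - 1"
  proof -
    have dK: "dK = Suc (dK - 1)" using dK_ge_3 by simp
    have "f - smult (a (dK - 1)) \<psi> = (\<Sum>i<dK. smult (a i - a (dK - 1)) ([:1, 1:] ^ i))"
      by (simp add: f_def \<psi>_def smult_sum2 sum_subtractf[symmetric] smult_diff_left)
    also have "\<dots> = (\<Sum>i<dK - 1. smult (a i - a (dK - 1)) ([:1, 1:] ^ i))"
      by (subst dK) simp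
    finally have eq: "f - smult (a (dK - 1)) \<psi> = (\<Sum>i<dK - 1. smult (a i - a (dK - 1)) ([:1, 1:] ^ i))" .
    have "degree (f - smult (a (dK - 1)) \<psi>) \<le> dK - 2"
      unfolding eq
    proof (rule degree_sum_le)
      fix i assume "i \<in> {..<dK - 1}"
      then have "i \<le> dK - 2" by auto
      moreover have "degree (smult (a i - a (dK - 1)) ([:1, 1:] ^ i)) \<le> i"
        using degree_smult_le[of "a i - a (dK - 1)" "[:1, 1:] ^ i"]
        by (simp only: degree_linear_power)
      ultimately show "degree (smult (a i - a (dK - 1)) ([:1, 1:] ^ i)) \<le> dK - 2"
        by (rule order_trans[rotated])
    qed simp
    then show ?thesis using dK_ge_3 by simp
  qed
  ultimately have "f - smult (a (dK - 1)) \<psi> = 0"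
    by (rule annihilator_of_trace_zero[OF s g0 trg, folded D_def])
  then have f: "f = smult (a (dK - 1)) \<psi>" by simp
  then have "of_int (a (dK - 1)) * gal_trace \<beta> = 0" using fb by (simp add: D.op_poly_smult psi)
  then have "f = 0" using tr f by simp
  \<comment> \<open>Substituting \<open>z - 1\<close> for \<open>X\<close> turns the powers of
    \<open>X + 1\<close> into monomials and exposes the coefficients \<open>a i\<close>.\<close>
  have "poly (\<Sum>i<dK. monom (a i) i) z = 0" for z
  proof -
    have "poly (\<Sum>i<dK. monom (a i) i) z = poly f (z - 1)"
      by (simp add: f_def poly_sum poly_monom)
    then show ?thesis using \<open>f = 0\<close> by simp
  qed
  then have "(\<Sum>i<dK. monom (a i) i) = 0" using poly_all_0_iff_0 by blast
  then have "coeff (\<Sum>i<dK. monom (a i) i) j = 0" by simp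
  then have "a j = 0" using j by (simp add: coeff_sum)
  then show "x j = 0" using N(1) N(2)[OF j] by simp
qed

lemma normal_basis_if:
  assumes b: "(\<beta>::'a) \<notin> \<rat>" and tr: "gal_trace \<beta> \<noteq> 0"
  shows "normal_basis ((\<lambda>\<sigma>. \<sigma> \<beta>) ` rat_Gal)"
proof -
  obtain \<sigma> :: "'a \<Rightarrow> 'a" where s: "\<sigma> \<in> rat_Gal" "\<sigma> \<noteq> id" using ex_nontrivial_Gal by blast
  have r: "rat_indep dK (\<lambda>i. (\<sigma> ^^ i) \<beta>)" by (rule conjugates_rat_indep[OF s b tr])
  have G: "rat_Gal = (\<lambda>i. \<sigma> ^^ i) ` {..<dK}" using generator_of_Gal(1)[OF s] by (simp add: bij_betw_def)
  have im: "(\<lambda>\<sigma>. \<sigma> \<beta>) ` rat_Gal = (\<lambda>i. (\<sigma> ^^ i) \<beta>) ` {..<dK}" unfolding G image_image ..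
  have "rat_vs.span ((\<lambda>i. (\<sigma> ^^ i) \<beta>) ` {..<dK}) = UNIV"
    using rat_indep_coords[OF r] rat_span_image_eq[of "\<lambda>i. (\<sigma> ^^ i) \<beta>" dK] r[unfolded rat_indep_iff]
    by (metis UNIV_eq_I)
  then show ?thesis using r[unfolded rat_indep_iff] unfolding normal_basis_def im[symmetric] by auto
qed

end

subsection \<open>Discriminant and integral bases\<close>

lemma det_of_int:
  "det (mat n n (\<lambda>(i,j). of_int (M i j))) = (of_int (det (mat n n (\<lambda>(i,j). M i j))) :: 'b::{comm_ring_1,ring_char_0})"
proof -
  have "mat n n (\<lambda>(i,j). of_int (M i j)) = (map_mat of_int (mat n n (\<lambda>(i,j). M i j)) :: 'b mat)"
    by (rule eq_matI) auto
  then show ?thesis by (simp add: of_int_hom.hom_det)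
qed

text \<open>Cramer's rule for the identity matrix. This is the determinant of exchanging a single
  basis vector.\<close>

lemma det_replace_row_one:
  fixes y :: "nat \<Rightarrow> 'b::field"
  assumes k: "k < n"
  shows "det (mat n n (\<lambda>(i,j). if i = k then y j else if i = j then 1 else 0)) = y k"
proof -
  let ?A = "mat n n (\<lambda>(i,j). if i = k then y j else if i = j then 1 else 0)"
  have "transpose_mat ?A = replace_col (1\<^sub>m n) (1\<^sub>m n *\<^sub>v vec n y) k"
    using k by (intro eq_matI) (auto simp: replace_col_def)
  then have "det (transpose_mat ?A) = vec n y $ k * det (1\<^sub>m n)"
    using cramer_lemma_mat[of "1\<^sub>m n" n "vec n y" k] k by simp
  then show ?thesis using k by (simp add: det_transpose[of _ n])
qed

definition gram_det :: "nat \<Rightarrow> (nat \<Rightarrow> 'a::field_char_0) \<Rightarrow> rat"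
  where "gram_det n b = det (mat n n (\<lambda>(i,j). rat_trace (b i * b j)))"

lemma basis_disc_eq_gram_det: "basis_disc bs = gram_det (length bs) (nth bs)"
  by (simp add: basis_disc_def gram_det_def)

context finite_galois
begin

lemma rat_trace_lincomb:
  "rat_trace ((\<Sum>i<n. of_rat (x i) * b i) * (\<Sum>j<n. of_rat (y j) * (b j :: 'a)))
    = (\<Sum>i<n. \<Sum>j<n. rat_trace (b i * b j) * x i * y j)"
proof -
  have "(\<Sum>i<n. of_rat (x i) * b i) * (\<Sum>j<n. of_rat (y j) * b j)
      = (\<Sum>i<n. \<Sum>j<n. of_rat (x i * y j) * (b i * b j))"
    by (simp add: sum_product of_rat_mult mult_ac)
  then show ?thesis by (simp only: rat_trace_sum rat_trace_of_rat_mult) (simp add: mult_ac)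
qed

text \<open>Gram matrices transform by congruence, which squares the determinant of
  \<open>P\<close>.\<close>

lemma gram_det_change_of_basis:
  fixes b c :: "nat \<Rightarrow> 'a"
  assumes c: "\<And>i. i < n \<Longrightarrow> c i = (\<Sum>j<n. of_rat (P i j) * b j)"
  shows "gram_det n c = det (mat n n (\<lambda>(i,j). P i j)) ^ 2 * gram_det n b"
proof -
  define A where "A = mat n n (\<lambda>(i,j). P i j)"
  define G where "G = mat n n (\<lambda>(i,j). rat_trace (b i * b j))"
  have A: "A \<in> carrier_mat n n" and G: "G \<in> carrier_mat n n" by (simp_all add: A_def G_def)
  have "mat n n (\<lambda>(i,j). rat_trace (c i * c j)) = A * G * transpose_mat A"
  proof (rule eq_matI)
    fix i j assume "i < dim_row (A * G * transpose_mat A)" "j < dim_col (A * G * transpose_mat A)"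
    then have ij: "i < n" "j < n" using A by auto
    have "rat_trace (c i * c j) = (\<Sum>k<n. \<Sum>l<n. rat_trace (b k * b l) * P i k * P j l)"
      by (simp only: c[OF ij(1)] c[OF ij(2)] rat_trace_lincomb)
    also have "\<dots> = (\<Sum>l<n. (\<Sum>k<n. P i k * rat_trace (b k * b l)) * P j l)"
      by (subst sum.swap) (simp add: sum_distrib_left mult_ac)
    finally show "mat n n (\<lambda>(i,j). rat_trace (c i * c j)) $$ (i, j) = (A * G * transpose_mat A) $$ (i, j)"
      using ij by (simp add: A_def G_def scalar_prod_def atLeast0LessThan)
  qed (use A in auto)
  then have "gram_det n c = det (A * G * transpose_mat A)" by (simp add: gram_det_def)
  also have "\<dots> = det A * det G * det A"
    using A G by (simp add: det_mult[of _ n] det_transpose)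
  finally show ?thesis by (simp add: A_def G_def gram_det_def power2_eq_square)
qed

text \<open>Pairing a relation with each \<open>b i\<close> puts its coefficients into the kernel of
  the Gram matrix.\<close>

lemma rat_indep_if_gram_det:
  fixes b :: "nat \<Rightarrow> 'a"
  assumes "gram_det n b \<noteq> 0"
  shows "rat_indep n b"
  unfolding rat_indep_def
proof (intro allI impI, rule ccontr)
  fix x k assume x: "(\<Sum>i<n. of_rat (x i) * b i) = 0" and k: "k < n" "x k \<noteq> 0"
  define G where "G = mat n n (\<lambda>(i,j). rat_trace (b i * b j))"
  have G: "G \<in> carrier_mat n n" by (simp add: G_def)
  have "G *\<^sub>v vec n x = 0\<^sub>v n"
  proof (rule eq_vecI)
    fix i assume "i < dim_vec (0\<^sub>v n :: rat vec)"
    then have i: "i < n" by simp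
    have "(G *\<^sub>v vec n x) $ i = (\<Sum>j<n. rat_trace (b i * b j) * x j)"
      using i by (simp add: G_def scalar_prod_def atLeast0LessThan)
    also have "\<dots> = rat_trace (b i * (\<Sum>j<n. of_rat (x j) * b j))"
      by (simp add: sum_distrib_left rat_trace_sum mult_ac flip: rat_trace_of_rat_mult)
    also have "\<dots> = 0" using rat_trace_of_rat[of 0] by (simp add: x)
    finally show "(G *\<^sub>v vec n x) $ i = 0\<^sub>v n $ i" using i by simp
  qed (simp add: G_def)
  moreover have "vec n x \<noteq> 0\<^sub>v n" using k by (metis index_vec index_zero_vec(1))
  ultimately have "det G = 0" using det_0_iff_vec_prod_zero_field[OF G] by (metis vec_carrier)
  then show False using assms by (simp add: gram_det_def G_def)
qed

lemma gram_det_Ints: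
  fixes b :: "nat \<Rightarrow> 'a"
  assumes "\<And>i. i < n \<Longrightarrow> algebraic_int (b i)"
  shows "gram_det n b \<in> \<int>"
proof -
  have "\<exists>z. i < n \<longrightarrow> j < n \<longrightarrow> rat_trace (b i * b j) = of_int z" for i j
    using rat_trace_algebraic_int[OF algebraic_int_plus_times(2)[OF assms assms], of i j]
    by (auto elim: Ints_cases)
  then obtain z where z: "\<And>i j. i < n \<Longrightarrow> j < n \<Longrightarrow> rat_trace (b i * b j) = of_int (z i j)" by metis
  have "mat n n (\<lambda>(i,j). rat_trace (b i * b j)) = mat n n (\<lambda>(i,j). of_int (z i j))"
    using z by (intro eq_matI) auto
  then show ?thesis by (simp add: gram_det_def det_of_int)
qed

end

text \<open>Composed with the automorphisms, the one embedding \<open>\<phi>\<close> makes all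
  conjugates real, so the trace of a square is a sum of real squares.\<close>

locale totally_real_galois = prime_galois T for T :: "'a::field_char_0 itself" +
  fixes \<phi> :: "'a \<Rightarrow> real"
  assumes \<phi>_add: "\<phi> (x + y) = \<phi> x + \<phi> y" and \<phi>_mult: "\<phi> (x * y) = \<phi> x * \<phi> y"
    and \<phi>_of_rat: "\<phi> (of_rat q) = of_rat q"
begin

lemma \<phi>_0: "\<phi> 0 = 0" using \<phi>_of_rat[of 0] by simp

lemma \<phi>_1: "\<phi> 1 = 1" using \<phi>_of_rat[of 1] by simp

lemma \<phi>_minus: "\<phi> (- x) = - \<phi> x"
  using \<phi>_add[of x "- x"] \<phi>_0 by simp

lemma \<phi>_diff: "\<phi> (x - y) = \<phi> x - \<phi> y"
  using \<phi>_add[of x "- y"] \<phi>_minus by simp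

lemma \<phi>_of_int: "\<phi> (of_int k) = of_int k" using \<phi>_of_rat[of "of_int k"] by simp

lemma \<phi>_sum: "\<phi> (sum f I) = (\<Sum>i\<in>I. \<phi> (f i))"
  by (induction I rule: infinite_finite_induct) (simp_all add: \<phi>_0 \<phi>_add)

lemma \<phi>_prod: "\<phi> (prod f I) = (\<Prod>i\<in>I. \<phi> (f i))"
  by (induction I rule: infinite_finite_induct) (simp_all add: \<phi>_1 \<phi>_mult)

lemma \<phi>_eq_0_iff: "\<phi> x = 0 \<longleftrightarrow> x = 0"
proof
  assume "\<phi> x = 0"
  show "x = 0"
  proof (rule ccontr)
    assume "x \<noteq> 0"
    then have "\<phi> x * \<phi> (1 / x) = 1" using \<phi>_mult[of x "1 / x"] \<phi>_1 by simp
    then show False using \<open>\<phi> x = 0\<close> by simp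
  qed
qed (simp add: \<phi>_0)

lemma rat_trace_real: "real_of_rat (rat_trace x) = (\<Sum>\<sigma>\<in>rat_Gal. \<phi> (\<sigma> x))"
  using rat_trace_eq_gal_trace[of x] \<phi>_of_rat[of "rat_trace x"] by (simp add: gal_trace_def \<phi>_sum)

lemma rat_trace_square: "real_of_rat (rat_trace (x * x)) = (\<Sum>\<sigma>\<in>rat_Gal. \<phi> (\<sigma> x) ^ 2)"
  by (simp add: rat_trace_real rat_Gal_mult \<phi>_mult power2_eq_square)

lemma rat_trace_square_pos:
  assumes "(x::'a) \<noteq> 0"
  shows "rat_trace (x * x) > 0"
proof -
  have "(\<Sum>\<sigma>\<in>rat_Gal. \<phi> (\<sigma> x) ^ 2) > 0"
    using assms finite_Gal rat_Gal_id by (intro sum_pos) (auto simp: \<phi>_eq_0_iff rat_Gal_eq_0_iff)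
  then show ?thesis by (simp flip: rat_trace_square)
qed

lemma norm_ge_1:
  assumes "algebraic_int (x::'a)" "x \<noteq> 0"
  shows "\<bar>\<Prod>\<sigma>\<in>rat_Gal. \<phi> (\<sigma> x)\<bar> \<ge> 1"
proof -
  obtain k where k: "k \<noteq> 0" "(\<Prod>\<sigma>\<in>rat_Gal. \<sigma> x) = of_int k"
    using gal_norm_algebraic_int[OF assms] by blast
  have "(\<Prod>\<sigma>\<in>rat_Gal. \<phi> (\<sigma> x)) = of_int k"
    using arg_cong[OF k(2), of \<phi>] by (simp add: \<phi>_prod \<phi>_of_int)
  then show ?thesis using k(1) by simp
qed

lemma rat_trace_square_ge:
  assumes b: "algebraic_int (\<beta>::'a)" "\<beta> \<notin> \<rat>"
  shows "5/4 * real dK \<le> real_of_rat (rat_trace (\<beta> * \<beta>))"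
proof -
  have b2: "algebraic_int (\<beta> * \<beta>)" "algebraic_int (\<beta> * \<beta> - 1)"
    using b(1) by (auto intro: algebraic_int_plus_times algebraic_int_diff)
  have "\<beta> \<noteq> 0" "\<beta> * \<beta> \<noteq> 1"
    using b(2) by (auto simp: square_eq_1_iff)
  then have nz: "\<beta> * \<beta> \<noteq> 0" "\<beta> * \<beta> - 1 \<noteq> 0" by auto
  have y: "\<phi> (\<sigma> (\<beta> * \<beta>)) > 0" "\<phi> (\<sigma> (\<beta> * \<beta>)) \<noteq> 1" if s: "\<sigma> \<in> (rat_Gal :: ('a \<Rightarrow> 'a) set)" for \<sigma>
  proof -
    show "\<phi> (\<sigma> (\<beta> * \<beta>)) > 0" using \<open>\<beta> \<noteq> 0\<close>
      by (simp add: rat_Gal_mult[OF s] \<phi>_mult \<phi>_eq_0_iff rat_Gal_eq_0_iff[OF s] zero_less_mult_iff linorder_neq_iff[symmetric])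
    have "\<phi> (\<sigma> (\<beta> * \<beta> - 1)) \<noteq> 0" using nz(2) by (simp only: \<phi>_eq_0_iff rat_Gal_eq_0_iff[OF s] not_False_eq_True)
    then show "\<phi> (\<sigma> (\<beta> * \<beta>)) \<noteq> 1"
      by (simp add: rat_Gal_diff[OF s] rat_Gal_1[OF s] \<phi>_diff \<phi>_1)
  qed
  have "\<bar>\<Prod>\<sigma>\<in>rat_Gal. \<phi> (\<sigma> (\<beta> * \<beta>)) - 1\<bar> \<ge> 1"
    using norm_ge_1[OF b2(2) nz(2)] by (simp add: rat_Gal_diff rat_Gal_1 \<phi>_diff \<phi>_1)
  moreover have "(\<Prod>\<sigma>\<in>rat_Gal. \<phi> (\<sigma> (\<beta> * \<beta>))) \<ge> 1"
  proof -
    have "(\<Prod>\<sigma>\<in>rat_Gal. \<phi> (\<sigma> (\<beta> * \<beta>))) > 0" using y by (intro prod_pos) auto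
    then show ?thesis using norm_ge_1[OF b2(1) nz(1)] by simp
  qed
  ultimately have "5/4 * real (card (rat_Gal :: ('a \<Rightarrow> 'a) set)) \<le> (\<Sum>\<sigma>\<in>rat_Gal. \<phi> (\<sigma> (\<beta> * \<beta>)))"
    using y finite_Gal by (intro sum_ge_five_quarters) auto
  then show ?thesis by (simp add: card_Gal rat_trace_real)
qed

lemma gram_LDL:
  assumes "rat_indep n (b :: nat \<Rightarrow> 'a)"
  obtains t U where "\<And>k. k < n \<Longrightarrow> t k > 0" "\<And>k. U k k = 1" "\<And>k i. k < i \<Longrightarrow> U k i = 0"
    "\<And>i j. i < n \<Longrightarrow> j < n \<Longrightarrow> rat_trace (b i * b j) = (\<Sum>k<n. t k * U k i * U k j)"
    "gram_det n b = (\<Prod>k<n. t k)"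
proof -
  have "\<exists>t U. (\<forall>k<n. t k > 0) \<and> (\<forall>k. U k k = 1) \<and> (\<forall>k i. k < i \<longrightarrow> U k i = 0) \<and>
    (\<forall>i<n. \<forall>j<n. rat_trace (b i * b j) = (\<Sum>k<n. t k * U k i * U k j))"
  proof (rule LDL_decomposition)
    fix x :: "nat \<Rightarrow> rat" assume x: "\<exists>i<n. x i \<noteq> 0"
    let ?z = "\<Sum>i<n. of_rat (x i) * b i"
    have "?z \<noteq> 0" using x rat_indepD[OF assms] by blast
    then have "rat_trace (?z * ?z) > 0" by (rule rat_trace_square_pos)
    then show "0 < (\<Sum>i<n. \<Sum>j<n. rat_trace (b i * b j) * x i * x j)" by (simp only: rat_trace_lincomb)
  qed (simp add: mult.commute)
  then obtain t U where "\<forall>k<n. t k > 0" "\<forall>k. U k k = 1" "\<forall>k i. k < i \<longrightarrow> U k i = 0"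
    "\<forall>i<n. \<forall>j<n. rat_trace (b i * b j) = (\<Sum>k<n. t k * U k i * U k j)"
    by (elim exE conjE) (rule that)
  note tU = this[rule_format]
  have "gram_det n b = (\<Prod>k<n. t k)"
    unfolding gram_det_def using tU by (intro det_LDL)
  with tU show ?thesis by (intro that[of t U])
qed

lemma gram_det_pos: "rat_indep n (b :: nat \<Rightarrow> 'a) \<Longrightarrow> gram_det n b > 0"
proof -
  assume r: "rat_indep n b"
  obtain t :: "nat \<Rightarrow> rat" where t: "\<And>k. k < n \<Longrightarrow> t k > 0" "gram_det n b = (\<Prod>k<n. t k)"
    by (rule gram_LDL[OF r]) (rule that)
  show ?thesis unfolding t(2) using t(1) by (intro prod_pos) auto
qed

section \<open>Integral bases that end with 1, and their discriminant\<close>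

lemma ex_multiple_algebraic_int: "\<exists>c::int. c \<noteq> 0 \<and> algebraic_int (of_int c * (z::'a))"
proof -
  obtain p where p: "map_poly of_rat p = (\<Prod>\<sigma>\<in>rat_Gal. [:- \<sigma> z, 1:])" "degree p = dK" "p \<noteq> 0"
    using orbit_poly by blast
  have pz: "poly (map_poly of_rat p) z = 0"
    unfolding p(1) poly_prod using finite_Gal rat_Gal_id by (intro prod_zero) (auto intro!: bexI[of _ id])
  obtain N :: int and a where N: "N > 0" "\<And>i. i < Suc dK \<Longrightarrow> of_int N * coeff p i = of_int (a i)"
    using common_denominator_rat by blast
  define q where "q = (\<Sum>i<Suc dK. monom (a i) i)"
  have cq: "coeff q i = (if i < Suc dK then a i else 0)" for i
    by (simp add: q_def coeff_sum del: sum.lessThan_Suc)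
  have "map_poly of_int q = smult (of_int N) (map_poly of_rat p :: 'a poly)"
  proof (rule poly_eqI)
    fix i
    show "coeff (map_poly of_int q) i = coeff (smult (of_int N) (map_poly of_rat p :: 'a poly)) i"
    proof (cases "i < Suc dK")
      case True
      have "(of_int N * of_rat (coeff p i) :: 'a) = of_rat (of_int N * coeff p i)" by (simp add: of_rat_mult)
      then show ?thesis using True N(2)[OF True] by (simp add: coeff_map_poly cq)
    next
      case False
      then show ?thesis using p(2) by (simp add: coeff_map_poly cq coeff_eq_0)
    qed
  qed
  then have "poly (map_poly of_int q) z = 0" by (simp add: pz)
  moreover have "q \<noteq> 0"
  proof
    assume "q = 0"
    then have "a dK = 0" using cq[of dK] by simp
    then have "coeff p dK = 0" using N(1) N(2)[of dK] by simp
    then show False using p(2,3) by (metis leading_coeff_0_iff)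
  qed
  ultimately show ?thesis using algebraic_int_clear_denominator[of q z] by metis
qed

text \<open>The basis ends with 1, so that the last coordinate of the decomposition in \<open>gram_LDL\<close> is the
  trace divided by the degree.\<close>

definition int_frame :: "(nat \<Rightarrow> 'a) \<Rightarrow> bool"
  where "int_frame b \<longleftrightarrow> rat_indep dK b \<and> (\<forall>i<dK. algebraic_int (b i)) \<and> b (dK - 1) = 1"

text \<open>The powers of an irrational algebraic integer, listed by falling exponent so that 1
  comes last.\<close>

lemma ex_int_frame: "\<exists>b. int_frame b"
proof -
  obtain y0 :: 'a where y0: "y0 \<notin> \<rat>" using ex_irrational by blast
  obtain c :: int where c: "c \<noteq> 0" "algebraic_int (of_int c * y0)"
    using ex_multiple_algebraic_int by blast
  define y where "y = of_int c * y0"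
  have y: "y \<notin> \<rat>"
  proof
    assume "y \<in> \<rat>"
    then have "y / of_int c \<in> \<rat>" by (intro Rats_divide) auto
    then show False using y0 c(1) by (simp add: y_def)
  qed
  have r: "rat_indep dK (\<lambda>i. y ^ i)" by (rule powers_rat_indep[OF y])
  have "rat_indep dK (\<lambda>i. y ^ (dK - 1 - i))"
    unfolding rat_indep_def
  proof (intro allI impI)
    fix x i assume x: "(\<Sum>i<dK. of_rat (x i) * y ^ (dK - 1 - i)) = 0" and i: "i < dK"
    have "(\<Sum>i<dK. of_rat (x (dK - Suc i)) * y ^ i) = (\<Sum>i<dK. of_rat (x i) * y ^ (dK - 1 - i))"
      by (subst sum.nat_diff_reindex[symmetric]) (auto intro!: sum.cong)
    then have "x (dK - Suc (dK - Suc i)) = 0"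
      using rat_indepD[OF r, of "\<lambda>i. x (dK - Suc i)" "dK - Suc i"] x i by simp
    then show "x i = 0" using i by simp
  qed
  moreover have "algebraic_int (y ^ k)" for k using c(2) by (simp add: y_def algebraic_int_power)
  ultimately show ?thesis by (intro exI[of _ "\<lambda>i. y ^ (dK - 1 - i)"]) (simp add: int_frame_def)
qed

text \<open>A frame of least discriminant spans: a coordinate with fractional part \<open>y > 0\<close> would allow an
  exchange that multiplies the discriminant by \<open>y\<^sup>2 < 1\<close>.\<close>

lemma ex_integral_frame:
  "\<exists>b. int_frame b \<and> (\<forall>\<omega>. algebraic_int \<omega> \<longrightarrow> (\<exists>m. \<omega> = (\<Sum>i<dK. of_int (m i) * b i)))"
proof -
  \<comment> \<open>Gram determinants of frames are positive integers, so \<open>nat\<close> and the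
    floor lose nothing and a minimum exists.\<close>
  define b where "b = (ARG_MIN (\<lambda>b. nat \<lfloor>gram_det dK b\<rfloor>) b. int_frame b)"
  have b: "int_frame b" "\<And>c. int_frame c \<Longrightarrow> nat \<lfloor>gram_det dK b\<rfloor> \<le> nat \<lfloor>gram_det dK c\<rfloor>"
    using arg_min_nat_lemma[of int_frame _ "\<lambda>b. nat \<lfloor>gram_det dK b\<rfloor>"] ex_int_frame
    unfolding b_def by blast+
  have ind: "rat_indep dK b" and ai: "\<And>i. i < dK \<Longrightarrow> algebraic_int (b i)" and b1: "b (dK - 1) = 1"
    using b(1) by (auto simp: int_frame_def)
  have min: "gram_det dK b \<le> gram_det dK c" if c: "int_frame c" for c
  proof -
    have "gram_det dK c > 0" "gram_det dK b > 0"
      using c b(1) gram_det_pos by (auto simp: int_frame_def)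
    moreover have "gram_det dK c \<in> \<int>" "gram_det dK b \<in> \<int>"
      using c b(1) gram_det_Ints by (auto simp: int_frame_def)
    ultimately show ?thesis using b(2)[OF c] by (auto elim!: Ints_cases)
  qed
  have "\<exists>m. \<omega> = (\<Sum>i<dK. of_int (m i) * b i)" if w: "algebraic_int \<omega>" for \<omega>
  proof -
    obtain x where x: "\<omega> = (\<Sum>i<dK. of_rat (x i) * b i)" using rat_indep_coords[OF ind] by blast
    \<comment> \<open>The last index is excluded, since an exchange there would remove 1 from the
      frame. Its coordinate is integral for another reason: what remains of \<open>\<omega>\<close>
      is a rational algebraic integer.\<close>
    have xZ: "x k \<in> \<int>" if k: "k < dK - 1" for k
    proof (rule ccontr)
      assume nk: "x k \<notin> \<int>"
      have kd: "k < dK" using k by simp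
      define y where "y = x(k := frac (x k))"
      have y: "0 < y k" "y k < 1" using nk frac_lt_1 by (auto simp: y_def frac_gt_0_iff)
      define c where "c = b(k := \<omega> - of_int \<lfloor>x k\<rfloor> * b k)"
      have ck: "\<omega> - of_int \<lfloor>x k\<rfloor> * b k = (\<Sum>i<dK. of_rat (y i) * b i)"
      proof -
        have "(\<Sum>i<dK. of_rat (y i) * b i) = (\<Sum>i<dK. of_rat (x i) * b i - (if i = k then of_int \<lfloor>x k\<rfloor> * b k else 0))"
          by (intro sum.cong) (auto simp: y_def frac_def of_rat_diff left_diff_distrib)
        also have "\<dots> = \<omega> - of_int \<lfloor>x k\<rfloor> * b k" using kd by (simp add: x sum_subtractf)
        finally show ?thesis by simp
      qed
      define P where "P = (\<lambda>i j. if i = k then y j else if i = j then 1 else 0)"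
      have "c i = (\<Sum>j<dK. of_rat (P i j) * b j)" if "i < dK" for i
      proof (cases "i = k")
        case True
        then show ?thesis by (simp add: c_def ck P_def)
      next
        case False
        then have "(\<Sum>j<dK. of_rat (P i j) * b j) = (\<Sum>j<dK. if i = j then b j else 0)"
          by (intro sum.cong) (auto simp: P_def)
        then show ?thesis using False that by (simp add: c_def)
      qed
      then have "gram_det dK c = det (mat dK dK (\<lambda>(i,j). P i j)) ^ 2 * gram_det dK b"
        by (rule gram_det_change_of_basis)
      also have "det (mat dK dK (\<lambda>(i,j). P i j)) = y k"
        unfolding P_def by (rule det_replace_row_one[OF kd])
      finally have gc: "gram_det dK c = y k ^ 2 * gram_det dK b" .
      have pos: "gram_det dK b > 0" by (rule gram_det_pos[OF ind])
      have "int_frame c"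
        unfolding int_frame_def
      proof (intro conjI allI impI)
        show "rat_indep dK c" using gc pos y(1) by (intro rat_indep_if_gram_det) simp
        show "algebraic_int (c i)" if "i < dK" for i
          using that ai w kd by (auto simp: c_def intro!: algebraic_int_diff algebraic_int_int_scale)
        show "c (dK - 1) = 1" using k b1 by (auto simp: c_def)
      qed
      from min[OF this] have "1 * gram_det dK b \<le> y k ^ 2 * gram_det dK b" by (simp add: gc)
      then have "1 \<le> y k ^ 2" using pos by (simp only: mult_le_cancel_right_pos)
      moreover have "y k ^ 2 < 1" using y by (simp add: power_less_one_iff)
      ultimately show False by simp
    qed
    have "\<exists>z. i < dK - 1 \<longrightarrow> x i = of_int z" for i
      using xZ[of i] by (auto elim: Ints_cases)
    then obtain m where m: "\<And>i. i < dK - 1 \<Longrightarrow> x i = of_int (m i)" by metis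
    have dK: "dK = Suc (dK - 1)" using dK_ge_3 by simp
    have w': "\<omega> = (\<Sum>i<dK - 1. of_int (m i) * b i) + of_rat (x (dK - 1))"
      using m b1 by (subst x, subst dK) simp
    have "algebraic_int (\<omega> - (\<Sum>i<dK - 1. of_int (m i) * b i))"
      using w ai by (intro algebraic_int_diff algebraic_int_sum algebraic_int_int_scale) auto
    then have "algebraic_int (of_rat (x (dK - 1)) :: 'a)" using w' by simp
    then have "(of_rat (x (dK - 1)) :: 'a) \<in> \<int>" using rational_algebraic_int_is_int Rats_of_rat by blast
    then obtain l where "(of_rat (x (dK - 1)) :: 'a) = of_int l" by (elim Ints_cases)
    then have "\<omega> = (\<Sum>i<dK. of_int ((m(dK - 1 := l)) i) * b i)"
      using b1 by (subst w', subst dK) simp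
    then show ?thesis by blast
  qed
  with b(1) show ?thesis by blast
qed

lemma int_span_map_upt:
  fixes b :: "nat \<Rightarrow> 'a"
  assumes "inj_on b {..<n}"
  shows "z \<in> int_mod.span (b ` {..<n}) \<longleftrightarrow> (\<exists>m. z = (\<Sum>i<n. of_int (m i) * b i))"
proof
  assume "z \<in> int_mod.span (b ` {..<n})"
  then obtain u where "z = (\<Sum>v\<in>b ` {..<n}. int_scale (u v) v)"
    unfolding int_mod.span_finite[OF finite_imageI[OF finite_lessThan]] by blast
  then show "\<exists>m. z = (\<Sum>i<n. of_int (m i) * b i)"
    by (intro exI[of _ "\<lambda>i. u (b i)"]) (simp add: sum.reindex[OF assms] int_scale_def)
next
  assume "\<exists>m. z = (\<Sum>i<n. of_int (m i) * b i)"
  then obtain m where "z = (\<Sum>i<n. int_scale (m i) (b i))" by (auto simp: int_scale_def)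
  then show "z \<in> int_mod.span (b ` {..<n})"
    by (simp, intro int_mod.span_sum int_mod.span_scale int_mod.span_base) auto
qed

lemma integral_basis_if_frame:
  assumes b: "int_frame b" "\<forall>\<omega>. algebraic_int \<omega> \<longrightarrow> (\<exists>m. \<omega> = (\<Sum>i<dK. of_int (m i) * b i))"
  shows "integral_basis (map b [0..<dK])"
proof -
  have ind: "rat_indep dK b" and ai: "\<And>i. i < dK \<Longrightarrow> algebraic_int (b i)"
    using b(1) by (auto simp: int_frame_def)
  have inj: "inj_on b {..<dK}" using ind by (simp add: rat_indep_iff)
  have set: "set (map b [0..<dK]) = b ` {..<dK}" by (simp add: atLeast0LessThan)
  have "distinct (map b [0..<dK])" using inj by (simp add: distinct_map atLeast0LessThan)
  moreover have "int_mod.independent (b ` {..<dK})"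
    unfolding int_mod.dependent_finite[OF finite_imageI[OF finite_lessThan]]
  proof safe
    fix u k assume u: "(\<Sum>v\<in>b ` {..<dK}. int_scale (u v) v) = 0" "u (b k) \<noteq> 0" "k < dK"
    have "(\<Sum>i<dK. of_rat (of_int (u (b i))) * b i) = 0"
      using u(1) by (simp add: sum.reindex[OF inj] int_scale_def)
    then have "(of_int (u (b k)) :: rat) = 0"
      using rat_indepD[OF ind, where x = "\<lambda>i. of_int (u (b i))" and i = k] u(3) by blast
    then show False using u(2) by simp
  qed
  moreover have "int_mod.span (b ` {..<dK}) = {x. algebraic_int x}"
    using b(2) ai by (auto simp: int_span_map_upt[OF inj] intro!: algebraic_int_sum algebraic_int_int_scale)
  ultimately show ?thesis unfolding integral_basis_def set by blast
qed

text \<open>The members of \<open>cs\<close> have integer coordinates in the frame, so the two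
  discriminants differ by the square of a nonzero integer determinant.\<close>

lemma gram_det_le_basis_disc:
  assumes b: "int_frame b" "\<forall>\<omega>. algebraic_int \<omega> \<longrightarrow> (\<exists>m. \<omega> = (\<Sum>i<dK. of_int (m i) * b i))"
    and cs: "integral_basis (cs :: 'a list)"
  shows "gram_det dK b \<le> basis_disc cs"
proof -
  have ind: "rat_indep dK b" using b(1) by (simp add: int_frame_def)
  define n where "n = length cs"
  define c where "c = nth cs"
  have inj: "inj_on c {..<n}" using cs by (auto simp: integral_basis_def inj_on_def c_def n_def nth_eq_iff_index_eq)
  have set: "set cs = c ` {..<n}" by (auto simp: c_def n_def set_conv_nth)
  have span: "int_mod.span (c ` {..<n}) = {x. algebraic_int x}" and zind: "int_mod.independent (c ` {..<n})"
    using cs by (simp_all add: integral_basis_def set)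
  have rc: "rat_indep n c"
    unfolding rat_indep_def
  proof (intro allI impI)
    fix x k assume x: "(\<Sum>i<n. of_rat (x i) * c i) = 0" and k: "k < n"
    obtain N :: int and a where N: "N > 0" "\<And>i. i < n \<Longrightarrow> of_int N * x i = of_int (a i)"
      using common_denominator_rat by blast
    have "(\<Sum>i<n. of_int (a i) * c i) = (\<Sum>i<n. of_rat (of_int N * x i) * c i)"
      by (intro sum.cong) (simp_all add: N(2))
    also have "\<dots> = of_int N * (\<Sum>i<n. of_rat (x i) * c i)"
      by (simp add: of_rat_mult sum_distrib_left mult.assoc)
    finally have a0: "(\<Sum>i<n. of_int (a i) * c i) = 0" by (simp add: x)
    define u where "u = (\<lambda>v. a (inv_into {..<n} c v))"
    have "(\<Sum>v\<in>c ` {..<n}. int_scale (u v) v) = (\<Sum>i<n. of_int (a i) * c i)"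
      by (simp add: sum.reindex[OF inj] u_def int_scale_def inj inv_into_f_f)
    then have "u (c k) = 0"
      using zind k a0 unfolding int_mod.dependent_finite[OF finite_imageI[OF finite_lessThan]] by auto
    then have "a k = 0" using k inj by (simp add: u_def)
    then show "x k = 0" using N(1) N(2)[OF k] by simp
  qed
  \<comment> \<open>The length of \<open>cs\<close> is not part of \<open>integral_basis\<close>.
    Every element has a nonzero integer multiple that is an algebraic integer, so \<open>cs\<close>
    spans the field over the rationals.\<close>
  have "dK \<le> n"
  proof -
    have "z \<in> rat_vs.span (c ` {..<n})" for z
    proof -
      obtain e :: int where e: "e \<noteq> 0" "algebraic_int (of_int e * z)"
        using ex_multiple_algebraic_int by blast
      then obtain m where "of_int e * z = (\<Sum>i<n. of_int (m i) * c i)"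
        using span int_span_map_upt[OF inj] by blast
      then have "z = (\<Sum>i<n. of_rat (of_int (m i) / of_int e) * c i)"
        using e(1) by (simp add: of_rat_divide field_simps sum_divide_distrib[symmetric])
      then show ?thesis unfolding rat_span_image_eq[OF inj]
        by (intro exI[of _ "\<lambda>i. of_int (m i) / of_int e"])
    qed
    then have "UNIV \<subseteq> rat_vs.span (c ` {..<n})" by blast
    from rat_vs.dim_le_card[OF this] have "rat_vs.dim (UNIV :: 'a set) \<le> card (c ` {..<n})" by simp
    then show ?thesis by (simp add: card_image[OF inj] rat_degree_def)
  qed
  then have n: "n = dK" using rat_indep_le[OF rc] by simp
  have "\<exists>m. i < n \<longrightarrow> c i = (\<Sum>j<dK. of_int (m j) * b j)" for i
  proof (cases "i < n")
    case True
    then have "c i \<in> int_mod.span (c ` {..<n})" by (intro int_mod.span_base) auto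
    then have "algebraic_int (c i)" using span by blast
    then show ?thesis using b(2) by blast
  qed simp
  then obtain m where m: "\<And>i. i < n \<Longrightarrow> c i = (\<Sum>j<dK. of_int (m i j) * b j)" by metis
  have "c i = (\<Sum>j<n. of_rat (of_int (m i j)) * b j)" if "i < n" for i
    using m[OF that] by (simp add: n)
  then have "gram_det n c = det (mat n n (\<lambda>(i,j). of_int (m i j))) ^ 2 * gram_det n b"
    by (rule gram_det_change_of_basis)
  then have g: "gram_det n c = of_int (det (mat n n (\<lambda>(i,j). m i j)) ^ 2) * gram_det n b"
    by (simp add: det_of_int)
  have "gram_det n c > 0" by (rule gram_det_pos[OF rc])
  then have "det (mat n n (\<lambda>(i,j). m i j)) \<noteq> 0" using g by auto
  then have "det (mat n n (\<lambda>(i,j). m i j)) ^ 2 \<ge> 1"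
    by (metis int_one_le_iff_zero_less zero_less_power2)
  then have "(of_int (det (mat n n (\<lambda>(i,j). m i j)) ^ 2) :: rat) \<ge> 1" by (simp only: of_int_1_le_iff)
  then have "1 * gram_det n b \<le> gram_det n c"
    unfolding g using gram_det_pos[OF ind] n by (intro mult_right_mono) auto
  then show ?thesis by (simp add: basis_disc_eq_gram_det n n_def[symmetric] c_def[symmetric])
qed

lemma integral_frame_field_disc:
  obtains b where "int_frame b" "\<And>\<omega>. algebraic_int \<omega> \<Longrightarrow> \<exists>m. \<omega> = (\<Sum>i<dK. of_int (m i) * b i)"
    "gram_det dK b \<le> field_disc T"
proof -
  obtain b where b: "int_frame b" "\<forall>\<omega>. algebraic_int \<omega> \<longrightarrow> (\<exists>m. \<omega> = (\<Sum>i<dK. of_int (m i) * b i))"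
    using ex_integral_frame by blast
  have "integral_basis (SOME bs :: 'a list. integral_basis bs)"
    using integral_basis_if_frame[OF b] by (rule someI)
  from gram_det_le_basis_disc[OF b this] have "gram_det dK b \<le> field_disc T" by (simp add: field_disc_def)
  with b that show ?thesis by blast
qed

end

subsection \<open>Places and heights\<close>

lemma absolute_value_props:
  assumes v: "absolute_value v"
  shows absolute_value_nonneg: "v x \<ge> 0" and absolute_value_0: "v 0 = 0"
    and absolute_value_mult: "v (x * y) = v x * v y"
    and absolute_value_triangle: "v (x + y) \<le> v x + v y"
    and absolute_value_1: "v 1 = 1" and absolute_value_minus: "v (- x) = v x"
    and absolute_value_diff: "\<bar>v x - v y\<bar> \<le> v (x - y)"
    and absolute_value_power: "v (x ^ n) = v x ^ n"
proof -
  show nonneg: "v x \<ge> 0" and zero: "v 0 = 0" and mult: "v (x * y) = v x * v y"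
    and tri: "v (x + y) \<le> v x + v y" for x y
    using v by (auto simp: absolute_value_def)
  have "v 1 * v 1 = v 1" using mult[of 1 1] by simp
  moreover have "v 1 \<noteq> 0" using v by (simp add: absolute_value_def)
  ultimately show one: "v 1 = 1" by simp
  have "v (- 1) * v (- 1) = 1" using mult[of "- 1" "- 1"] one by simp
  then have "v (- 1) = 1" using nonneg[of "- 1"] by (metis abs_of_nonneg real_sqrt_abs2 real_sqrt_one)
  then show minus: "v (- x) = v x" for x using mult[of "- 1" x] by simp
  show "\<bar>v x - v y\<bar> \<le> v (x - y)"
    using tri[of "x - y" y] tri[of "y - x" x] minus[of "x - y"] by simp
  show "v (x ^ n) = v x ^ n" by (induction n) (simp_all add: one mult)
qed

lemma absolute_value_sum: "absolute_value v \<Longrightarrow> v (sum f I) \<le> (\<Sum>i\<in>I. v (f i))"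
  by (induction I rule: infinite_finite_induct)
    (auto simp: absolute_value_0 intro: order_trans[OF absolute_value_triangle])

lemma absolute_value_prod: "absolute_value v \<Longrightarrow> v (prod f I) = (\<Prod>i\<in>I. v (f i))"
  by (induction I rule: infinite_finite_induct) (simp_all add: absolute_value_1 absolute_value_mult)

lemma padic_abs_of_int_le_1:
  assumes "prime p"
  shows "padic_abs p (of_int k) \<le> 1"
proof -
  have "p \<ge> 1" using prime_ge_1_nat[OF assms] .
  moreover have "real p powi - int m \<le> 1" for m
    using \<open>p \<ge> 1\<close> by (simp add: power_int_minus field_simps one_le_power)
  ultimately show ?thesis by (simp add: padic_abs_def)
qed

lemma ex_rat_seq_tendsto: "\<exists>s :: nat \<Rightarrow> rat. (\<lambda>n. real_of_rat (s n)) \<longlonglongrightarrow> L"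
proof -
  have "\<exists>q. real_of_rat q > L \<and> real_of_rat q < L + 1 / real (Suc n)" for n
    using of_rat_dense[of L "L + 1 / real (Suc n)"] by auto
  then obtain s where s: "\<And>n. real_of_rat (s n) > L" "\<And>n. real_of_rat (s n) < L + 1 / real (Suc n)"
    by metis
  have "(\<lambda>n. L + 1 / real (Suc n)) \<longlonglongrightarrow> L + 0"
    using LIMSEQ_inverse_real_of_nat by (intro tendsto_add tendsto_const) (simp add: inverse_eq_divide)
  then have u: "(\<lambda>n. L + 1 / real (Suc n)) \<longlonglongrightarrow> L" by simp
  have "(\<lambda>n. real_of_rat (s n)) \<longlonglongrightarrow> L"
    by (rule tendsto_sandwich[OF _ _ tendsto_const u])
      (simp_all add: s[THEN less_imp_le] del: of_nat_Suc)
  then show ?thesis by (rule exI[of _ s])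
qed

lemma tendsto_coeff_prod_linear:
  fixes a :: "'b \<Rightarrow> nat \<Rightarrow> real"
  assumes "finite I" "\<And>i. i \<in> I \<Longrightarrow> a i \<longlonglongrightarrow> a' i"
  shows "(\<lambda>n. coeff (\<Prod>i\<in>I. [:- a i n, 1:]) k) \<longlonglongrightarrow> coeff (\<Prod>i\<in>I. [:- a' i, 1:]) k"
  using assms
proof (induction I arbitrary: k rule: finite_induct)
  case (insert j I)
  have c: "coeff ([:- x, 1:] * P) k = (case k of 0 \<Rightarrow> 0 | Suc l \<Rightarrow> coeff P l) - x * coeff P k"
    for x :: real and P
    by (simp add: coeff_pCons split: nat.split)
  have "(\<lambda>n. (case k of 0 \<Rightarrow> 0 | Suc l \<Rightarrow> coeff (\<Prod>i\<in>I. [:- a i n, 1:]) l)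
        - a j n * coeff (\<Prod>i\<in>I. [:- a i n, 1:]) k)
      \<longlonglongrightarrow> (case k of 0 \<Rightarrow> 0 | Suc l \<Rightarrow> coeff (\<Prod>i\<in>I. [:- a' i, 1:]) l)
        - a' j * coeff (\<Prod>i\<in>I. [:- a' i, 1:]) k"
    using insert by (intro tendsto_diff tendsto_mult) (auto split: nat.split)
  then show ?case unfolding prod.insert[OF insert.hyps] c .
qed simp

context totally_real_galois
begin

text \<open>All powers of \<open>\<beta>\<close> are integer combinations of one finite family, and
  \<open>v\<close> is at most 1 on the integers, so the powers of \<open>v \<beta>\<close> are
  bounded.\<close>

lemma nonarchimedean_le_1:
  assumes v: "absolute_value v" and p: "prime p" "\<And>q. v (of_rat q) = padic_abs p q"
    and a: "algebraic_int (\<beta>::'a)"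
  shows "v \<beta> \<le> 1"
proof (rule ccontr)
  assume "\<not> v \<beta> \<le> 1"
  then have gt: "v \<beta> > 1" by simp
  obtain b :: "nat \<Rightarrow> 'a" where b: "\<forall>\<omega>. algebraic_int \<omega> \<longrightarrow> (\<exists>m. \<omega> = (\<Sum>i<dK. of_int (m i) * b i))"
    using ex_integral_frame by blast
  have le: "v (of_int k) \<le> 1" for k
    using p(2)[of "of_int k"] padic_abs_of_int_le_1[OF p(1)] by simp
  have bound: "v \<beta> ^ n \<le> (\<Sum>i<dK. v (b i))" for n
  proof -
    obtain m where m: "\<beta> ^ n = (\<Sum>i<dK. of_int (m i) * b i)"
      using b algebraic_int_power[OF a] by blast
    have "v \<beta> ^ n = v (\<Sum>i<dK. of_int (m i) * b i)" by (simp flip: m add: absolute_value_power[OF v])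
    also have "\<dots> \<le> (\<Sum>i<dK. v (of_int (m i) * b i))" by (rule absolute_value_sum[OF v])
    also have "\<dots> \<le> (\<Sum>i<dK. 1 * v (b i))"
      unfolding absolute_value_mult[OF v]
      using le absolute_value_nonneg[OF v] by (intro sum_mono mult_right_mono) auto
    finally show ?thesis by simp
  qed
  obtain n where "(\<Sum>i<dK. v (b i)) < v \<beta> ^ n" using real_arch_pow[OF gt] by blast
  with bound[of n] show False by simp
qed

text \<open>For rationals \<open>s \<sigma> n\<close> converging to \<open>\<phi> (\<sigma> y)\<close>, the coefficients of \<open>\<Prod>\<sigma>. (X - s \<sigma> n)\<close> converge to
  those of \<open>\<Prod>\<sigma>. (X - \<sigma> y)\<close>, which vanishes at \<open>y\<close>. So \<open>\<Prod>\<sigma>. v (y - s \<sigma> n)\<close> tends to 0.\<close>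

lemma archimedean_close_rational:
  assumes v: "absolute_value v" and arch: "\<And>q. v (of_rat q) = \<bar>real_of_rat q\<bar>"
  shows "\<exists>\<sigma>\<in>rat_Gal. \<forall>e>0. \<exists>q. \<bar>real_of_rat q - \<phi> (\<sigma> (y::'a))\<bar> < e \<and> v (y - of_rat q) < e"
proof (rule ccontr)
  assume neg: "\<not> ?thesis"
  let ?G = "rat_Gal :: ('a \<Rightarrow> 'a) set"
  \<comment> \<open>If no \<open>\<sigma>\<close> works, each has a radius \<open>e \<sigma>\<close>
    such that rationals that close to \<open>\<phi> (\<sigma> y)\<close> stay at
    \<open>v\<close>-distance at least \<open>e \<sigma>\<close> from \<open>y\<close>. The product
    of the radii then bounds from below a product that tends to 0.\<close>
  have "\<forall>\<sigma>. \<exists>e. \<sigma> \<in> ?G \<longrightarrow> e > 0 \<and> (\<forall>q. \<bar>real_of_rat q - \<phi> (\<sigma> y)\<bar> < e \<longrightarrow> v (y - of_rat q) \<ge> e)"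
    using neg by (meson not_less)
  then obtain e where e: "\<And>\<sigma>. \<sigma> \<in> ?G \<Longrightarrow> e \<sigma> > 0"
    "\<And>\<sigma> q. \<sigma> \<in> ?G \<Longrightarrow> \<bar>real_of_rat q - \<phi> (\<sigma> y)\<bar> < e \<sigma> \<Longrightarrow> v (y - of_rat q) \<ge> e \<sigma>" by metis
  have "\<forall>\<sigma>. \<exists>s. (\<lambda>n. real_of_rat (s n)) \<longlonglongrightarrow> \<phi> (\<sigma> y)" using ex_rat_seq_tendsto by blast
  then obtain s where s: "\<And>\<sigma>. (\<lambda>n. real_of_rat (s \<sigma> n)) \<longlonglongrightarrow> \<phi> (\<sigma> y)" by metis
  obtain p where p: "map_poly of_rat p = (\<Prod>\<sigma>\<in>?G. [:- \<sigma> y, 1:])" "degree p = dK"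
    using orbit_poly by blast
  have py: "poly (map_poly of_rat p) y = 0"
    unfolding p(1) poly_prod using finite_Gal rat_Gal_id by (intro prod_zero) (auto intro!: bexI[of _ id])
  have map_prod: "map_poly h (prod f I) = (\<Prod>i\<in>I. map_poly h (f i))"
    if "h 0 = 0" "h 1 = 1" "\<And>x y. h (x + y) = h x + h y" "\<And>x y. h (x * y) = h x * h y"
    for h :: "'b::field \<Rightarrow> 'c::field" and f :: "('a \<Rightarrow> 'a) \<Rightarrow> 'b poly" and I
    by (induction I rule: infinite_finite_induct) (simp_all add: that map_poly_hom_mult[of h])
  have pr: "(\<Prod>\<sigma>\<in>?G. [:- \<phi> (\<sigma> y), 1:]) = map_poly real_of_rat p"
  proof -
    have "map_poly \<phi> (\<Prod>\<sigma>\<in>?G. [:- \<sigma> y, 1:]) = (\<Prod>\<sigma>\<in>?G. map_poly \<phi> [:- \<sigma> y, 1:])"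
      by (rule map_prod) (simp_all add: \<phi>_0 \<phi>_1 \<phi>_add \<phi>_mult)
    also have "\<dots> = (\<Prod>\<sigma>\<in>?G. [:- \<phi> (\<sigma> y), 1:])"
      by (intro prod.cong refl) (simp add: map_poly_pCons \<phi>_0 \<phi>_1 \<phi>_minus)
    finally have "(\<Prod>\<sigma>\<in>?G. [:- \<phi> (\<sigma> y), 1:]) = map_poly \<phi> (map_poly of_rat p)" by (simp add: p(1))
    also have "\<dots> = map_poly real_of_rat p"
      by (rule poly_eqI) (simp add: coeff_map_poly \<phi>_0 \<phi>_of_rat)
    finally show ?thesis .
  qed
  define P where "P = (\<lambda>n. \<Prod>\<sigma>\<in>?G. [:- s \<sigma> n, 1:])"
  have degP: "degree (P n) = dK" for n
    unfolding P_def by (subst degree_prod_eq_sum_degree) (simp_all add: card_Gal)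
  have mapP: "map_poly of_rat (P n) = (\<Prod>\<sigma>\<in>?G. [:- of_rat (s \<sigma> n), 1:] :: 'c::field_char_0 poly)" for n
    unfolding P_def by (subst map_prod) (simp_all add: of_rat_add of_rat_mult map_poly_pCons of_rat_minus)
  have "(\<lambda>n. coeff (\<Prod>\<sigma>\<in>?G. [:- real_of_rat (s \<sigma> n), 1:]) k) \<longlonglongrightarrow> coeff (\<Prod>\<sigma>\<in>?G. [:- \<phi> (\<sigma> y), 1:]) k" for k
    using finite_Gal s by (intro tendsto_coeff_prod_linear)
  then have coeffs: "(\<lambda>n. real_of_rat (coeff (P n) k)) \<longlonglongrightarrow> real_of_rat (coeff p k)" for k
    unfolding pr mapP[symmetric] by (simp add: coeff_map_poly)
  have bound: "v (\<Prod>\<sigma>\<in>?G. y - of_rat (s \<sigma> n))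
      \<le> (\<Sum>k\<le>dK. \<bar>real_of_rat (coeff (P n) k) - real_of_rat (coeff p k)\<bar> * v y ^ k)" for n
  proof -
    \<comment> \<open>Subtracting the value of \<open>p\<close> at \<open>y\<close>, which is 0,
      leaves differences of coefficients that tend to 0.\<close>
    have "(\<Prod>\<sigma>\<in>?G. y - of_rat (s \<sigma> n)) = poly (map_poly of_rat (P n)) y - poly (map_poly of_rat p) y"
      by (simp add: mapP poly_prod py)
    also have "\<dots> = (\<Sum>k\<le>dK. of_rat (coeff (P n) k - coeff p k) * y ^ k)"
      by (simp add: poly_altdef degree_map_poly coeff_map_poly degP p(2) sum_subtractf[symmetric]
          of_rat_diff left_diff_distrib)
    finally have "v (\<Prod>\<sigma>\<in>?G. y - of_rat (s \<sigma> n))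
        \<le> (\<Sum>k\<le>dK. v (of_rat (coeff (P n) k - coeff p k) * y ^ k))"
      using absolute_value_sum[OF v] by simp
    then show ?thesis
      unfolding absolute_value_mult[OF v] absolute_value_power[OF v] arch unfolding of_rat_diff .
  qed
  have "(\<lambda>n. \<Sum>k\<le>dK. \<bar>real_of_rat (coeff (P n) k) - real_of_rat (coeff p k)\<bar> * v y ^ k)
      \<longlonglongrightarrow> (\<Sum>k\<le>dK. \<bar>real_of_rat (coeff p k) - real_of_rat (coeff p k)\<bar> * v y ^ k)"
    by (intro tendsto_sum tendsto_mult tendsto_rabs tendsto_diff tendsto_const coeffs)
  then have lim: "(\<lambda>n. \<Sum>k\<le>dK. \<bar>real_of_rat (coeff (P n) k) - real_of_rat (coeff p k)\<bar> * v y ^ k) \<longlonglongrightarrow> 0"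
    by simp
  have epos: "(\<Prod>\<sigma>\<in>?G. e \<sigma>) > 0" using e(1) by (intro prod_pos)
  have "eventually (\<lambda>n. \<forall>\<sigma>\<in>?G. \<bar>real_of_rat (s \<sigma> n) - \<phi> (\<sigma> y)\<bar> < e \<sigma>) sequentially"
    using finite_Gal
  proof (rule eventually_ball_finite, intro ballI)
    fix \<sigma> assume "\<sigma> \<in> ?G"
    from tendstoD[OF s e(1)[OF this], of \<sigma>]
    show "eventually (\<lambda>n. \<bar>real_of_rat (s \<sigma> n) - \<phi> (\<sigma> y)\<bar> < e \<sigma>) sequentially" by (simp add: dist_real_def)
  qed
  moreover have "eventually (\<lambda>n. (\<Sum>k\<le>dK. \<bar>real_of_rat (coeff (P n) k) - real_of_rat (coeff p k)\<bar> * v y ^ k)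
      < (\<Prod>\<sigma>\<in>?G. e \<sigma>)) sequentially"
    using order_tendstoD(2)[OF lim epos] .
  ultimately have "eventually (\<lambda>n. (\<forall>\<sigma>\<in>?G. \<bar>real_of_rat (s \<sigma> n) - \<phi> (\<sigma> y)\<bar> < e \<sigma>) \<and>
      (\<Sum>k\<le>dK. \<bar>real_of_rat (coeff (P n) k) - real_of_rat (coeff p k)\<bar> * v y ^ k)
      < (\<Prod>\<sigma>\<in>?G. e \<sigma>)) sequentially" by (rule eventually_conj)
  then obtain n where n: "\<forall>\<sigma>\<in>?G. \<bar>real_of_rat (s \<sigma> n) - \<phi> (\<sigma> y)\<bar> < e \<sigma>"
    "(\<Sum>k\<le>dK. \<bar>real_of_rat (coeff (P n) k) - real_of_rat (coeff p k)\<bar> * v y ^ k) < (\<Prod>\<sigma>\<in>?G. e \<sigma>)"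
    by (auto simp: eventually_sequentially)
  have "(\<Prod>\<sigma>\<in>?G. e \<sigma>) \<le> (\<Prod>\<sigma>\<in>?G. v (y - of_rat (s \<sigma> n)))"
    using e n(1) by (intro prod_mono) (auto intro: less_imp_le)
  also have "\<dots> = v (\<Prod>\<sigma>\<in>?G. y - of_rat (s \<sigma> n))" by (simp add: absolute_value_prod[OF v])
  also have "\<dots> < (\<Prod>\<sigma>\<in>?G. e \<sigma>)" using bound[of n] n(2) by simp
  finally show False by simp
qed

text \<open>The predicate \<open>A\<close> below says that one rational sequence approximates
  \<open>z\<close> both for \<open>v\<close> and under \<open>\<phi> \<circ> \<sigma>\<close>. It
  holds for \<open>y\<close> and all rationals and passes to sums and products, hence holds
  everywhere. Then \<open>v z\<close> and \<open>\<bar>\<phi> (\<sigma> z)\<bar>\<close> are limits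
  of the same sequence.\<close>

lemma archimedean_eq_abs_conjugate:
  assumes v: "absolute_value v" and arch: "\<And>q. v (of_rat q) = \<bar>real_of_rat q\<bar>"
  obtains \<sigma> where "\<sigma> \<in> rat_Gal" "v = (\<lambda>z::'a. \<bar>\<phi> (\<sigma> z)\<bar>)"
proof -
  obtain y :: 'a where y: "y \<notin> \<rat>" using ex_irrational by blast
  obtain \<sigma> where s: "\<sigma> \<in> rat_Gal"
    and close: "\<And>e. e > 0 \<Longrightarrow> \<exists>q. \<bar>real_of_rat q - \<phi> (\<sigma> y)\<bar> < e \<and> v (y - of_rat q) < e"
    using archimedean_close_rational[OF v arch, of y] by blast
  define A where "A = (\<lambda>z::'a. \<exists>s. (\<lambda>n. real_of_rat (s n)) \<longlonglongrightarrow> \<phi> (\<sigma> z) \<and> (\<lambda>n. v (z - of_rat (s n))) \<longlonglongrightarrow> 0)"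
  have "\<forall>n. \<exists>q. \<bar>real_of_rat q - \<phi> (\<sigma> y)\<bar> < 1 / real (Suc n) \<and> v (y - of_rat q) < 1 / real (Suc n)"
    using close by simp
  then obtain r where r: "\<And>n. \<bar>real_of_rat (r n) - \<phi> (\<sigma> y)\<bar> < 1 / real (Suc n)"
    "\<And>n. v (y - of_rat (r n)) < 1 / real (Suc n)" by metis
  have inv0: "(\<lambda>n. 1 / real (Suc n)) \<longlonglongrightarrow> 0"
    using LIMSEQ_inverse_real_of_nat by (simp add: inverse_eq_divide)
  have A_y: "A y"
    unfolding A_def
  proof (intro exI conjI)
    show "(\<lambda>n. v (y - of_rat (r n))) \<longlonglongrightarrow> 0"
      by (rule tendsto_sandwich[OF _ _ tendsto_const inv0])
        (simp_all add: r(2)[THEN less_imp_le] absolute_value_nonneg[OF v] del: of_nat_Suc)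
    have "(\<lambda>n. \<bar>real_of_rat (r n) - \<phi> (\<sigma> y)\<bar>) \<longlonglongrightarrow> 0"
      by (rule tendsto_sandwich[OF _ _ tendsto_const inv0]) 
        (simp_all add: r(1)[THEN less_imp_le] del: of_nat_Suc)
    then show "(\<lambda>n. real_of_rat (r n)) \<longlonglongrightarrow> \<phi> (\<sigma> y)" by (simp add: tendsto_rabs_zero_iff LIM_zero_iff)
  qed
  have A_rat: "A (of_rat q)" for q
    unfolding A_def by (intro exI[of _ "\<lambda>_. q"]) (simp add: rat_Gal_of_rat[OF s] \<phi>_of_rat absolute_value_0[OF v])
  have A_add: "A (x + z)" if x: "A x" and z: "A z" for x z
  proof -
    obtain s t where st: "(\<lambda>n. real_of_rat (s n)) \<longlonglongrightarrow> \<phi> (\<sigma> x)" "(\<lambda>n. v (x - of_rat (s n))) \<longlonglongrightarrow> 0"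
      "(\<lambda>n. real_of_rat (t n)) \<longlonglongrightarrow> \<phi> (\<sigma> z)" "(\<lambda>n. v (z - of_rat (t n))) \<longlonglongrightarrow> 0"
      using x z unfolding A_def by blast
    have le: "v (x + z - of_rat (s n + t n)) \<le> v (x - of_rat (s n)) + v (z - of_rat (t n))" for n
      using absolute_value_triangle[OF v, of "x - of_rat (s n)" "z - of_rat (t n)"]
      by (simp add: of_rat_add algebra_simps)
    have "(\<lambda>n. v (x + z - of_rat (s n + t n))) \<longlonglongrightarrow> 0"
      by (rule tendsto_sandwich[OF _ _ tendsto_const tendsto_add_zero[OF st(2,4)]])
        (simp_all add: le absolute_value_nonneg[OF v])
    moreover have "(\<lambda>n. real_of_rat (s n + t n)) \<longlonglongrightarrow> \<phi> (\<sigma> (x + z))"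
      using tendsto_add[OF st(1,3)] by (simp add: of_rat_add rat_Gal_add[OF s] \<phi>_add)
    ultimately show ?thesis unfolding A_def by (intro exI[of _ "\<lambda>n. s n + t n"] conjI)
  qed
  have A_mult: "A (x * z)" if x: "A x" and z: "A z" for x z
  proof -
    obtain s t where st: "(\<lambda>n. real_of_rat (s n)) \<longlonglongrightarrow> \<phi> (\<sigma> x)" "(\<lambda>n. v (x - of_rat (s n))) \<longlonglongrightarrow> 0"
      "(\<lambda>n. real_of_rat (t n)) \<longlonglongrightarrow> \<phi> (\<sigma> z)" "(\<lambda>n. v (z - of_rat (t n))) \<longlonglongrightarrow> 0"
      using x z unfolding A_def by blast
    have le: "v (x * z - of_rat (s n * t n))
        \<le> v x * v (z - of_rat (t n)) + \<bar>real_of_rat (t n)\<bar> * v (x - of_rat (s n))" for n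
    proof -
      have eq: "x * z - of_rat (s n * t n) = x * (z - of_rat (t n)) + of_rat (t n) * (x - of_rat (s n))"
        by (simp add: of_rat_mult algebra_simps)
      show ?thesis
        unfolding eq
        using absolute_value_triangle[OF v, of "x * (z - of_rat (t n))" "of_rat (t n) * (x - of_rat (s n))"]
        by (simp only: absolute_value_mult[OF v] arch)
    qed
    have "(\<lambda>n. v x * v (z - of_rat (t n)) + \<bar>real_of_rat (t n)\<bar> * v (x - of_rat (s n)))
        \<longlonglongrightarrow> v x * 0 + \<bar>\<phi> (\<sigma> z)\<bar> * 0"
      using st by (intro tendsto_intros)
    then have "(\<lambda>n. v x * v (z - of_rat (t n)) + \<bar>real_of_rat (t n)\<bar> * v (x - of_rat (s n))) \<longlonglongrightarrow> 0" by simp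
    then have "(\<lambda>n. v (x * z - of_rat (s n * t n))) \<longlonglongrightarrow> 0"
      by (rule tendsto_sandwich[OF _ _ tendsto_const, rotated 2])
        (rule always_eventually, rule allI, rule le absolute_value_nonneg[OF v])+
    moreover have "(\<lambda>n. real_of_rat (s n * t n)) \<longlonglongrightarrow> \<phi> (\<sigma> (x * z))"
      using tendsto_mult[OF st(1,3)] by (simp add: of_rat_mult rat_Gal_mult[OF s] \<phi>_mult)
    ultimately show ?thesis unfolding A_def by (intro exI[of _ "\<lambda>n. s n * t n"] conjI)
  qed
  have "A (poly (map_poly of_rat f) y)" for f
  proof (induction f)
    case 0
    show ?case using A_rat[of 0] by simp
  next
    case (pCons a f)
    have "map_poly of_rat (pCons a f) = pCons (of_rat a) (map_poly of_rat f :: 'a poly)"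
      by (rule poly_eqI) (simp add: coeff_map_poly coeff_pCons split: nat.splits)
    then show ?case using pCons A_rat A_add A_mult A_y by simp
  qed
  then have A: "A z" for z using ex_poly_repr[OF y] by metis
  have "v z = \<bar>\<phi> (\<sigma> z)\<bar>" for z
  proof -
    obtain s where s: "(\<lambda>n. real_of_rat (s n)) \<longlonglongrightarrow> \<phi> (\<sigma> z)" "(\<lambda>n. v (z - of_rat (s n))) \<longlonglongrightarrow> 0"
      using A[of z] unfolding A_def by blast
    have le: "\<bar>\<bar>real_of_rat (s n)\<bar> - v z\<bar> \<le> v (z - of_rat (s n))" for n
      using absolute_value_diff[OF v, of z "of_rat (s n)"] by (simp only: arch abs_minus_commute)
    have "(\<lambda>n. \<bar>\<bar>real_of_rat (s n)\<bar> - v z\<bar>) \<longlonglongrightarrow> 0"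
      by (rule tendsto_sandwich[OF _ _ tendsto_const s(2)])
        (rule always_eventually, rule allI, rule abs_ge_zero le)+
    then have "(\<lambda>n. \<bar>real_of_rat (s n)\<bar> - v z) \<longlonglongrightarrow> 0" by (rule tendsto_rabs_zero_cancel)
    then have "(\<lambda>n. \<bar>real_of_rat (s n)\<bar>) \<longlonglongrightarrow> v z" by (simp add: LIM_zero_iff)
    then show ?thesis using tendsto_rabs[OF s(1)] LIMSEQ_unique by blast
  qed
  then show ?thesis using that s by blast
qed

end

text \<open>The completion at a real embedding is already exhausted by the classes of rational Cauchy
  sequences, as the rationals are dense in the reals.\<close>

lemma local_degree_real_embedding:
  fixes \<psi> :: "'a::field_char_0 \<Rightarrow> real"
  assumes add: "\<And>x y. \<psi> (x + y) = \<psi> x + \<psi> y" and mult: "\<And>x y. \<psi> (x * y) = \<psi> x * \<psi> y"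
    and rat: "\<And>q. \<psi> (of_rat q) = of_rat q"
  shows "local_degree (\<lambda>z. \<bar>\<psi> z\<bar>) = 1"
proof -
  let ?v = "\<lambda>z. \<bar>\<psi> z\<bar>"
  let ?R = "cauchy_ring ?v" and ?I = "null_seqs ?v"
  have zero: "\<psi> 0 = 0" and one: "\<psi> 1 = 1" using rat[of 0] rat[of 1] by simp_all
  have minus: "\<psi> (- x) = - \<psi> x" for x using add[of x "- x"] zero by simp
  have diff: "\<psi> (x - y) = \<psi> x - \<psi> y" for x y using add[of x "- y"] minus by simp
  \<comment> \<open>As the reals are complete, the Cauchy sequences are those whose images converge,
    which reduces the ring axioms to rules about limits.\<close>
  have C: "cauchy_seqs ?v = {s. convergent (\<lambda>n. \<psi> (s n))}"
    by (auto simp: cauchy_seqs_def diff Cauchy_convergent_iff[symmetric] Cauchy_def dist_real_def)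
  have N: "?I = {s. (\<lambda>n. \<psi> (s n)) \<longlonglongrightarrow> 0}"
    by (simp add: null_seqs_def tendsto_rabs_zero_iff)
  have R: "carrier ?R = {s. convergent (\<lambda>n. \<psi> (s n))}" "s \<otimes>\<^bsub>?R\<^esub> t = (\<lambda>n. s n * t n)"
    "s \<oplus>\<^bsub>?R\<^esub> t = (\<lambda>n. s n + t n)" "\<one>\<^bsub>?R\<^esub> = (\<lambda>_. 1)" "\<zero>\<^bsub>?R\<^esub> = (\<lambda>_. 0)" for s t
    by (simp_all add: cauchy_ring_def C)
  have ag: "abelian_group ?R"
  proof (rule abelian_groupI)
    fix x assume "x \<in> carrier ?R"
    then show "\<exists>y\<in>carrier ?R. y \<oplus>\<^bsub>?R\<^esub> x = \<zero>\<^bsub>?R\<^esub>"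
      by (intro bexI[of _ "\<lambda>n. - x n"]) (auto simp: R minus intro: convergent_minus_iff[THEN iffD1])
  qed (auto simp: R add zero algebra_simps intro: convergent_add convergent_const)
  have cr: "cring ?R"
  proof (rule cringI[OF ag])
    show "comm_monoid ?R"
      by (rule comm_monoidI) (auto simp: R mult one algebra_simps intro: convergent_mult convergent_const)
  qed (simp add: R algebra_simps)
  interpret R: cring ?R by (rule cr)
  have Ic: "?I \<subseteq> carrier ?R" by (auto simp: N R convergent_def)
  have uminus: "\<ominus>\<^bsub>?R\<^esub> s = (\<lambda>n. - s n)" if "s \<in> carrier ?R" for s
    using that by (intro R.minus_equality) (auto simp: R minus intro: convergent_minus_iff[THEN iffD1])
  have id: "ideal ?I ?R"
  proof (rule idealI)
    show "subgroup ?I (add_monoid ?R)"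
    proof (rule R.add.subgroupI)
      show "?I \<noteq> {}" using zero by (auto simp: N intro!: exI[of _ "\<lambda>_. 0"])
      fix a b assume a: "a \<in> ?I" and b: "b \<in> ?I"
      show "\<ominus>\<^bsub>?R\<^esub> a \<in> ?I" using a Ic by (subst uminus) (auto simp: N minus intro: tendsto_minus_cancel)
      show "a \<oplus>\<^bsub>?R\<^esub> b \<in> ?I" using tendsto_add_zero[of "\<lambda>n. \<psi> (a n)"] a b by (simp add: N R add)
    qed (use Ic in auto)
    fix a x assume a: "a \<in> ?I" and x: "x \<in> carrier ?R"
    obtain L where "(\<lambda>n. \<psi> (x n)) \<longlonglongrightarrow> L" using x by (auto simp: R convergent_def)
    moreover have "(\<lambda>n. \<psi> (a n)) \<longlonglongrightarrow> 0" using a by (simp add: N)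
    ultimately have "(\<lambda>n. \<psi> (x n) * \<psi> (a n)) \<longlonglongrightarrow> L * 0" by (rule tendsto_mult)
    then show "x \<otimes>\<^bsub>?R\<^esub> a \<in> ?I" "a \<otimes>\<^bsub>?R\<^esub> x \<in> ?I" by (simp_all add: N R mult mult.commute)
  qed (rule R.ring_axioms)
  \<comment> \<open>A sequence with nonzero limit is invertible modulo null sequences by the
    termwise inverse, with \<open>1 / 0 = 0\<close>, so an ideal containing it and all null
    sequences contains 1.\<close>
  have max: "maximalideal ?I ?R"
  proof (rule maximalidealI[OF id])
    have "(\<lambda>_. 1) \<notin> ?I" using LIMSEQ_unique[of "\<lambda>_. 1::real" 1 0] by (auto simp: N one)
    moreover have "(\<lambda>_. 1) \<in> carrier ?R" by (simp add: R convergent_const)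
    ultimately show "carrier ?R \<noteq> ?I" by blast
    fix J assume J: "ideal J ?R" "?I \<subseteq> J" "J \<subseteq> carrier ?R"
    interpret J: ideal J ?R by (rule J(1))
    show "J = ?I \<or> J = carrier ?R"
    proof (cases "J = ?I")
      case False
      with J(2) obtain s where s: "s \<in> J" "s \<notin> ?I" by blast
      then obtain L where L: "(\<lambda>n. \<psi> (s n)) \<longlonglongrightarrow> L" using J(3) by (auto simp: R convergent_def)
      then have L0: "L \<noteq> 0" using s(2) by (auto simp: N)
      define t where "t = (\<lambda>n. 1 / s n)"
      have nz: "s n \<noteq> 0 \<Longrightarrow> \<psi> (s n) * \<psi> (t n) = 1" for n
        using mult[of "s n" "1 / s n"] one by (simp add: t_def)
      have t: "\<psi> (t n) = inverse (\<psi> (s n))" for n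
      proof (cases "s n = 0")
        case False
        from nz[OF this] show ?thesis by (metis inverse_unique)
      qed (simp add: t_def zero)
      have tl: "(\<lambda>n. \<psi> (t n)) \<longlonglongrightarrow> inverse L" unfolding t by (rule tendsto_inverse[OF L L0])
      then have tc: "t \<in> carrier ?R" by (auto simp: R convergent_def)
      have st: "s \<otimes>\<^bsub>?R\<^esub> t \<in> J" using J.I_r_closed[OF s(1) tc] .
      have "(\<lambda>n. \<psi> (1 - s n * t n)) \<longlonglongrightarrow> 1 - L * inverse L"
        unfolding diff one mult using L tl by (intro tendsto_intros)
      then have "(\<lambda>n. 1 - s n * t n) \<in> ?I" using L0 by (simp add: N)
      then have "(\<lambda>n. 1 - s n * t n) \<in> J" using J(2) by blast
      from J.a_closed[OF this st] have "\<one>\<^bsub>?R\<^esub> \<in> J" by (simp add: R)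
      then show ?thesis using J.one_imp_carrier by blast
    qed simp
  qed
  have fld: "field (completion ?v)"
    unfolding completion_def by (rule maximalideal.quotient_is_field[OF max cr])
  interpret F: field "completion ?v" by (rule fld)
  have rc: "rat_completion ?v = carrier (completion ?v)"
  proof
    show "rat_completion ?v \<subseteq> carrier (completion ?v)"
      by (auto simp: rat_completion_def completion_def FactRing_def A_RCOSETS_def' C R)
    show "carrier (completion ?v) \<subseteq> rat_completion ?v"
    proof
      fix X assume "X \<in> carrier (completion ?v)"
      then obtain s where s: "s \<in> carrier ?R" "X = ?I +>\<^bsub>?R\<^esub> s"
        by (auto simp: completion_def FactRing_def A_RCOSETS_def')
      then obtain L where L: "(\<lambda>n. \<psi> (s n)) \<longlonglongrightarrow> L" by (auto simp: R convergent_def)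
      obtain q where q: "(\<lambda>n. real_of_rat (q n)) \<longlonglongrightarrow> L" using ex_rat_seq_tendsto by blast
      define t where "t = (\<lambda>n. of_rat (q n) :: 'a)"
      have tl: "(\<lambda>n. \<psi> (t n)) \<longlonglongrightarrow> L" using q by (simp add: t_def rat)
      then have tc: "t \<in> carrier ?R" by (auto simp: R convergent_def)
      have "s \<ominus>\<^bsub>?R\<^esub> t = (\<lambda>n. s n - t n)"
        unfolding a_minus_def using uminus[OF tc] by (simp add: R)
      moreover have "(\<lambda>n. s n - t n) \<in> ?I" using tendsto_diff[OF L tl] by (simp add: N diff)
      ultimately have "X = ?I +>\<^bsub>?R\<^esub> t"
        using R.quotient_eq_iff_same_a_r_cos[OF id s(1) tc] s(2) by simp
      moreover have "range t \<subseteq> \<rat>" by (auto simp: t_def)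
      ultimately show "X \<in> rat_completion ?v" using tc by (auto simp: rat_completion_def C R)
    qed
  qed
  have dim1: "F.dimension 1 (carrier (completion ?v)) (carrier (completion ?v))"
    by (rule F.dimension_one[OF F.carrier_is_subfield])
  have "n = 1" if "F.dimension n (carrier (completion ?v)) (carrier (completion ?v))" for n
    by (rule F.dimension_is_inj[OF F.carrier_is_subfield that dim1])
  with dim1 show ?thesis unfolding local_degree_def rc by (rule the_equality)
qed

section \<open>Bounding the height by the trace form\<close>

context totally_real_galois
begin

text \<open>The places with \<open>v \<beta> > 1\<close> inject into the automorphisms and have
  local degree 1; the factors of the remaining automorphisms are at least 1.\<close>

lemma weil_height_le_conjugates:
  assumes a: "algebraic_int (\<beta>::'a)"
  shows "weil_height \<beta> \<le> (\<Prod>\<sigma>\<in>rat_Gal. max 1 \<bar>\<phi> (\<sigma> \<beta>)\<bar>) powr (1 / real dK)"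
proof -
  let ?G = "rat_Gal :: ('a \<Rightarrow> 'a) set"
  let ?S = "{v \<in> places. v \<beta> > 1}"
  define V where "V = (\<lambda>(\<sigma> :: 'a \<Rightarrow> 'a) z. \<bar>\<phi> (\<sigma> z)\<bar>)"
  define h where "h = (\<lambda>\<sigma> :: 'a \<Rightarrow> 'a. max 1 \<bar>\<phi> (\<sigma> \<beta>)\<bar> powr (1 / real dK))"
  have place: "\<exists>\<sigma>\<in>?G. v = V \<sigma>" if v: "v \<in> ?S" for v
  proof -
    have av: "absolute_value v" using v by (simp add: places_def)
    have "\<forall>q. v (of_rat q) = \<bar>real_of_rat q\<bar>"
    proof (rule ccontr)
      assume "\<not> ?thesis"
      then obtain p where "prime p" "\<forall>q. v (of_rat q) = padic_abs p q" using v by (auto simp: places_def)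
      then have "v \<beta> \<le> 1" using nonarchimedean_le_1[OF av] a by blast
      then show False using v by simp
    qed
    then obtain \<sigma> where "\<sigma> \<in> ?G" "v = (\<lambda>z. \<bar>\<phi> (\<sigma> z)\<bar>)"
      using archimedean_eq_abs_conjugate[OF av] by blast
    then show ?thesis unfolding V_def by blast
  qed
  have "\<forall>v\<in>?S. \<exists>\<sigma>. \<sigma> \<in> ?G \<and> v = V \<sigma>" using place by blast
  from bchoice[OF this] obtain g where "\<forall>v\<in>?S. g v \<in> ?G \<and> v = V (g v)" ..
  then have g: "g v \<in> ?G" "v = V (g v)" if "v \<in> ?S" for v
    using that by blast+
  have inj: "inj_on g ?S"
  proof (rule inj_onI)
    fix v w assume "v \<in> ?S" "w \<in> ?S" "g v = g w"
    then show "v = w" using g(2)[of v] g(2)[of w] by simp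
  qed
  have h1: "h \<sigma> \<ge> 1" for \<sigma> unfolding h_def by (rule ge_one_powr_ge_zero) auto
  have ld: "local_degree v = 1" if v: "v \<in> ?S" for v
  proof -
    have G: "g v \<in> ?G" by (rule g(1)[OF v])
    have "local_degree (\<lambda>z. \<bar>\<phi> (g v z)\<bar>) = 1"
      by (rule local_degree_real_embedding)
        (simp_all add: rat_Gal_add[OF G] rat_Gal_mult[OF G] rat_Gal_of_rat[OF G] \<phi>_add \<phi>_mult \<phi>_of_rat)
    then show ?thesis using g(2)[OF v] by (simp add: V_def)
  qed
  have "weil_height \<beta> = (\<Prod>v\<in>?S. h (g v))"
    unfolding weil_height_def
  proof (rule prod.cong[OF refl])
    fix v assume v: "v \<in> ?S"
    have "v \<beta> = \<bar>\<phi> (g v \<beta>)\<bar>" using g(2)[OF v] by (metis V_def)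
    then show "max 1 (v \<beta>) powr (real (local_degree v) / real (rat_degree TYPE('a))) = h (g v)"
      by (simp add: ld[OF v] h_def rat_degree_def)
  qed
  also have "\<dots> = (\<Prod>\<sigma>\<in>g ` ?S. h \<sigma>)" by (simp add: prod.reindex[OF inj])
  also have "\<dots> \<le> (\<Prod>\<sigma>\<in>?G. h \<sigma>)"
    using finite_Gal g(1) h1 by (intro prod_mono2) (auto intro: order_trans[OF zero_le_one])
  also have "\<dots> = (\<Prod>\<sigma>\<in>?G. max 1 \<bar>\<phi> (\<sigma> \<beta>)\<bar>) powr (1 / real dK)"
    by (simp add: h_def prod_powr_distrib)
  finally show ?thesis .
qed

text \<open>Over the conjugates, \<open>max 1 \<bar>x\<bar> ^ 2 \<le> 1 + x ^ 2\<close> has mean at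
  most the left-hand side of the hypothesis on \<open>A\<close>.\<close>

lemma weil_height_le:
  assumes a: "algebraic_int (\<beta>::'a)" and A: "1 + real_of_rat (rat_trace (\<beta> * \<beta>)) / real dK \<le> A"
  shows "weil_height \<beta> \<le> A powr (1 / 2)"
proof -
  let ?G = "rat_Gal :: ('a \<Rightarrow> 'a) set"
  let ?M = "\<Prod>\<sigma>\<in>?G. max 1 \<bar>\<phi> (\<sigma> \<beta>)\<bar>"
  have dpos: "real dK > 0" using deg_pos by simp
  have trp: "0 \<le> real_of_rat (rat_trace (\<beta> * \<beta>))"
    unfolding rat_trace_square by (intro sum_nonneg) simp
  then have A1: "A > 0" using A dpos by (smt (verit) divide_nonneg_pos)
  have sq: "max 1 \<bar>x\<bar> ^ 2 \<le> 1 + x ^ 2" for x :: real by (auto simp: max_def)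
  have "?M ^ 2 = (\<Prod>\<sigma>\<in>?G. max 1 \<bar>\<phi> (\<sigma> \<beta>)\<bar> ^ 2)" by (simp add: prod_power_distrib)
  also have "\<dots> \<le> A ^ card ?G"
  proof (rule prod_le_mean_power[OF finite_Gal _ A1])
    have "(\<Sum>\<sigma>\<in>?G. max 1 \<bar>\<phi> (\<sigma> \<beta>)\<bar> ^ 2) \<le> (\<Sum>\<sigma>\<in>?G. 1 + \<phi> (\<sigma> \<beta>) ^ 2)" by (intro sum_mono sq)
    also have "\<dots> = real dK + real_of_rat (rat_trace (\<beta> * \<beta>))"
      by (simp add: sum.distrib card_Gal rat_trace_square)
    also have "\<dots> \<le> A * real dK" using A dpos by (simp add: field_simps)
    finally show "(\<Sum>\<sigma>\<in>?G. max 1 \<bar>\<phi> (\<sigma> \<beta>)\<bar> ^ 2) \<le> A * real (card ?G)" by (simp add: card_Gal)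
  qed simp
  finally have M2: "?M ^ 2 \<le> A ^ dK" by (simp add: card_Gal)
  have Mp: "?M > 0" by (intro prod_pos) auto
  have "weil_height \<beta> \<le> ?M powr (1 / real dK)" by (rule weil_height_le_conjugates[OF a])
  also have "\<dots> = (?M ^ 2) powr (1 / (2 * real dK))"
    using Mp by (simp add: powr_powr flip: powr_numeral)
  also have "\<dots> \<le> (A ^ dK) powr (1 / (2 * real dK))" using M2 Mp by (intro powr_mono2) auto
  also have "\<dots> = A powr (1 / 2)"
    using A1 dpos by (simp add: powr_powr flip: powr_realpow)
  finally show ?thesis .
qed

subsection \<open>A small normal basis\<close>

text \<open>As the basis ends with 1, the last pivot is the trace of 1, that is \<open>dK\<close>;
  the other pivots therefore multiply to the discriminant divided by \<open>dK\<close>.\<close>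

lemma trace_form_split:
  assumes b: "int_frame b"
  obtains t u where "\<And>k. k < dK - 1 \<Longrightarrow> t k > 0"
    "(\<Prod>k<dK - 1. t k) * of_nat dK = gram_det dK b"
    "\<And>x :: nat \<Rightarrow> int. rat_trace (\<Sum>i<dK. of_int (x i) * b i)
      = of_nat dK * (of_int (x (dK - 1)) + (\<Sum>i<dK - 1. u (dK - 1) i * of_int (x i)))"
    "\<And>x :: nat \<Rightarrow> int. rat_trace ((\<Sum>i<dK. of_int (x i) * b i) * (\<Sum>i<dK. of_int (x i) * b i))
      = (\<Sum>k<dK - 1. t k * (of_int (x k) + (\<Sum>i<k. u k i * of_int (x i))) ^ 2)
        + of_nat dK * (of_int (x (dK - 1)) + (\<Sum>i<dK - 1. u (dK - 1) i * of_int (x i))) ^ 2"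
proof -
  define m where "m = dK - 1"
  have dm: "dK = Suc m" using dK_ge_3 by (simp add: m_def)
  have ind: "rat_indep dK b" and b1: "b m = 1" using b by (simp_all add: int_frame_def m_def)
  obtain t U where t: "\<And>k. k < dK \<Longrightarrow> t k > 0" and U1: "\<And>k. U k k = 1" and U0: "\<And>k i. k < i \<Longrightarrow> U k i = 0"
    and G: "\<And>i j. i < dK \<Longrightarrow> j < dK \<Longrightarrow> rat_trace (b i * b j) = (\<Sum>k<dK. t k * U k i * U k j)"
    and det: "gram_det dK b = (\<Prod>k<dK. t k)"
    by (rule gram_LDL[OF ind]) (rule that)
  \<comment> \<open>The last column of the triangular \<open>U\<close> has its only nonzero entry in
    row \<open>m\<close>.\<close>
  have last: "rat_trace (b m * b i) = t m * U m i" if "i < dK" for i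
  proof -
    have "rat_trace (b m * b i) = (\<Sum>k<dK. t k * U k m * U k i)" using that dm by (intro G) auto
    also have "\<dots> = t m * U m i" by (simp add: dm U0 U1)
    finally show ?thesis .
  qed
  have tm: "t m = of_nat dK"
    using last[of m] rat_trace_of_rat[of 1] dm by (simp add: b1 U1)
  have l: "(\<Sum>i<dK. U k i * x i) = x k + (\<Sum>i<k. U k i * x i)" if "k < dK" for k and x :: "nat \<Rightarrow> rat"
  proof -
    have "(\<Sum>i<dK. U k i * x i) = (\<Sum>i<Suc k. U k i * x i)"
      using that U0 by (intro sum.mono_neutral_right) auto
    then show ?thesis by (simp add: U1)
  qed
  have T1: "rat_trace (\<Sum>i<dK. of_int (x i) * b i) = of_nat dK * (of_int (x m) + (\<Sum>i<m. U m i * of_int (x i)))"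
    for x :: "nat \<Rightarrow> int"
  proof -
    have "rat_trace (\<Sum>i<dK. of_int (x i) * b i) = (\<Sum>i<dK. rat_trace (of_rat (of_int (x i)) * (b m * b i)))"
      by (simp add: rat_trace_sum b1)
    also have "\<dots> = (\<Sum>i<dK. of_int (x i) * (t m * U m i))"
      by (intro sum.cong refl) (simp only: rat_trace_of_rat_mult last lessThan_iff)
    also have "\<dots> = t m * (\<Sum>i<dK. U m i * of_int (x i))"
      by (simp add: sum_distrib_left mult_ac)
    finally show ?thesis using l[of m "\<lambda>i. of_int (x i)"] dm by (simp add: tm)
  qed
  have T2: "rat_trace ((\<Sum>i<dK. of_int (x i) * b i) * (\<Sum>i<dK. of_int (x i) * b i))
      = (\<Sum>k<m. t k * (of_int (x k) + (\<Sum>i<k. U k i * of_int (x i))) ^ 2)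
        + of_nat dK * (of_int (x m) + (\<Sum>i<m. U m i * of_int (x i))) ^ 2" for x :: "nat \<Rightarrow> int"
  proof -
    have "rat_trace ((\<Sum>i<dK. of_rat (of_int (x i)) * b i) * (\<Sum>j<dK. of_rat (of_int (x j)) * b j))
        = (\<Sum>i<dK. \<Sum>j<dK. (\<Sum>k<dK. t k * U k i * U k j) * of_int (x i) * of_int (x j))"
      unfolding rat_trace_lincomb by (intro sum.cong refl) (simp add: G)
    also have "\<dots> = (\<Sum>i<dK. \<Sum>j<dK. \<Sum>k<dK. t k * ((U k i * of_int (x i)) * (U k j * of_int (x j))))"
      by (simp add: sum_distrib_left sum_distrib_right mult_ac)
    also have "\<dots> = (\<Sum>i<dK. \<Sum>k<dK. \<Sum>j<dK. t k * ((U k i * of_int (x i)) * (U k j * of_int (x j))))"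
      by (intro sum.cong refl sum.swap)
    also have "\<dots> = (\<Sum>k<dK. \<Sum>i<dK. \<Sum>j<dK. t k * ((U k i * of_int (x i)) * (U k j * of_int (x j))))"
      by (rule sum.swap)
    also have "\<dots> = (\<Sum>k<dK. t k * (\<Sum>i<dK. U k i * of_int (x i)) ^ 2)"
      unfolding power2_eq_square sum_product by (simp only: sum_distrib_left)
    also have "\<dots> = (\<Sum>k<dK. t k * (of_int (x k) + (\<Sum>i<k. U k i * of_int (x i))) ^ 2)"
      by (intro sum.cong refl) (simp add: l)
    finally show ?thesis by (simp add: dm tm[unfolded dm])
  qed
  show ?thesis
  proof (rule that[of t U, folded m_def])
    show "t k > 0" if "k < m" for k using t that dm by simp
    show "(\<Prod>k<m. t k) * of_nat dK = gram_det dK b" unfolding det using tm by (simp add: dm)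
  qed (rule T1 T2)+
qed

text \<open>The first \<open>dK - 1\<close> forms, weighted by the roots of their pivots, all get
  the bound \<open>sqrt C\<close>. The last coordinate enters only the trace part, so it is set to 0
  and left to the shift \<open>j\<close>. Irrationality holds because an earlier coordinate is
  nonzero.\<close>

lemma ex_small_irrational:
  assumes b: "int_frame b" and C: "C > 0" and CD: "real_of_rat (gram_det dK b) / real dK < C ^ (dK - 1)"
  obtains \<beta> :: 'a and \<tau> where "algebraic_int \<beta>" "\<beta> \<notin> \<rat>"
    "\<And>j::int. rat_trace (\<beta> + of_int j) = of_nat dK * (\<tau> + of_int j)"
    "\<And>j::int. real_of_rat (rat_trace ((\<beta> + of_int j) * (\<beta> + of_int j)))
      \<le> real (dK - 1) * C + real dK * (real_of_rat \<tau> + of_int j) ^ 2"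
proof -
  define m where "m = dK - 1"
  have dm: "dK = Suc m" using dK_ge_3 by (simp add: m_def)
  have ind: "rat_indep dK b" and b1: "b m = 1" and ai: "\<And>i. i < dK \<Longrightarrow> algebraic_int (b i)"
    using b by (simp_all add: int_frame_def m_def)
  obtain t u where t: "\<And>k. k < m \<Longrightarrow> t k > 0" and det: "(\<Prod>k<m. t k) * of_nat dK = gram_det dK b"
    and T1: "\<And>x :: nat \<Rightarrow> int. rat_trace (\<Sum>i<dK. of_int (x i) * b i)
      = of_nat dK * (of_int (x m) + (\<Sum>i<m. u m i * of_int (x i)))"
    and T2: "\<And>x :: nat \<Rightarrow> int. rat_trace ((\<Sum>i<dK. of_int (x i) * b i) * (\<Sum>i<dK. of_int (x i) * b i))
      = (\<Sum>k<m. t k * (of_int (x k) + (\<Sum>i<k. u k i * of_int (x i))) ^ 2)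
        + of_nat dK * (of_int (x m) + (\<Sum>i<m. u m i * of_int (x i))) ^ 2"
    by (rule trace_form_split[OF b, folded m_def]) (rule that)
  have "(\<Prod>k<m. real_of_rat (t k)) = real_of_rat (gram_det dK b) / real dK"
    using det dK_ge_3 by (simp add: of_rat_prod[symmetric] of_rat_mult field_simps flip: det)
  then have "(\<Prod>k<m. real_of_rat (t k)) < C ^ m" using CD by (simp add: m_def)
  then have lt: "(\<Prod>k<m. sqrt (real_of_rat (t k))) < (\<Prod>k<m. sqrt C)"
  proof -
    have sqrt_prod: "(\<Prod>k<n. sqrt (f k)) = sqrt (\<Prod>k<n. f k)" for f :: "nat \<Rightarrow> real" and n
      by (induction n) (simp_all add: real_sqrt_mult)
    show ?thesis unfolding sqrt_prod using \<open>(\<Prod>k<m. real_of_rat (t k)) < C ^ m\<close> by simp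
  qed
  have st: "sqrt (real_of_rat (t k)) > 0" if "k < m" for k using t[OF that] by simp
  have sC: "sqrt C > 0" using C by simp
  obtain x :: "nat \<Rightarrow> int" where x0: "\<exists>i<m. x i \<noteq> 0"
    and x: "\<And>k. k < m \<Longrightarrow> sqrt (real_of_rat (t k)) *
      \<bar>of_int (x k) + (\<Sum>i<k. real_of_rat (u k i) * of_int (x i))\<bar> < sqrt C"
    by (rule unitriangular_small_vector[where u = "\<lambda>k i. real_of_rat (u k i)", OF st sC lt],
        assumption) (rule that)
  define \<beta> where "\<beta> = (\<Sum>i<dK. of_int ((x(m := 0)) i) * b i)"
  define \<tau> where "\<tau> = (\<Sum>i<m. u m i * of_int (x i))"
  have eq: "\<beta> + of_int j = (\<Sum>i<dK. of_int ((x(m := j)) i) * b i)" for j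
    by (simp add: \<beta>_def dm b1)
  show ?thesis
  proof (rule that[of \<beta> \<tau>])
    show "algebraic_int \<beta>"
      unfolding \<beta>_def using ai by (intro algebraic_int_sum algebraic_int_int_scale) auto
    show "\<beta> \<notin> \<rat>"
    proof
      assume "\<beta> \<in> \<rat>"
      then obtain q where q: "\<beta> = of_rat q" by (auto elim: Rats_cases)
      have "(\<Sum>i<dK. of_rat (if i = m then - q else of_int (x i)) * b i) = 0"
        using q by (simp add: \<beta>_def dm b1 of_rat_minus)
      then have "(if i = m then - q else of_int (x i)) = 0" if "i < dK" for i
        using rat_indepD[OF ind, where x = "\<lambda>i. if i = m then - q else of_int (x i)" and i = i] that by blast
      then have "x i = 0" if "i < m" for i using that dm by (metis less_SucI nat_neq_iff of_int_eq_0_iff)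
      with x0 show False by blast
    qed
    show "rat_trace (\<beta> + of_int j) = of_nat dK * (\<tau> + of_int j)" for j
      unfolding eq T1 by (simp add: \<tau>_def)
    fix j :: int
    have "real_of_rat (t k * (of_int (x k) + (\<Sum>i<k. u k i * of_int (x i))) ^ 2) \<le> C" if k: "k < m" for k
    proof -
      let ?l = "of_int (x k) + (\<Sum>i<k. real_of_rat (u k i) * of_int (x i))"
      have "(sqrt (real_of_rat (t k)) * \<bar>?l\<bar>) ^ 2 \<le> sqrt C ^ 2"
        using x[OF k] t[OF k] by (intro power_mono) auto
      then have "real_of_rat (t k) * ?l ^ 2 \<le> C" using t[OF k] C by (simp add: power_mult_distrib)
      then show ?thesis by (simp add: of_rat_mult of_rat_power of_rat_add of_rat_sum)
    qed
    then have "(\<Sum>k<m. real_of_rat (t k * (of_int (x k) + (\<Sum>i<k. u k i * of_int (x i))) ^ 2)) \<le> (\<Sum>k<m. C)"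
      by (intro sum_mono) auto
    moreover have "rat_trace ((\<beta> + of_int j) * (\<beta> + of_int j))
        = (\<Sum>k<m. t k * (of_int (x k) + (\<Sum>i<k. u k i * of_int (x i))) ^ 2) + of_nat dK * (\<tau> + of_int j) ^ 2"
      unfolding eq T2 by (simp add: \<tau>_def add.commute)
    ultimately show "real_of_rat (rat_trace ((\<beta> + of_int j) * (\<beta> + of_int j)))
        \<le> real (dK - 1) * C + real dK * (real_of_rat \<tau> + of_int j) ^ 2"
      by (simp add: of_rat_add of_rat_mult of_rat_power of_rat_sum m_def)
  qed
qed

lemma gram_det_gt_degree:
  assumes b: "int_frame b"
  shows "real dK < real_of_rat (gram_det dK b)"
proof (rule ccontr)
  assume "\<not> real dK < real_of_rat (gram_det dK b)"
  moreover have d3: "real dK \<ge> 3" using dK_ge_3 by simp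
  ultimately have le: "real_of_rat (gram_det dK b) / real dK \<le> 1" by simp
  \<comment> \<open>Any \<open>C > 1\<close> passes the pigeonhole condition. This one has
    \<open>(dK - 1) * C = dK - 1 / dK\<close>, so with \<open>dK / 4\<close> from rounding the trace
    form stays strictly below \<open>5/4 * dK\<close>.\<close>
  define C where "C = 1 + 1 / real dK"
  have C: "C > 1" using d3 by (simp add: C_def)
  have "1 < C ^ (dK - 1)" using C dK_ge_3 by (intro one_less_power) auto
  with le have CD: "real_of_rat (gram_det dK b) / real dK < C ^ (dK - 1)" by simp
  obtain \<beta> :: 'a and \<tau> where \<beta>: "algebraic_int \<beta>" "\<beta> \<notin> \<rat>"
    and tr: "\<And>j::int. rat_trace (\<beta> + of_int j) = of_nat dK * (\<tau> + of_int j)"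
    and tr2: "\<And>j::int. real_of_rat (rat_trace ((\<beta> + of_int j) * (\<beta> + of_int j)))
      \<le> real (dK - 1) * C + real dK * (real_of_rat \<tau> + of_int j) ^ 2"
    by (rule ex_small_irrational[OF b _ CD]) (use C in simp, rule that)
  define j where "j = - round (real_of_rat \<tau>)"
  have "\<bar>real_of_rat \<tau> + of_int j\<bar> \<le> 1/2"
    using of_int_round_abs_le[of "real_of_rat \<tau>"] by (simp add: j_def abs_minus_commute)
  then have "\<bar>real_of_rat \<tau> + of_int j\<bar> ^ 2 \<le> (1/2) ^ 2" by (intro power_mono) auto
  then have j: "(real_of_rat \<tau> + of_int j) ^ 2 \<le> 1/4" by (simp add: power2_eq_square)
  have irr: "\<beta> + of_int j \<notin> \<rat>"
  proof
    assume "\<beta> + of_int j \<in> \<rat>"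
    then have "\<beta> + of_int j - of_int j \<in> \<rat>" by (intro Rats_diff) auto
    then show False using \<beta>(2) by simp
  qed
  have "algebraic_int (\<beta> + of_int j)" using \<beta>(1) by (intro algebraic_int_plus_times) auto
  from rat_trace_square_ge[OF this irr]
  have "5/4 * real dK \<le> real_of_rat (rat_trace ((\<beta> + of_int j) * (\<beta> + of_int j)))" .
  also have "\<dots> \<le> real (dK - 1) * C + real dK * (1/4)"
    using tr2[of j] mult_left_mono[OF j, of "real dK"] by simp
  also have "real (dK - 1) * C = real dK - 1 / real dK"
    using d3 by (simp add: C_def of_nat_diff field_simps)
  finally show False using d3 by simp
qed

lemma ex_small_normal_generator:
  "\<exists>\<beta>. algebraic_int \<beta> \<and> \<beta> \<notin> \<rat> \<and> gal_trace (\<beta>::'a) \<noteq> 0 \<and>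
    1 + real_of_rat (rat_trace (\<beta> * \<beta>)) / real dK \<le> real_of_rat (field_disc T)"
proof -
  obtain b where b: "int_frame b" and bd: "gram_det dK b \<le> field_disc T"
    by (rule integral_frame_field_disc) (rule that)
  define R where "R = real_of_rat (gram_det dK b)"
  have R: "R > real dK" unfolding R_def by (rule gram_det_gt_degree[OF b])
  have d3: "real dK \<ge> 3" using dK_ge_3 by simp
  define C where "C = R / real dK"
  have C: "C > 1" using R d3 by (simp add: C_def)
  \<comment> \<open>Here \<open>dK - 1 \<ge> 2\<close> enters: the power strictly exceeds
    \<open>C\<close>.\<close>
  have "C ^ 1 < C ^ (dK - 1)" using C dK_ge_3 by (intro power_strict_increasing) auto
  then have CD: "real_of_rat (gram_det dK b) / real dK < C ^ (dK - 1)" by (simp add: C_def R_def)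
  obtain \<beta> :: 'a and \<tau> where \<beta>: "algebraic_int \<beta>" "\<beta> \<notin> \<rat>"
    and tr: "\<And>j::int. rat_trace (\<beta> + of_int j) = of_nat dK * (\<tau> + of_int j)"
    and tr2: "\<And>j::int. real_of_rat (rat_trace ((\<beta> + of_int j) * (\<beta> + of_int j)))
      \<le> real (dK - 1) * C + real dK * (real_of_rat \<tau> + of_int j) ^ 2"
    by (rule ex_small_irrational[OF b _ CD]) (use C in simp, rule that)
  \<comment> \<open>Moving \<open>\<tau>\<close> into \<open>(0, 1]\<close>, and not to the nearest
    integer, excludes trace 0.\<close>
  define j where "j = 1 - \<lceil>\<tau>\<rceil>"
  have j: "0 < \<tau> + of_int j" "\<tau> + of_int j \<le> 1" using ceiling_correct[of \<tau>] by (simp_all add: j_def)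
  define \<gamma> where "\<gamma> = \<beta> + of_int j"
  have "\<gamma> \<notin> \<rat>"
  proof
    assume "\<gamma> \<in> \<rat>"
    then have "\<gamma> - of_int j \<in> \<rat>" by (intro Rats_diff) auto
    then show False using \<beta>(2) by (simp add: \<gamma>_def)
  qed
  moreover have "algebraic_int \<gamma>" unfolding \<gamma>_def using \<beta>(1) by (intro algebraic_int_plus_times) auto
  moreover have "gal_trace \<gamma> \<noteq> 0"
    using tr[of j] j(1) dK_ge_3 rat_trace_eq_gal_trace[of \<gamma>] by (auto simp: \<gamma>_def)
  moreover have "1 + real_of_rat (rat_trace (\<gamma> * \<gamma>)) / real dK \<le> real_of_rat (field_disc T)"
  proof -
    have "real_of_rat (\<tau> + of_int j) ^ 2 \<le> 1 ^ 2"
    proof (rule power_mono)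
      show "real_of_rat (\<tau> + of_int j) \<le> 1" using j(2) by (metis of_rat_1 of_rat_less_eq)
      show "0 \<le> real_of_rat (\<tau> + of_int j)" using j(1) by simp
    qed
    then have "(real_of_rat \<tau> + of_int j) ^ 2 \<le> 1" by (simp add: of_rat_add)
    from mult_left_mono[OF this, of "real dK"] tr2[of j]
    have "real_of_rat (rat_trace (\<gamma> * \<gamma>)) \<le> real (dK - 1) * C + real dK" by (simp add: \<gamma>_def)
    also have "\<dots> \<le> real dK * C + real dK" using C by simp
    finally have "real_of_rat (rat_trace (\<gamma> * \<gamma>)) / real dK \<le> C + 1"
      using d3 by (simp add: field_simps)
    \<comment> \<open>The total is at most \<open>R / 3 + 2\<close>, which is at most
      \<open>R\<close> because \<open>R > 3\<close>.\<close>
    moreover have "C \<le> R / 3" unfolding C_def using R d3 by (intro divide_left_mono) auto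
    ultimately have "1 + real_of_rat (rat_trace (\<gamma> * \<gamma>)) / real dK \<le> R" using R d3 by linarith
    also have "R \<le> real_of_rat (field_disc T)" unfolding R_def using bd by (simp add: of_rat_less_eq)
    finally show ?thesis .
  qed
  ultimately show ?thesis by blast
qed

lemma small_normal_basis:
  "\<exists>\<beta> :: nat \<Rightarrow> 'a. inj_on \<beta> {1..dK} \<and> normal_basis (\<beta> ` {1..dK}) \<and>
    (\<forall>i\<in>{1..dK}. algebraic_int (\<beta> i)) \<and>
    (\<forall>i\<in>{1..dK}. weil_height (\<beta> i) \<le> real_of_rat \<bar>field_disc T\<bar> powr (1 / 2))"
proof -
  obtain \<beta> :: 'a where \<beta>: "algebraic_int \<beta>" "\<beta> \<notin> \<rat>" "gal_trace \<beta> \<noteq> 0"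
    and small: "1 + real_of_rat (rat_trace (\<beta> * \<beta>)) / real dK \<le> real_of_rat (field_disc T)"
    using ex_small_normal_generator by blast
  obtain h where h: "bij_betw h {1..dK} (rat_Gal :: ('a \<Rightarrow> 'a) set)"
    using ex_bij_betw_nat_finite_1[OF finite_Gal] by (auto simp: card_Gal)
  define c where "c = (\<lambda>i. h i \<beta>)"
  have hG: "h i \<in> rat_Gal" if "i \<in> {1..dK}" for i using h that by (auto simp: bij_betw_def)
  have "inj_on c {1..dK}"
    using comp_inj_on[of h "{1..dK}" "\<lambda>\<sigma>. \<sigma> \<beta>"] inj_on_conjugates[OF \<beta>(2)] h
    by (simp add: bij_betw_def c_def comp_def)
  moreover have "c ` {1..dK} = (\<lambda>\<sigma>. \<sigma> \<beta>) ` rat_Gal"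
  proof -
    have "c ` {1..dK} = (\<lambda>\<sigma>. \<sigma> \<beta>) ` (h ` {1..dK})" by (simp add: c_def image_image)
    then show ?thesis using h by (simp add: bij_betw_def)
  qed
  moreover have "algebraic_int (c i)" if "i \<in> {1..dK}" for i
    unfolding c_def by (rule rat_Gal_algebraic_int[OF hG[OF that] \<beta>(1)])
  moreover have "weil_height (c i) \<le> real_of_rat \<bar>field_disc T\<bar> powr (1 / 2)" if i: "i \<in> {1..dK}" for i
  proof -
    \<comment> \<open>The conjugates share the trace of the square, so one bound serves the whole
      basis.\<close>
    have "rat_trace (c i * c i) = rat_trace (\<beta> * \<beta>)"
      using rat_trace_conj[OF hG[OF i], of "\<beta> * \<beta>"] by (simp add: c_def rat_Gal_mult[OF hG[OF i]])
    then have "weil_height (c i) \<le> real_of_rat (field_disc T) powr (1 / 2)"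
      using small rat_Gal_algebraic_int[OF hG[OF i] \<beta>(1)] by (intro weil_height_le) (simp_all add: c_def)
    also have "\<dots> \<le> real_of_rat \<bar>field_disc T\<bar> powr (1 / 2)"
    proof (rule powr_mono2)
      have "0 \<le> real_of_rat (rat_trace (\<beta> * \<beta>))"
        unfolding rat_trace_square by (intro sum_nonneg) simp
      then have "0 \<le> 1 + real_of_rat (rat_trace (\<beta> * \<beta>)) / real dK" by simp
      then show "0 \<le> real_of_rat (field_disc T)" using small by linarith
    qed (simp_all add: of_rat_less_eq)
    finally show ?thesis .
  qed
  ultimately show ?thesis using normal_basis_if[OF \<beta>(2,3)] by (intro exI[of _ c]) auto
qed

end

theorem theorem1p3:
  fixes d :: nat
  assumes "rat_galois TYPE('a::field_char_0)"
    and "rat_degree TYPE('a) = d"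
    and "prime d" and "d \<ge> 3"
  shows "\<exists>\<beta> :: nat \<Rightarrow> 'a.
    inj_on \<beta> {1..d} \<and> normal_basis (\<beta> ` {1..d}) \<and>
    (\<forall>i\<in>{1..d}. algebraic_int (\<beta> i)) \<and>
    (\<forall>i\<in>{1..d}. weil_height (\<beta> i) \<le> real_of_rat \<bar>field_disc TYPE('a)\<bar> powr (1 / 2))"
proof -
  interpret prime_galois "TYPE('a)" by unfold_locales (use assms in simp_all)
  obtain \<phi> :: "'a \<Rightarrow> real" where \<phi>: "\<And>x y. \<phi> (x + y) = \<phi> x + \<phi> y" "\<And>x y. \<phi> (x * y) = \<phi> x * \<phi> y"
    "\<And>q. \<phi> (of_rat q) = of_rat q" using ex_real_embedding by blast
  interpret totally_real_galois "TYPE('a)" \<phi> by unfold_locales (fact \<phi>)+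
  show ?thesis using small_normal_basis assms(2) by simp
qed

end
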